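(* Consider the panel change point model $Y_{i,t}=\mu_i+\delta_i\mathcal{I}\{t>\tau\}+\sigma\varepsilon_{i,t}$, $1\le i\le N$, $1\le t\le T$, with $T\ge4$ fixed, $\tau\in\{1,\ldots,T\}$ (both $\tau=T$ and $\tau<T$ are allowed), and error vectors satisfying the conditions in the context. Let $\widehat{\tau}_N$ be an estimator of $\tau$, computed from $\mathbb{Y}=\{Y_{i,t}\}_{i,t=1}^{N,T}$ with values in $\{1,\ldots,T\}$, such that $\lim_{N\to\infty}\mathsf{P}[\widehat{\tau}_N=\tau]=1$, and suppose $\mathsf{E}\varepsilon_{1,t}^4<\infty$ for all $t\in\{1,\ldots,T\}$. Let $\mathcal{R}_N^*(T)$ be the bootstrap statistic defined in the context. Then, as $N\to\infty$, the conditional distribution of $\mathcal{R}_N^*(T)$ given $\mathbb{Y}$ converges weakly, in probability $\mathsf{P}$, to the distribution of $$\max_{t=2,\ldots,T-2}\frac{\max_{s=1,\ldots,t}\left|\mathcal{X}_s-\frac{s}{t}\mathcal{X}_t\right|}{\max_{s=t,\ldots,T-1}\left|\mathcal{Z}_s-\frac{T-s}{T-t}\mathcal{Z}_t\right|},$$ where $\mathcal{Z}_t:=\mathcal{X}_T-\mathcal{X}_t$ and $[\mathcal{X}_1,\ldots,\mathcal{X}_T]^{\top}$ is a multivariate normal random vector with zero mean and (symmetric) covariance matrix $\Gamma=\{\gamma_{t,v}(\tau)\}_{t,v=1}^{T,T}$ given as follows. Diagonal entries: $$\gamma_{t,t}(\tau)=\begin{cases} r(t)+\frac{t^2}{\tau^2}r(\tau)-\frac{2t}{\tau}[r(t)+R(t,\tau)],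 & t<\tau;\\ 0, & t=\tau;\\ r(t-\tau)+\frac{(t-\tau)^2}{(T-\tau)^2}r(T-\tau)-\frac{2(t-\tau)}{T-\tau}\left[r(t-\tau)+R(t-\tau,T-\tau)\right], & t>\tau.\end{cases}$$ Off-diagonal entries ($t<v$): $\gamma_{t,v}(\tau)=0$ if $t=\tau$ or $v=\tau$; $$\gamma_{t,v}(\tau)=r(t)+R(t,v)+\frac{tv}{\tau^2}r(\tau)-\frac{v}{\tau}[r(t)+R(t,\tau)]-\frac{t}{\tau}[r(v)+R(v,\tau)]\quad\text{if } t<v<\tau;$$ $$\gamma_{t,v}(\tau)=S(t,v,\tau+1-t)+\frac{t(v-\tau)}{\tau(T-\tau)}R(\tau,T)-\frac{v-\tau}{T-\tau}S(t,T,\tau+1-t)-\frac{t}{\tau}R(\tau,v)\quad\text{if } t<\tau<v;$$ $$\begin{aligned}\gamma_{t,v}(\tau)={}&r(t-\tau)+R(t-\tau,v-\tau)+\frac{(t-\tau)(v-\tau)}{(T-\tau)^2}r(T-\tau)\\&-\frac{v-\tau}{T-\tau}[r(t-\tau)+R(t-\tau,T-\tau)]-\frac{t-\tau}{T-\tau}[r(v-\tau)+R(v-\tau,T-\tau)]\quad\text{if } \tau<t<v.\end{aligned}$$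
   Context: Panel change point model: $Y_{i,t}=\mu_i+\delta_i\mathcal{I}\{t>\tau\}+\sigma\varepsilon_{i,t}$, where $\sigma>0$ is an unknown parameter, $\mu_i,\delta_i$ are (non-random) real numbers (the $\delta_i$ may depend on $N$), $\tau\in\{1,\ldots,T\}$ is the common change point ($\tau=T$ means no change), and $T$ is fixed (not depending on $N$). Conditions on the errors: the vectors $[\varepsilon_{i,1},\ldots,\varepsilon_{i,T}]^{\top}$, defined on a probability space $(\Omega,\mathcal{F},\mathsf{P})$, are iid for $i=1,\ldots,N$, with $\mathsf{E}\varepsilon_{i,t}=0$, $\mathsf{Var}\,\varepsilon_{i,t}=1$, and autocorrelation function $\rho_t=\mathsf{Corr}(\varepsilon_{i,s},\varepsilon_{i,s+t})=\mathsf{Cov}(\varepsilon_{i,s},\varepsilon_{i,s+t})$ for all $s\in\{1,\ldots,T-t\}$, not depending on $s$ (with $\rho_{-t}=\rho_t$). Correlation functions: $r(t)=\mathsf{Var}\sum_{s=1}^t\varepsilon_{i,s}=\sum_{|s|<t}(t-|s|)\rho_s$; $R(t,v)=\mathsf{Cov}\left(\sum_{s=1}^t\varepsilon_{i,s},\sum_{u=t+1}^v\varepsilon_{i,u}\right)=\sum_{s=1}^t\sum_{u=t+1}^v\rho_{u-s}$; $S(t,v,d)=\mathsf{Cov}\left(\sum_{s=1}^t\varepsilon_{i,s},\sum_{u=t+d}^v\varepsilon_{i,u}\right)=\sum_{s=1}^t\sum_{u=t+d}^v\rho_{u-s}$. Empty sums are zero (so $R(t,t)=0$). Residuals: $\widehat{e}_{i,t}:=Y_{i,t}-\overline{Y}_{i,\widehat{\tau}_N}$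 if $t\le\widehat{\tau}_N$ and $\widehat{e}_{i,t}:=Y_{i,t}-\widetilde{Y}_{i,\widehat{\tau}_N}$ if $t>\widehat{\tau}_N$, with $\overline{Y}_{i,t}=\frac1t\sum_{s=1}^tY_{i,s}$ and $\widetilde{Y}_{i,t}=\frac1{T-t}\sum_{s=t+1}^TY_{i,s}$. Bootstrap: given $\mathbb{Y}$, the row vectors $[\widehat{e}_{i,1}^*,\ldots,\widehat{e}_{i,T}^*]$, $i=1,\ldots,N$, are drawn by resampling with replacement from the rows $\{[\widehat{e}_{j,1},\ldots,\widehat{e}_{j,T}]\}_{j=1}^N$ (i.e. conditionally iid, uniform on these $N$ rows). Put $\widehat{Y}_{i,t}^*:=\widehat{e}_{i,t}^*-\frac1N\sum_{j=1}^N\widehat{e}_{j,t}$. Bootstrap statistic: $$\mathcal{R}_{N}^*(T)=\max_{t=2,\ldots,T-2}\frac{\max_{s=1,\ldots,t}\left|\sum_{i=1}^N\left[\sum_{r=1}^s\left(\widehat{Y}_{i,r}^*-\overline{\widehat{Y}}_{i,t}^*\right)\right]\right|}{\max_{s=t,\ldots,T-1}\left|\sum_{i=1}^N\left[\sum_{r=s+1}^T\left(\widehat{Y}_{i,r}^*-\widetilde{\widehat{Y}}_{i,t}^*\right)\right]\right|},$$ with $\overline{\widehat{Y}}_{i,t}^*=\frac1t\sum_{s=1}^t\widehat{Y}_{i,s}^*$ and $\widetilde{\widehat{Y}}_{i,t}^*=\frac1{T-t}\sum_{s=t+1}^T\widehat{Y}_{i,s}^*$. *)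

theory Defs
  imports "HOL-Probability.Probability"
begin

definition covariance :: "'a measure \<Rightarrow> ('a \<Rightarrow> real) \<Rightarrow> ('a \<Rightarrow> real) \<Rightarrow> real" where
  "covariance M X Y =
     (\<integral>\<omega>. (X \<omega> - (\<integral>\<xi>. X \<xi> \<partial>M)) * (Y \<omega> - (\<integral>\<xi>. Y \<xi> \<partial>M)) \<partial>M)"

definition correlation :: "'a measure \<Rightarrow> ('a \<Rightarrow> real) \<Rightarrow> ('a \<Rightarrow> real) \<Rightarrow> real" where
  "correlation M X Y = covariance M X Y / sqrt (covariance M X X * covariance M Y Y)"

text \<open>
  Covariance matrices may be singular here, so a Gaussian vector is one all of whose linear
  combinations are univariate normal or almost surely constant.
\<close>

definition univariate_normal :: "'a measure \<Rightarrow> ('a \<Rightarrow> real) \<Rightarrow> bool" where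
  "univariate_normal M X \<longleftrightarrow> X \<in> borel_measurable M \<and>
     ((\<exists>m. AE \<omega> in M. X \<omega> = m) \<or>
      (\<exists>m s. 0 < s \<and> distributed M lborel X (normal_density m s)))"

definition multivariate_normal ::
    "'a measure \<Rightarrow> 'i set \<Rightarrow> ('i \<Rightarrow> 'a \<Rightarrow> real) \<Rightarrow> ('i \<Rightarrow> real) \<Rightarrow> ('i \<Rightarrow> 'i \<Rightarrow> real) \<Rightarrow> bool" where
  "multivariate_normal M I X m G \<longleftrightarrow>
     (\<forall>i\<in>I. X i \<in> borel_measurable M) \<and>
     (\<forall>a :: 'i \<Rightarrow> real. univariate_normal M (\<lambda>\<omega>. \<Sum>i\<in>I. a i * X i \<omega>)) \<and>
     (\<forall>i\<in>I. (\<integral>\<omega>. X i \<omega> \<partial>M) = m i) \<and>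
     (\<forall>i\<in>I. \<forall>j\<in>I. covariance M (X i) (X j) = G i j)"

definition tendsto_in_probability :: "'a measure \<Rightarrow> (nat \<Rightarrow> 'a \<Rightarrow> real) \<Rightarrow> real \<Rightarrow> bool" where
  "tendsto_in_probability M X c \<longleftrightarrow>
     (\<forall>N. X N \<in> borel_measurable M) \<and>
     (\<forall>\<eta>>0. (\<lambda>N. measure M {\<omega> \<in> space M. \<eta> < \<bar>X N \<omega> - c\<bar>}) \<longlonglongrightarrow> 0)"

text \<open>
  Weak convergence in probability of random probability measures \<open>K N \<omega>\<close> on the real line
  to the deterministic probability measure \<open>L\<close>.
\<close>

definition weak_conv_in_probability ::
    "'a measure \<Rightarrow> (nat \<Rightarrow> 'a \<Rightarrow> real measure) \<Rightarrow> real measure \<Rightarrow> bool" where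
  "weak_conv_in_probability M K L \<longleftrightarrow>
     (\<forall>f :: real \<Rightarrow> real. continuous_on UNIV f \<and> bounded (range f) \<longrightarrow>
        tendsto_in_probability M (\<lambda>N \<omega>. \<integral>x. f x \<partial>(K N \<omega>)) (\<integral>x. f x \<partial>L))"


definition r_fun :: "(int \<Rightarrow> real) \<Rightarrow> nat \<Rightarrow> real" where
  "r_fun \<rho> t = (\<Sum>s | \<bar>s\<bar> < int t. (real t - \<bar>of_int s\<bar>) * \<rho> s)"

definition R_fun :: "(int \<Rightarrow> real) \<Rightarrow> nat \<Rightarrow> nat \<Rightarrow> real" where
  "R_fun \<rho> t v = (\<Sum>s=1..t. \<Sum>u=t+1..v. \<rho> (int u - int s))"

definition S_fun :: "(int \<Rightarrow> real) \<Rightarrow> nat \<Rightarrow> nat \<Rightarrow> nat \<Rightarrow> real" where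
  "S_fun \<rho> t v d = (\<Sum>s=1..t. \<Sum>u=t+d..v. \<rho> (int u - int s))"

definition gamma_diag :: "(int \<Rightarrow> real) \<Rightarrow> nat \<Rightarrow> nat \<Rightarrow> nat \<Rightarrow> real" where
  "gamma_diag \<rho> T \<tau> t =
    (if t < \<tau> then
       r_fun \<rho> t + (real t)\<^sup>2 / (real \<tau>)\<^sup>2 * r_fun \<rho> \<tau>
       - 2 * real t / real \<tau> * (r_fun \<rho> t + R_fun \<rho> t \<tau>)
     else if t = \<tau> then 0
     else
       r_fun \<rho> (t - \<tau>)
       + (real (t - \<tau>))\<^sup>2 / (real (T - \<tau>))\<^sup>2 * r_fun \<rho> (T - \<tau>)
       - 2 * real (t - \<tau>) / real (T - \<tau>)
           * (r_fun \<rho> (t - \<tau>) + R_fun \<rho> (t - \<tau>) (T - \<tau>)))"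

text \<open>The entries above the diagonal, used for \<open>t < v\<close>.\<close>

definition gamma_upper :: "(int \<Rightarrow> real) \<Rightarrow> nat \<Rightarrow> nat \<Rightarrow> nat \<Rightarrow> nat \<Rightarrow> real" where
  "gamma_upper \<rho> T \<tau> t v =
    (if t = \<tau> \<or> v = \<tau> then 0
     else if v < \<tau> then
       r_fun \<rho> t + R_fun \<rho> t v + real t * real v / (real \<tau>)\<^sup>2 * r_fun \<rho> \<tau>
       - real v / real \<tau> * (r_fun \<rho> t + R_fun \<rho> t \<tau>)
       - real t / real \<tau> * (r_fun \<rho> v + R_fun \<rho> v \<tau>)
     else if t < \<tau> then
       S_fun \<rho> t v (\<tau> + 1 - t)
       + real t * real (v - \<tau>) / (real \<tau> * real (T - \<tau>)) * R_fun \<rho> \<tau> T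
       - real (v - \<tau>) / real (T - \<tau>) * S_fun \<rho> t T (\<tau> + 1 - t)
       - real t / real \<tau> * R_fun \<rho> \<tau> v
     else
       r_fun \<rho> (t - \<tau>) + R_fun \<rho> (t - \<tau>) (v - \<tau>)
       + real (t - \<tau>) * real (v - \<tau>) / (real (T - \<tau>))\<^sup>2 * r_fun \<rho> (T - \<tau>)
       - real (v - \<tau>) / real (T - \<tau>)
           * (r_fun \<rho> (t - \<tau>) + R_fun \<rho> (t - \<tau>) (T - \<tau>))
       - real (t - \<tau>) / real (T - \<tau>)
           * (r_fun \<rho> (v - \<tau>) + R_fun \<rho> (v - \<tau>) (T - \<tau>)))"

definition gamma_matrix :: "(int \<Rightarrow> real) \<Rightarrow> nat \<Rightarrow> nat \<Rightarrow> nat \<Rightarrow> nat \<Rightarrow> real" where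
  "gamma_matrix \<rho> T \<tau> t v =
    (if t = v then gamma_diag \<rho> T \<tau> t
     else if t < v then gamma_upper \<rho> T \<tau> t v
     else gamma_upper \<rho> T \<tau> v t)"


definition mean_upto :: "(nat \<Rightarrow> real) \<Rightarrow> nat \<Rightarrow> real" where
  "mean_upto y t = (\<Sum>s=1..t. y s) / real t"

definition mean_after :: "nat \<Rightarrow> (nat \<Rightarrow> real) \<Rightarrow> nat \<Rightarrow> real" where
  "mean_after T y t = (\<Sum>s=t+1..T. y s) / real (T - t)"

definition panel :: "(nat \<Rightarrow> real) \<Rightarrow> (nat \<Rightarrow> real) \<Rightarrow> real \<Rightarrow> nat \<Rightarrow> (nat \<Rightarrow> nat \<Rightarrow> real)
    \<Rightarrow> nat \<Rightarrow> nat \<Rightarrow> real" where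
  "panel \<mu> \<delta> \<sigma> \<tau> \<epsilon> i t = \<mu> i + \<delta> i * of_bool (t > \<tau>) + \<sigma> * \<epsilon> i t"

definition residual :: "nat \<Rightarrow> nat \<Rightarrow> (nat \<Rightarrow> nat \<Rightarrow> real) \<Rightarrow> nat \<Rightarrow> nat \<Rightarrow> real" where
  "residual T k Y i t =
    (if t \<le> k then Y i t - mean_upto (Y i) k else Y i t - mean_after T (Y i) k)"

text \<open>\<open>N\<close> independent draws, each uniform over the rows \<open>e 1, \<dots>, e N\<close>.\<close>

definition resampled_rows :: "nat \<Rightarrow> (nat \<Rightarrow> nat \<Rightarrow> real) \<Rightarrow> (nat \<Rightarrow> nat \<Rightarrow> real) pmf" where
  "resampled_rows N e = Pi_pmf {1..N} (\<lambda>_. 0) (\<lambda>_. map_pmf e (pmf_of_set {1..N}))"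

definition centred_rows :: "nat \<Rightarrow> (nat \<Rightarrow> nat \<Rightarrow> real) \<Rightarrow> (nat \<Rightarrow> nat \<Rightarrow> real)
    \<Rightarrow> nat \<Rightarrow> nat \<Rightarrow> real" where
  "centred_rows N e e' i t = e' i t - 1 / real N * (\<Sum>j=1..N. e j t)"

text \<open>
  A quotient with zero denominator counts as \<open>0\<close>, here and in the limit statistic. With \<open>k = \<tau>\<close> the
  residuals are linear in the errors, so a denominator that vanishes almost surely in the limit
  also vanishes almost surely in the bootstrap sample.
\<close>

definition ratio_statistic :: "nat \<Rightarrow> nat \<Rightarrow> (nat \<Rightarrow> nat \<Rightarrow> real) \<Rightarrow> real" where
  "ratio_statistic N T Y =
    (MAX t\<in>{2..T-2}.
       (MAX s\<in>{1..t}. \<bar>\<Sum>i=1..N. \<Sum>r=1..s. (Y i r - mean_upto (Y i) t)\<bar>) /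
       (MAX s\<in>{t..T-1}. \<bar>\<Sum>i=1..N. \<Sum>r=s+1..T. (Y i r - mean_after T (Y i) t)\<bar>))"

text \<open>
  The law of the bootstrap statistic given the data, \<open>Y\<close> being the observed panel and \<open>k\<close>
  the estimated change point.
\<close>

definition bootstrap_law :: "nat \<Rightarrow> nat \<Rightarrow> nat \<Rightarrow> (nat \<Rightarrow> nat \<Rightarrow> real) \<Rightarrow> real measure" where
  "bootstrap_law N T k Y =
    distr (measure_pmf (resampled_rows N (residual T k Y))) borel
      (\<lambda>e'. ratio_statistic N T (centred_rows N (residual T k Y) e'))"

definition limit_statistic :: "nat \<Rightarrow> (nat \<Rightarrow> real) \<Rightarrow> real" where
  "limit_statistic T x =
    (let z = (\<lambda>t. x T - x t) in
     MAX t\<in>{2..T-2}.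
       (MAX s\<in>{1..t}. \<bar>x s - real s / real t * x t\<bar>) /
       (MAX s\<in>{t..T-1}. \<bar>z s - real (T - s) / real (T - t) * z t\<bar>))"


text \<open>\<open>r_fun\<close>, \<open>R_fun\<close>, \<open>S_fun\<close> are the (co)variances of partial sums.\<close>

lemma (in prob_space) covariance_sums:
  assumes fin: "finite A" "finite B"
    and int: "\<And>s. s \<in> A \<union> B \<Longrightarrow> X s \<in> borel_measurable M"
      "\<And>s. s \<in> A \<union> B \<Longrightarrow> integrable M (\<lambda>\<omega>. (X s \<omega>)\<^sup>2)"
    and mean: "\<And>s. s \<in> A \<union> B \<Longrightarrow> expectation (X s) = 0"
  shows "covariance M (\<lambda>\<omega>. \<Sum>s\<in>A. X s \<omega>) (\<lambda>\<omega>. \<Sum>u\<in>B. X u \<omega>) =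
         (\<Sum>s\<in>A. \<Sum>u\<in>B. covariance M (X s) (X u))"
proof -
  have prod: "integrable M (\<lambda>\<omega>. X s \<omega> * X u \<omega>)" if "s \<in> A \<union> B" "u \<in> A \<union> B" for s u
  proof (rule Bochner_Integration.integrable_bound)
    show "integrable M (\<lambda>\<omega>. (X s \<omega>)\<^sup>2 + (X u \<omega>)\<^sup>2)"
      using int that by auto
    show "(\<lambda>\<omega>. X s \<omega> * X u \<omega>) \<in> borel_measurable M"
      using int that by auto
    have "\<bar>a * b\<bar> \<le> a\<^sup>2 + b\<^sup>2" for a b :: real
    proof -
      have "0 \<le> (\<bar>a\<bar> - \<bar>b\<bar>)\<^sup>2" by simp
      then have "2 * (\<bar>a\<bar> * \<bar>b\<bar>) \<le> a\<^sup>2 + b\<^sup>2" by (simp add: power2_diff)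
      then show ?thesis by (simp add: abs_mult) (smt (verit) mult_nonneg_nonneg abs_ge_zero)
    qed
    then show "AE \<omega> in M. norm (X s \<omega> * X u \<omega>) \<le> norm ((X s \<omega>)\<^sup>2 + (X u \<omega>)\<^sup>2)"
      by simp
  qed
  have single: "integrable M (X s)" if "s \<in> A \<union> B" for s
    using square_integrable_imp_integrable[OF int[OF that]] .
  have zero: "expectation (\<lambda>\<omega>. \<Sum>s\<in>C. X s \<omega>) = 0" if "C \<subseteq> A \<union> B" for C
  proof -
    have "expectation (\<lambda>\<omega>. \<Sum>s\<in>C. X s \<omega>) = (\<Sum>s\<in>C. expectation (X s))"
      using that by (intro Bochner_Integration.integral_sum) (auto intro: single)
    then show ?thesis using mean that by (auto intro!: sum.neutral)
  qed
  have cov: "covariance M (X s) (X u) = expectation (\<lambda>\<omega>. X s \<omega> * X u \<omega>)"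
    if "s \<in> A \<union> B" "u \<in> A \<union> B" for s u
    using mean that by (simp add: covariance_def)
  have "covariance M (\<lambda>\<omega>. \<Sum>s\<in>A. X s \<omega>) (\<lambda>\<omega>. \<Sum>u\<in>B. X u \<omega>) =
      expectation (\<lambda>\<omega>. \<Sum>s\<in>A. \<Sum>u\<in>B. X s \<omega> * X u \<omega>)"
    by (simp add: covariance_def zero sum_product)
  also have "\<dots> = (\<Sum>s\<in>A. expectation (\<lambda>\<omega>. \<Sum>u\<in>B. X s \<omega> * X u \<omega>))"
    by (intro Bochner_Integration.integral_sum Bochner_Integration.integrable_sum prod) auto
  also have "\<dots> = (\<Sum>s\<in>A. \<Sum>u\<in>B. expectation (\<lambda>\<omega>. X s \<omega> * X u \<omega>))"
    by (intro sum.cong refl Bochner_Integration.integral_sum prod) auto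
  finally show ?thesis by (simp add: cov)
qed

lemma r_fun_eq_double_sum: "r_fun \<rho> t = (\<Sum>s=1..t. \<Sum>u=1..t. \<rho> (int u - int s))"
proof (induction t)
  case 0
  show ?case by (simp add: r_fun_def)
next
  case (Suc t)
  let ?A = "{s. \<bar>s\<bar> < int (Suc t)}"
  have A: "?A = {- int t..int t}" and B: "{s. \<bar>s\<bar> < int t} \<subseteq> ?A" by auto
  have fin: "finite ?A" by (subst A) simp
  have "r_fun \<rho> (Suc t) = (\<Sum>s\<in>?A. (real t - \<bar>of_int s\<bar>) * \<rho> s) + (\<Sum>s\<in>?A. \<rho> s)"
    by (simp add: r_fun_def flip: sum.distrib) (intro sum.cong refl, simp add: algebra_simps)
  also have "(\<Sum>s\<in>?A. (real t - \<bar>of_int s\<bar>) * \<rho> s) = r_fun \<rho> t"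
    unfolding r_fun_def
  proof (rule sum.mono_neutral_right[OF fin B], rule ballI)
    fix s assume "s \<in> ?A - {s. \<bar>s\<bar> < int t}"
    then have "\<bar>s\<bar> = int t" by auto
    then have "\<bar>real_of_int s\<bar> = real t" by (metis of_int_abs of_int_of_nat_eq)
    then show "(real t - \<bar>real_of_int s\<bar>) * \<rho> s = 0" by simp
  qed
  also have "(\<Sum>s\<in>?A. \<rho> s) =
      (\<Sum>s\<in>{1..int t}. \<rho> s) + (\<Sum>s\<in>{- int t..-1}. \<rho> s) + \<rho> 0"
  proof -
    have "?A = insert 0 ({1..int t} \<union> {- int t..-1})" by auto
    moreover have "{1..int t} \<inter> {- int t..-1} = {}" by auto
    ultimately show ?thesis by (simp add: sum.union_disjoint)
  qed
  also have "(\<Sum>s\<in>{1..int t}. \<rho> s) = (\<Sum>s=1..t. \<rho> (int (Suc t) - int s))"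
    by (rule sum.reindex_bij_witness[where i="\<lambda>s. int (Suc t) - int s"
          and j="\<lambda>s. nat (int (Suc t) - s)"]) auto
  also have "(\<Sum>s\<in>{- int t..-1}. \<rho> s) = (\<Sum>u=1..t. \<rho> (int u - int (Suc t)))"
    by (rule sum.reindex_bij_witness[where i="\<lambda>u. int u - int (Suc t)"
          and j="\<lambda>s. nat (s + int (Suc t))"]) auto
  finally show ?case
    by (simp add: Suc.IH sum.distrib)
qed

lemma (in prob_space)
  assumes rv: "\<And>t. t \<in> {1..T} \<Longrightarrow> random_variable borel (X t)"
    and mean: "\<And>t. t \<in> {1..T} \<Longrightarrow> expectation (X t) = 0"
    and var: "\<And>t. t \<in> {1..T} \<Longrightarrow> variance (X t) = 1"
    and sym: "\<And>t. \<rho> (- t) = \<rho> t"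
    and corr: "\<And>t s. \<lbrakk>t < T; s \<in> {1..T - t}\<rbrakk> \<Longrightarrow> correlation M (X s) (X (s + t)) = \<rho> (int t)"
  shows r_fun_eq_variance:
      "t \<le> T \<Longrightarrow> r_fun \<rho> t = variance (\<lambda>\<omega>. \<Sum>s=1..t. X s \<omega>)"
    and R_fun_eq_covariance:
      "\<lbrakk>t \<le> v; v \<le> T\<rbrakk> \<Longrightarrow>
        R_fun \<rho> t v = covariance M (\<lambda>\<omega>. \<Sum>s=1..t. X s \<omega>) (\<lambda>\<omega>. \<Sum>u=t+1..v. X u \<omega>)"
    and S_fun_eq_covariance:
      "\<lbrakk>1 \<le> d; t \<le> v; v \<le> T\<rbrakk> \<Longrightarrow>
        S_fun \<rho> t v d = covariance M (\<lambda>\<omega>. \<Sum>s=1..t. X s \<omega>) (\<lambda>\<omega>. \<Sum>u=t+d..v. X u \<omega>)"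
proof -
  have sq: "integrable M (\<lambda>\<omega>. (X t \<omega>)\<^sup>2)" if "t \<in> {1..T}" for t
    using var[OF that] mean[OF that] not_integrable_integral_eq by fastforce
  have covself: "covariance M (X s) (X s) = 1" if "s \<in> {1..T}" for s
    using var[OF that] by (simp add: covariance_def power2_eq_square)
  have cov1: "covariance M (X s) (X u) = \<rho> (int u - int s)"
    if "s \<in> {1..T}" "u \<in> {1..T}" "s \<le> u" for s u
    using corr[of "u - s" s] that by (simp add: correlation_def covself of_nat_diff)
  have cov: "covariance M (X s) (X u) = \<rho> (int u - int s)"
    if "s \<in> {1..T}" "u \<in> {1..T}" for s u
  proof (cases "s \<le> u")
    case False
    have "covariance M (X s) (X u) = covariance M (X u) (X s)"
      by (simp add: covariance_def mult.commute)
    also have "\<dots> = \<rho> (int u - int s)"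
      using cov1[of u s] sym[of "int s - int u"] False that by simp
    finally show ?thesis .
  qed (use cov1 that in auto)
  have main: "covariance M (\<lambda>\<omega>. \<Sum>s=1..t. X s \<omega>) (\<lambda>\<omega>. \<Sum>u=a..v. X u \<omega>) =
      (\<Sum>s=1..t. \<Sum>u=a..v. \<rho> (int u - int s))" if "t \<le> T" "1 \<le> a" "v \<le> T" for t a v
  proof -
    have "covariance M (\<lambda>\<omega>. \<Sum>s=1..t. X s \<omega>) (\<lambda>\<omega>. \<Sum>u=a..v. X u \<omega>) =
        (\<Sum>s=1..t. \<Sum>u=a..v. covariance M (X s) (X u))"
      using that by (intro covariance_sums rv sq mean) auto
    also have "\<dots> = (\<Sum>s=1..t. \<Sum>u=a..v. \<rho> (int u - int s))"
      using that by (intro sum.cong refl cov) auto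
    finally show ?thesis .
  qed
  show "r_fun \<rho> t = variance (\<lambda>\<omega>. \<Sum>s=1..t. X s \<omega>)" if "t \<le> T"
    using main[of t 1 t] that
    by (simp add: r_fun_eq_double_sum covariance_def power2_eq_square)
  show "R_fun \<rho> t v = covariance M (\<lambda>\<omega>. \<Sum>s=1..t. X s \<omega>) (\<lambda>\<omega>. \<Sum>u=t+1..v. X u \<omega>)"
    if "t \<le> v" "v \<le> T"
    using main[of t "t+1" v] that by (simp add: R_fun_def)
  show "S_fun \<rho> t v d = covariance M (\<lambda>\<omega>. \<Sum>s=1..t. X s \<omega>) (\<lambda>\<omega>. \<Sum>u=t+d..v. X u \<omega>)"
    if "1 \<le> d" "t \<le> v" "v \<le> T"
    using main[of t "t+d" v] that by (simp add: S_fun_def)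
qed

end

theory Submission
  imports Defs "HOL-Real_Asymp.Real_Asymp"
begin

text \<open>
  Given the data, the bootstrap statistic is a functional of the partial sums of \<open>N\<close> rows that are
  drawn uniformly from the residual rows and centred by their mean. This functional is
  \<open>limit_statistic\<close>, and it does not change when its argument is multiplied by a positive constant.
  Hence the partial sums may be divided by \<open>\<sigma> * sqrt N\<close>, and the claim becomes a central limit theorem
  for resampled partial sums followed by a continuous mapping argument. On the event that the
  estimator hits \<open>\<tau>\<close>, the levels \<open>\<mu>\<close> and the jumps \<open>\<delta>\<close> cancel in the residuals, whose partial
  sums are \<open>\<sigma>\<close> times fixed linear functionals of the error rows. The covariance matrix of these
  functionals is \<open>gamma_matrix\<close> (\<open>gamma_matrix_eq_bilinear_form\<close>).

  The probabilistic core is a statement about deterministic arrays of rows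
  (\<open>resampled_statistic_limit\<close>): if the empirical means tend to \<open>0\<close>, the empirical second moments
  tend to a matrix \<open>G\<close>, and the empirical fourth moments are of smaller order than \<open>sqrt N\<close>, then the
  statistic of the resampled rows converges in distribution to the statistic of a Gaussian vector
  with covariance \<open>G\<close>. A Lyapunov bound for the characteristic function of a resampled sum
  (\<open>resampling_char_approx\<close>) gives the convergence of all linear combinations of the
  partial sums. That this determines the limit of the expectation of every bounded continuous
  function (\<open>cramer_wold\<close>) follows from the Stone-Weierstrass theorem: on a large cube such a function
  is uniformly close to a polynomial in the functions \<open>sin (x i / R)\<close>, which is a combination of cosines
  of linear forms and obeys almost the same bound as the function on the whole space.

  The statistic is discontinuous where a denominator vanishes. A denominator is a maximum of
  absolute values of linear forms, and a linear form of a centred Gaussian vector is almost surely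
  zero or almost surely nonzero. If all forms of one denominator have variance zero, they
  vanish almost surely on every error row too, so that the quotient is \<open>0\<close> both in the bootstrap sample
  and in the limit. Otherwise the denominator is almost surely positive in the limit; bounding it from
  below by \<open>\<kappa>\<close> makes the functional continuous, and the error is controlled by the probability that
  the limiting denominator is below \<open>2 * \<kappa>\<close>, which tends to \<open>0\<close> with \<open>\<kappa>\<close>.

  An argument by contradiction turns the deterministic limit into a uniform estimate
  (\<open>resampled_statistic_uniform\<close>): the conditional expectation of a bounded continuous function is
  close to its limit as soon as \<open>N\<close> is large and the empirical moments are within some \<open>d\<close> of their
  limits. The weak law of large numbers and the consistency of the estimator show that this happens
  with probability tending to one.
\<close>

section \<open>Convergence in distribution from linear combinations\<close>

text \<open>
  The phase \<open>b\<close> lets one family of cosines contain the sines and the constants, so that closure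
  under products needs a single addition formula.
\<close>

inductive trig_poly :: "('i::countable) set \<Rightarrow> (('i \<Rightarrow> real) \<Rightarrow> real) \<Rightarrow> bool" for I where
  cos: "trig_poly I (\<lambda>x. cos (b + (\<Sum>i\<in>I. a i * x i)))"
| add: "trig_poly I f \<Longrightarrow> trig_poly I g \<Longrightarrow> trig_poly I (\<lambda>x. f x + g x)"
| scale: "trig_poly I f \<Longrightarrow> trig_poly I (\<lambda>x. c * f x)"

lemma trig_poly_const: "trig_poly I (\<lambda>_. c)"
  using trig_poly.scale[OF trig_poly.cos[of I 0 "\<lambda>_. 0"], of c] by simp

lemma trig_poly_sin_coordinate:
  assumes "finite I" "j \<in> I"
  shows "trig_poly I (\<lambda>x. sin (c * x j))"
proof -
  have "(\<Sum>i\<in>I. (if i = j then c else 0) * x i) = c * x j" for x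
    using assms by (simp add: if_distrib[of "\<lambda>y. y * _"] sum.delta cong: if_cong)
  then show ?thesis
    using trig_poly.cos[of I "- (pi / 2)" "\<lambda>i. if i = j then c else 0"]
    by (simp add: cos_diff sin_add cos_add flip: minus_add_distrib)
qed

lemma trig_poly_mult:
  assumes "trig_poly I f" "trig_poly I g"
  shows "trig_poly I (\<lambda>x. f x * g x)"
  using assms(1)
proof induction
  case (cos b a)
  show ?case using assms(2)
  proof induction
    case (cos b' a')
    have "cos (b + (\<Sum>i\<in>I. a i * x i)) * cos (b' + (\<Sum>i\<in>I. a' i * x i)) =
        1/2 * cos ((b - b') + (\<Sum>i\<in>I. (a i - a' i) * x i)) +
        1/2 * cos ((b + b') + (\<Sum>i\<in>I. (a i + a' i) * x i))" for x
      unfolding cos_times_cos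
      by (simp add: algebra_simps sum.distrib sum_subtractf)
    then show ?case
      by (simp only:) (intro trig_poly.intros)
  next
    case (add f g)
    then show ?case using trig_poly.add[OF add.IH] by (simp add: distrib_left)
  next
    case (scale f c)
    then show ?case using trig_poly.scale[OF scale.IH, of c] by (simp add: mult.left_commute)
  qed
next
  case (add f g)
  then show ?case using trig_poly.add[OF add.IH] by (simp add: distrib_right)
next
  case (scale f c)
  then show ?case using trig_poly.scale[OF scale.IH, of c] by (simp add: mult.assoc)
qed

text \<open>
  Substituting \<open>v i = sin (x i / R)\<close> turns \<open>f\<close> into the continuous function \<open>F\<close> of \<open>v\<close> on a compact
  cube, since \<open>arcsin\<close> undoes the sine for \<open>\<bar>x i\<bar> \<le> R\<close>. A Stone-Weierstrass approximation of \<open>F\<close> by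
  polynomials in the coordinates of \<open>v\<close> is a trigonometric polynomial in \<open>x\<close>. As \<open>F\<close> is bounded by \<open>B\<close> on
  the whole cube, the approximant is bounded for every \<open>x\<close>, also where it no longer approximates \<open>f\<close>.
\<close>

lemma trig_poly_approximation:
  fixes f :: "('i::countable \<Rightarrow> real) \<Rightarrow> real"
  assumes I: "finite I" and f: "continuous_on UNIV f" "\<And>x. \<bar>f x\<bar> \<le> B"
    and pos: "0 < e" "0 < R"
  obtains p where "trig_poly I p"
    and "\<And>x. (\<And>i. i \<notin> I \<Longrightarrow> x i = 0) \<Longrightarrow> \<bar>p x\<bar> \<le> B + e"
    and "\<And>x. (\<And>i. i \<notin> I \<Longrightarrow> x i = 0) \<Longrightarrow> (\<And>i. i \<in> I \<Longrightarrow> \<bar>x i\<bar> \<le> R) \<Longrightarrow> \<bar>f x - p x\<bar> \<le> e"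
proof -
  define S :: "('i \<Rightarrow> real) set" where "S = (\<Pi>\<^sub>E i\<in>UNIV. if i \<in> I then {-1..1} else {0})"
  define F where "F v = f (\<lambda>i. R * arcsin (v i))" for v
  define sn where "sn x = (\<lambda>i. sin (1 / R * x i))" for x :: "'i \<Rightarrow> real"
  \<comment> \<open>The functions on \<open>S\<close> that become trigonometric polynomials after the substitution by sines.\<close>
  define P where "P g \<longleftrightarrow> continuous_on S g \<and>
    (\<exists>p. trig_poly I p \<and> (\<forall>x. (\<forall>i. i \<notin> I \<longrightarrow> x i = 0) \<longrightarrow> g (sn x) = p x))" for g
  have sn: "sn x \<in> S" if "\<And>i. i \<notin> I \<Longrightarrow> x i = 0" for x
    using that by (auto simp: sn_def S_def PiE_iff)
  have S_range: "\<bar>v i\<bar> \<le> 1" if "v \<in> S" for v i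
    using that by (auto simp: S_def PiE_iff abs_le_iff minus_le_iff split: if_splits dest: spec[of _ i])
  have compact: "compact S"
  proof -
    have "compactin (product_topology (\<lambda>_. euclidean) UNIV) S"
      unfolding S_def by (subst compactin_PiE) auto
    then show ?thesis by (simp add: euclidean_product_topology)
  qed
  have coord: "continuous_on S (\<lambda>v. v i)" for i
    by (rule continuous_on_subset[OF continuous_on_product_coordinates]) auto
  have "continuous_on S (\<lambda>v. f (\<lambda>i. R * arcsin (v i)))"
  proof (rule continuous_on_compose2[OF f(1)])
    show "continuous_on S (\<lambda>v i. R * arcsin (v i))"
    proof (rule continuous_on_coordinatewise_then_product)
      fix i
      show "continuous_on S (\<lambda>v. R * arcsin (v i))"
        using S_range by (intro continuous_intros continuous_on_arcsin coord)
          (auto simp: abs_le_iff)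
    qed
  qed auto
  then have F: "continuous_on S F" by (simp add: F_def[abs_def])
  have "\<exists>g. P g \<and> (\<forall>v\<in>S. \<bar>F v - g v\<bar> < e)"
  proof (rule Stone_Weierstrass_HOL[where P = P and S = S])
    show "compact S" "continuous_on S F" "0 < e" by (fact compact F pos)+
    show "P (\<lambda>_. c)" for c
      unfolding P_def by (auto intro!: exI[of _ "\<lambda>_. c"] trig_poly_const)
    show "continuous_on S g" if "P g" for g using that by (simp add: P_def)
    fix g h assume "P g \<and> P h"
    then obtain p q where gh: "continuous_on S g" "continuous_on S h" and "trig_poly I p" "trig_poly I q"
      "\<And>x. (\<And>i. i \<notin> I \<Longrightarrow> x i = 0) \<Longrightarrow> g (sn x) = p x"
      "\<And>x. (\<And>i. i \<notin> I \<Longrightarrow> x i = 0) \<Longrightarrow> h (sn x) = q x"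
      unfolding P_def by metis
    note pq = this
    show "P (\<lambda>v. g v + h v)" unfolding P_def
      using pq by (auto intro!: continuous_intros exI[of _ "\<lambda>x. p x + q x"] trig_poly.add)
    show "P (\<lambda>v. g v * h v)" unfolding P_def
      using pq by (auto intro!: continuous_intros exI[of _ "\<lambda>x. p x * q x"] trig_poly_mult)
  next
    fix v w assume vw: "v \<in> S \<and> w \<in> S \<and> v \<noteq> w"
    then obtain j where j: "v j \<noteq> w j" by auto
    have "j \<in> I"
    proof (rule ccontr)
      assume "j \<notin> I"
      then have "v j = 0" "w j = 0"
        using vw by (auto simp: S_def PiE_iff dest!: spec[of _ j])
      then show False using j by simp
    qed
    moreover have "P (\<lambda>v. v j)" unfolding P_def
      using trig_poly_sin_coordinate[OF I \<open>j \<in> I\<close>, of "1 / R"] coord[of j]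
      by (auto simp: sn_def)
    ultimately show "\<exists>g. P g \<and> g v \<noteq> g w" using j by blast
  qed
  then obtain g p where g: "\<And>v. v \<in> S \<Longrightarrow> \<bar>F v - g v\<bar> < e" and p: "trig_poly I p"
    "\<And>x. (\<And>i. i \<notin> I \<Longrightarrow> x i = 0) \<Longrightarrow> g (sn x) = p x"
    unfolding P_def by metis
  show ?thesis
  proof (rule that[OF p(1)])
    fix x :: "'i \<Rightarrow> real" assume x: "\<And>i. i \<notin> I \<Longrightarrow> x i = 0"
    have close: "\<bar>F (sn x) - p x\<bar> < e" using g[OF sn[OF x]] p(2)[OF x] by simp
    moreover have "\<bar>F (sn x)\<bar> \<le> B" unfolding F_def by (rule f(2))
    ultimately show "\<bar>p x\<bar> \<le> B + e" by linarith
    assume R: "\<And>i. i \<in> I \<Longrightarrow> \<bar>x i\<bar> \<le> R"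
    have "R * arcsin (sn x i) = x i" for i
    proof -
      have "\<bar>x i\<bar> \<le> R" using R[of i] x[of i] pos by (cases "i \<in> I") auto
      then have "\<bar>1 / R * x i\<bar> \<le> 1" using pos by (simp add: abs_mult field_simps)
      then have "arcsin (sin (1 / R * x i)) = 1 / R * x i"
        using pi_gt3 by (intro arcsin_sin) linarith+
      then show ?thesis using pos by (simp add: sn_def)
    qed
    then have "F (sn x) = f x" by (simp add: F_def)
    then show "\<bar>f x - p x\<bar> \<le> e" using close by simp
  qed
qed

lemma trig_poly_continuous: "trig_poly I p \<Longrightarrow> continuous_on UNIV p"
proof (induction rule: trig_poly.induct)
  case (cos b a)
  show ?case
    by (intro continuous_on_cos continuous_on_add continuous_on_sum continuous_on_mult
      continuous_on_const continuous_on_product_coordinates)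
qed (auto intro: continuous_intros)

lemma trig_poly_bounded: "trig_poly I p \<Longrightarrow> \<exists>C. \<forall>x. \<bar>p x\<bar> \<le> C"
proof (induction rule: trig_poly.induct)
  case (cos b a)
  then show ?case by (auto intro!: exI[of _ 1])
next
  case (add f g)
  then obtain C D where "\<And>x. \<bar>f x\<bar> \<le> C" "\<And>x. \<bar>g x\<bar> \<le> D" by blast
  then show ?case
    by (intro exI[of _ "C + D"] allI) (meson abs_triangle_ineq add_mono order_trans)
next
  case (scale f c)
  then obtain C where "\<And>x. \<bar>f x\<bar> \<le> C" by blast
  then show ?case
    by (intro exI[of _ "\<bar>c\<bar> * C"]) (auto simp: abs_mult intro: mult_left_mono)
qed

lemma (in prob_space) integrable_bounded_continuous:
  fixes g :: "('i::countable \<Rightarrow> real) \<Rightarrow> real"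
  assumes "V \<in> borel_measurable M" "continuous_on UNIV g" "\<And>x. \<bar>g x\<bar> \<le> B"
  shows "integrable M (\<lambda>\<omega>. g (V \<omega>))"
proof (rule integrable_const_bound[of _ B])
  show "(\<lambda>\<omega>. g (V \<omega>)) \<in> borel_measurable M"
    using borel_measurable_continuous_onI[OF assms(2)] assms(1) by measurable
qed (use assms in auto)

text \<open>
  Outside the cube of half-width \<open>R\<close> the two functions differ by at most \<open>2 * B + e\<close>, and there the sum
  of the \<open>(V i / R)\<^sup>2\<close> is at least \<open>1\<close>; this is Chebyshev's inequality applied pointwise.
\<close>

lemma (in prob_space) expectation_close_on_cube:
  fixes g p :: "('i::countable \<Rightarrow> real) \<Rightarrow> real"
  assumes I: "finite I" and V: "V \<in> borel_measurable M" "\<And>\<omega> i. i \<notin> I \<Longrightarrow> V \<omega> i = 0"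
    and sq: "\<And>i. i \<in> I \<Longrightarrow> integrable M (\<lambda>\<omega>. (V \<omega> i)\<^sup>2)"
      "\<And>i. i \<in> I \<Longrightarrow> expectation (\<lambda>\<omega>. (V \<omega> i)\<^sup>2) \<le> C"
    and g: "continuous_on UNIV g" "\<And>x. \<bar>g x\<bar> \<le> B"
    and p: "trig_poly I p" "\<And>x. (\<And>i. i \<notin> I \<Longrightarrow> x i = 0) \<Longrightarrow> \<bar>p x\<bar> \<le> B + e"
      "\<And>x. (\<And>i. i \<notin> I \<Longrightarrow> x i = 0) \<Longrightarrow> (\<And>i. i \<in> I \<Longrightarrow> \<bar>x i\<bar> \<le> R) \<Longrightarrow> \<bar>g x - p x\<bar> \<le> e"
    and pos: "0 < e" "0 < R"
  shows "\<bar>expectation (\<lambda>\<omega>. g (V \<omega>)) - expectation (\<lambda>\<omega>. p (V \<omega>))\<bar>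
    \<le> e + (2 * B + e) * (real (card I) * C / R\<^sup>2)"
proof -
  have B: "0 \<le> B" using g(2)[of undefined] by linarith
  have int_g: "integrable M (\<lambda>\<omega>. g (V \<omega>))" by (rule integrable_bounded_continuous[OF V(1) g])
  obtain D where "\<And>x. \<bar>p x\<bar> \<le> D" using trig_poly_bounded[OF p(1)] by blast
  then have int_p: "integrable M (\<lambda>\<omega>. p (V \<omega>))"
    by (rule integrable_bounded_continuous[OF V(1) trig_poly_continuous[OF p(1)]])
  have bound: "\<bar>g (V \<omega>) - p (V \<omega>)\<bar> \<le> e + (2 * B + e) * (\<Sum>i\<in>I. (V \<omega> i)\<^sup>2 / R\<^sup>2)" for \<omega>
  proof (cases "\<forall>i\<in>I. \<bar>V \<omega> i\<bar> \<le> R")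
    case True
    then have "\<bar>g (V \<omega>) - p (V \<omega>)\<bar> \<le> e" by (intro p(3) V(2)) auto
    moreover have "0 \<le> (2 * B + e) * (\<Sum>i\<in>I. (V \<omega> i)\<^sup>2 / R\<^sup>2)"
      using B pos by (intro mult_nonneg_nonneg sum_nonneg) auto
    ultimately show ?thesis by linarith
  next
    case False
    then obtain i where i: "i \<in> I" "R < \<bar>V \<omega> i\<bar>" by force
    then have "R\<^sup>2 \<le> (V \<omega> i)\<^sup>2" using pos by (simp add: abs_le_square_iff[symmetric])
    then have "1 \<le> (V \<omega> i)\<^sup>2 / R\<^sup>2" using pos by (simp add: field_simps)
    also have "\<dots> \<le> (\<Sum>i\<in>I. (V \<omega> i)\<^sup>2 / R\<^sup>2)" using i I by (intro member_le_sum) auto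
    finally have "(2 * B + e) * 1 \<le> (2 * B + e) * (\<Sum>i\<in>I. (V \<omega> i)\<^sup>2 / R\<^sup>2)"
      using B pos by (intro mult_left_mono) auto
    moreover have "\<bar>g (V \<omega>) - p (V \<omega>)\<bar> \<le> (2 * B + e) * 1"
    proof -
      have "\<bar>p (V \<omega>)\<bar> \<le> B + e" by (intro p(2) V(2))
      then show ?thesis
        using g(2)[of "V \<omega>"] abs_triangle_ineq4[of "g (V \<omega>)" "p (V \<omega>)"] by simp
    qed
    ultimately show ?thesis using pos by (meson add_increasing less_imp_le order_trans)
  qed
  have "\<bar>expectation (\<lambda>\<omega>. g (V \<omega>)) - expectation (\<lambda>\<omega>. p (V \<omega>))\<bar>
      = \<bar>expectation (\<lambda>\<omega>. g (V \<omega>) - p (V \<omega>))\<bar>"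
    by (simp add: Bochner_Integration.integral_diff[OF int_g int_p])
  also have "\<dots> \<le> expectation (\<lambda>\<omega>. \<bar>g (V \<omega>) - p (V \<omega>)\<bar>)"
    by (rule integral_abs_bound)
  also have "\<dots> \<le> expectation (\<lambda>\<omega>. e + (2 * B + e) * (\<Sum>i\<in>I. (V \<omega> i)\<^sup>2 / R\<^sup>2))"
    using sq(1) by (intro integral_mono bound integrable_abs Bochner_Integration.integrable_diff int_g int_p
        Bochner_Integration.integrable_add integrable_mult_right Bochner_Integration.integrable_sum
        integrable_divide) auto
  also have "\<dots> = e + (2 * B + e) * (\<Sum>i\<in>I. expectation (\<lambda>\<omega>. (V \<omega> i)\<^sup>2) / R\<^sup>2)"
    using sq(1) by (simp add: prob_space)
  also have "\<dots> \<le> e + (2 * B + e) * (\<Sum>i\<in>I. C / R\<^sup>2)"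
    using sq(2) B pos by (intro add_left_mono mult_left_mono sum_mono divide_right_mono) auto
  finally show ?thesis by simp
qed

text \<open>
  Bounded second moments supply the tightness: they make the cube of the trigonometric approximation
  carry almost all the mass of every \<open>V k\<close> at once.
\<close>

lemma cramer_wold:
  fixes V :: "nat \<Rightarrow> 'p \<Rightarrow> 'i::countable \<Rightarrow> real" and X :: "'q \<Rightarrow> 'i \<Rightarrow> real"
    and g :: "('i \<Rightarrow> real) \<Rightarrow> real"
  assumes P: "\<And>k. prob_space (P k)" and Q: "prob_space Q" and I: "finite I"
    and V: "\<And>k. V k \<in> borel_measurable (P k)" "\<And>k \<omega> i. i \<notin> I \<Longrightarrow> V k \<omega> i = 0"
    and X: "X \<in> borel_measurable Q" "\<And>\<omega> i. i \<notin> I \<Longrightarrow> X \<omega> i = 0"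
    and V_sq: "\<And>k i. i \<in> I \<Longrightarrow> integrable (P k) (\<lambda>\<omega>. (V k \<omega> i)\<^sup>2)"
      "\<And>k i. i \<in> I \<Longrightarrow> (\<integral>\<omega>. (V k \<omega> i)\<^sup>2 \<partial>P k) \<le> C"
    and X_sq: "\<And>i. i \<in> I \<Longrightarrow> integrable Q (\<lambda>\<omega>. (X \<omega> i)\<^sup>2)"
      "\<And>i. i \<in> I \<Longrightarrow> (\<integral>\<omega>. (X \<omega> i)\<^sup>2 \<partial>Q) \<le> C"
    and cos: "\<And>a b. (\<lambda>k. \<integral>\<omega>. cos (b + (\<Sum>i\<in>I. a i * V k \<omega> i)) \<partial>P k)
      \<longlonglongrightarrow> (\<integral>\<omega>. cos (b + (\<Sum>i\<in>I. a i * X \<omega> i)) \<partial>Q)"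
    and g: "continuous_on UNIV g" "\<And>x. \<bar>g x\<bar> \<le> B"
  shows "(\<lambda>k. \<integral>\<omega>. g (V k \<omega>) \<partial>P k) \<longlonglongrightarrow> (\<integral>\<omega>. g (X \<omega>) \<partial>Q)"
proof -
  have trig: "(\<lambda>k. \<integral>\<omega>. p (V k \<omega>) \<partial>P k) \<longlonglongrightarrow> (\<integral>\<omega>. p (X \<omega>) \<partial>Q)" if "trig_poly I p" for p
  proof -
    have int: "integrable (P k) (\<lambda>\<omega>. p (V k \<omega>))" "integrable Q (\<lambda>\<omega>. p (X \<omega>))"
      if "trig_poly I p" for p k
      using trig_poly_bounded[OF that] trig_poly_continuous[OF that] V(1) X(1)
      by (blast intro: prob_space.integrable_bounded_continuous P Q)+
    show ?thesis using that
    proof induction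
      case (cos b a)
      show ?case by (rule assms(12))
    next
      case (add f g)
      then show ?case by (simp add: int tendsto_add)
    next
      case (scale f c)
      then show ?case by (simp add: int tendsto_mult_left)
    qed
  qed
  have B: "0 \<le> B" using g(2)[of undefined] by linarith
  show ?thesis
  proof (rule LIMSEQ_I)
    fix r :: real assume r: "0 < r"
    define e where "e = min 1 (r / 8)"
    have e: "0 < e" "e \<le> 1" "e \<le> r / 8" using r by (auto simp: e_def)
    \<comment> \<open>The constant \<open>2 * B + 1\<close> bounds \<open>2 * B + e\<close>, so that \<open>R\<close> can be chosen before the approximant.\<close>
    have "((\<lambda>R. (2 * B + 1) * (real (card I) * C / R\<^sup>2)) \<longlongrightarrow> 0) at_top"
      by real_asymp
    then have "eventually (\<lambda>R. (2 * B + 1) * (real (card I) * C / R\<^sup>2) < r / 8) at_top"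
      using r by (intro order_tendstoD) auto
    then have "eventually (\<lambda>R. (2 * B + 1) * (real (card I) * C / R\<^sup>2) < r / 8 \<and> 0 < R) at_top"
      using eventually_gt_at_top eventually_conj by blast
    then obtain R where R: "(2 * B + 1) * (real (card I) * C / R\<^sup>2) < r / 8" "0 < R"
      using eventually_happens'[OF trivial_limit_at_top_linorder] by blast
    have CI: "0 \<le> real (card I) * C / R\<^sup>2"
    proof (cases "I = {}")
      case False
      then obtain i where "i \<in> I" by auto
      have "0 \<le> (\<integral>\<omega>. (X \<omega> i)\<^sup>2 \<partial>Q)" by simp
      then have "0 \<le> C" using X_sq(2)[OF \<open>i \<in> I\<close>] by linarith
      then show ?thesis by simp
    qed simp
    have small: "e + (2 * B + e) * (real (card I) * C / R\<^sup>2) < r / 4"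
    proof -
      have "(2 * B + e) * (real (card I) * C / R\<^sup>2) \<le> (2 * B + 1) * (real (card I) * C / R\<^sup>2)"
        using e CI by (intro mult_right_mono) auto
      then show ?thesis using R e by linarith
    qed
    obtain p where p: "trig_poly I p"
      "\<And>x. (\<And>i. i \<notin> I \<Longrightarrow> x i = 0) \<Longrightarrow> \<bar>p x\<bar> \<le> B + e"
      "\<And>x. (\<And>i. i \<notin> I \<Longrightarrow> x i = 0) \<Longrightarrow> (\<And>i. i \<in> I \<Longrightarrow> \<bar>x i\<bar> \<le> R) \<Longrightarrow> \<bar>g x - p x\<bar> \<le> e"
      using trig_poly_approximation[OF I g \<open>0 < e\<close> \<open>0 < R\<close>] by metis
    have 1: "\<bar>(\<integral>\<omega>. g (V k \<omega>) \<partial>P k) - (\<integral>\<omega>. p (V k \<omega>) \<partial>P k)\<bar> < r / 4" for k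
      by (rule le_less_trans[OF prob_space.expectation_close_on_cube small])
        (fact P I V V_sq g p e R)+
    have 2: "\<bar>(\<integral>\<omega>. g (X \<omega>) \<partial>Q) - (\<integral>\<omega>. p (X \<omega>) \<partial>Q)\<bar> < r / 4"
      by (rule le_less_trans[OF prob_space.expectation_close_on_cube small])
        (fact Q I X X_sq g p e R)+
    obtain K where K: "\<And>k. k \<ge> K \<Longrightarrow> \<bar>(\<integral>\<omega>. p (V k \<omega>) \<partial>P k) - (\<integral>\<omega>. p (X \<omega>) \<partial>Q)\<bar> < r / 4"
      using LIMSEQ_D[OF trig[OF p(1)], of "r / 4"] r by auto
    show "\<exists>K. \<forall>k\<ge>K. norm ((\<integral>\<omega>. g (V k \<omega>) \<partial>P k) - (\<integral>\<omega>. g (X \<omega>) \<partial>Q)) < r"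
    proof (intro exI[of _ K] allI impI)
      fix k assume "k \<ge> K"
      from K[OF this] 1[of k] 2 show "norm ((\<integral>\<omega>. g (V k \<omega>) \<partial>P k) - (\<integral>\<omega>. g (X \<omega>) \<partial>Q)) < r"
        unfolding real_norm_def by linarith
    qed
  qed
qed

section \<open>Averages and sums of independent variables\<close>

text \<open>
  Used for real data and for the complex summands of a characteristic function.
\<close>

definition average :: "nat \<Rightarrow> (nat \<Rightarrow> 'b::real_vector) \<Rightarrow> 'b" where
  "average N x = (\<Sum>j=1..N. x j) /\<^sub>R real N"

lemma average_real: "average N (x :: nat \<Rightarrow> real) = (\<Sum>j=1..N. x j) / real N"
  by (simp add: average_def field_simps)

lemma average_const: "1 \<le> N \<Longrightarrow> average N (\<lambda>_. c :: real) = c"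
  by (simp add: average_real)

lemma average_add: "average N (\<lambda>j. x j + y j :: real) = average N x + average N y"
  by (simp add: average_real sum.distrib add_divide_distrib)

lemma average_diff: "average N (\<lambda>j. x j - y j :: real) = average N x - average N y"
  by (simp add: average_real sum_subtractf diff_divide_distrib)

lemma average_cmult: "average N (\<lambda>j. c * x j :: real) = c * average N x"
  by (simp add: average_real sum_distrib_left)

lemma average_sum: "average N (\<lambda>j. \<Sum>t\<in>I. x t j :: real) = (\<Sum>t\<in>I. average N (x t))"
  by (simp add: average_real sum.swap[of _ I] sum_divide_distrib)

lemma average_mono: "(\<And>j. j \<in> {1..N} \<Longrightarrow> x j \<le> y j) \<Longrightarrow> average N x \<le> (average N y :: real)"
  unfolding average_real by (intro divide_right_mono sum_mono) auto

lemma average_nonneg: "(\<And>j. j \<in> {1..N} \<Longrightarrow> 0 \<le> x j) \<Longrightarrow> 0 \<le> (average N x :: real)"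
  unfolding average_real by (intro divide_nonneg_nonneg sum_nonneg) auto

lemma (in prob_space) expectation_prod_two_indep:
  fixes W :: "'i \<Rightarrow> 'a \<Rightarrow> real"
  assumes "indep_vars (\<lambda>_. borel) W A" "i \<in> A" "j \<in> A" "i \<noteq> j"
    and "integrable M (W i)" "integrable M (W j)"
  shows "integrable M (\<lambda>\<omega>. W i \<omega> * W j \<omega>)"
    and "expectation (\<lambda>\<omega>. W i \<omega> * W j \<omega>) = expectation (W i) * expectation (W j)"
proof -
  have "indep_vars (\<lambda>_. borel) W {i, j}"
    using assms by (intro indep_vars_subset[OF assms(1)]) auto
  then have "integrable M (\<lambda>\<omega>. \<Prod>i\<in>{i, j}. W i \<omega>)"
    "expectation (\<lambda>\<omega>. \<Prod>i\<in>{i, j}. W i \<omega>) = (\<Prod>i\<in>{i, j}. expectation (W i))"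
    using assms by (intro indep_vars_integrable indep_vars_lebesgue_integral; auto)+
  then show "integrable M (\<lambda>\<omega>. W i \<omega> * W j \<omega>)"
    "expectation (\<lambda>\<omega>. W i \<omega> * W j \<omega>) = expectation (W i) * expectation (W j)"
    using \<open>i \<noteq> j\<close> by simp_all
qed

lemma (in prob_space) expectation_square_sum_indep:
  fixes W :: "'i \<Rightarrow> 'a \<Rightarrow> real"
  assumes fin: "finite A" and indep: "indep_vars (\<lambda>_. borel) W A"
    and sq: "\<And>i. i \<in> A \<Longrightarrow> integrable M (\<lambda>\<omega>. (W i \<omega>)\<^sup>2)"
    and mean: "\<And>i. i \<in> A \<Longrightarrow> expectation (W i) = 0"
  shows "integrable M (\<lambda>\<omega>. (\<Sum>i\<in>A. W i \<omega>)\<^sup>2)"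
    and "expectation (\<lambda>\<omega>. (\<Sum>i\<in>A. W i \<omega>)\<^sup>2) = (\<Sum>i\<in>A. expectation (\<lambda>\<omega>. (W i \<omega>)\<^sup>2))"
proof -
  have rv: "random_variable borel (W i)" if "i \<in> A" for i
    using indep that by (auto simp: indep_vars_def)
  have int: "integrable M (W i)" if "i \<in> A" for i
    using square_integrable_imp_integrable[OF rv sq] that by auto
  have prod: "integrable M (\<lambda>\<omega>. W i \<omega> * W j \<omega>) \<and>
      expectation (\<lambda>\<omega>. W i \<omega> * W j \<omega>) = (if i = j then expectation (\<lambda>\<omega>. (W i \<omega>)\<^sup>2) else 0)"
    if "i \<in> A" "j \<in> A" for i j
    using expectation_prod_two_indep[OF indep that _ int[OF that(1)] int[OF that(2)]] sq that mean
    by (auto simp: power2_eq_square)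
  have eq: "(\<lambda>\<omega>. (\<Sum>i\<in>A. W i \<omega>)\<^sup>2) = (\<lambda>\<omega>. \<Sum>i\<in>A. \<Sum>j\<in>A. W i \<omega> * W j \<omega>)"
    by (simp add: power2_eq_square sum_product)
  show "integrable M (\<lambda>\<omega>. (\<Sum>i\<in>A. W i \<omega>)\<^sup>2)"
    unfolding eq using prod by (intro Bochner_Integration.integrable_sum) auto
  have "expectation (\<lambda>\<omega>. \<Sum>i\<in>A. \<Sum>j\<in>A. W i \<omega> * W j \<omega>) =
      (\<Sum>i\<in>A. \<Sum>j\<in>A. expectation (\<lambda>\<omega>. W i \<omega> * W j \<omega>))"
    using prod by simp
  also have "\<dots> = (\<Sum>i\<in>A. \<Sum>j\<in>A. if i = j then expectation (\<lambda>\<omega>. (W i \<omega>)\<^sup>2) else 0)"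
    using prod by (intro sum.cong refl) auto
  also have "\<dots> = (\<Sum>i\<in>A. expectation (\<lambda>\<omega>. (W i \<omega>)\<^sup>2))"
    using fin by (intro sum.cong refl) (simp add: sum.delta)
  finally show "expectation (\<lambda>\<omega>. (\<Sum>i\<in>A. W i \<omega>)\<^sup>2) = (\<Sum>i\<in>A. expectation (\<lambda>\<omega>. (W i \<omega>)\<^sup>2))"
    unfolding eq .
qed

lemma power4_sum_le:
  fixes y :: "'i \<Rightarrow> real"
  shows "(\<Sum>i\<in>I. y i) ^ 4 \<le> real (card I) ^ 3 * (\<Sum>i\<in>I. y i ^ 4)"
proof -
  have "(\<Sum>i\<in>I. y i) ^ 4 = ((\<Sum>i\<in>I. y i)\<^sup>2)\<^sup>2" by simp
  also have "\<dots> \<le> ((\<Sum>i\<in>I. (y i)\<^sup>2) * real (card I))\<^sup>2"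
    by (rule power_mono[OF sum_squared_le_sum_of_squares]) simp
  also have "\<dots> = (\<Sum>i\<in>I. (y i)\<^sup>2)\<^sup>2 * (real (card I))\<^sup>2" by (simp add: power_mult_distrib)
  also have "\<dots> \<le> ((\<Sum>i\<in>I. ((y i)\<^sup>2)\<^sup>2) * real (card I)) * (real (card I))\<^sup>2"
    by (rule mult_right_mono[OF sum_squared_le_sum_of_squares]) simp
  finally show ?thesis by (simp add: power2_eq_square power3_eq_cube power4_eq_xxxx ac_simps)
qed

lemma power4_diff_le: "(x - y) ^ 4 \<le> 8 * (x ^ 4 + y ^ 4)" for x y :: real
  using power4_sum_le[of "\<lambda>b. if b then x else - y" UNIV] by (simp add: UNIV_bool add.commute)

lemma abs_power3_le: "\<bar>x\<bar> ^ 3 \<le> x\<^sup>2 + x ^ 4" for x :: real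
proof -
  have "0 \<le> x\<^sup>2 * ((\<bar>x\<bar> - 1)\<^sup>2 + \<bar>x\<bar>)" by simp
  also have "\<dots> = \<bar>x\<bar> ^ 2 + \<bar>x\<bar> ^ 4 - \<bar>x\<bar> ^ 3"
    by (simp add: power2_eq_square power3_eq_cube power4_eq_xxxx algebra_simps)
  finally show ?thesis by simp
qed

section \<open>A central limit theorem for resampling\<close>

definition resampling :: "nat \<Rightarrow> (nat \<Rightarrow> nat) pmf" where
  "resampling N = Pi_pmf {1..N} 0 (\<lambda>_. pmf_of_set {1..N})"

lemma finite_set_resampling: "1 \<le> N \<Longrightarrow> finite (set_pmf (resampling N))"
  unfolding resampling_def by (subst set_Pi_pmf) (auto intro!: finite_PiE_dflt)

lemma integrable_resampling:
  fixes g :: "(nat \<Rightarrow> nat) \<Rightarrow> 'b::{banach, second_countable_topology}"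
  shows "1 \<le> N \<Longrightarrow> integrable (measure_pmf (resampling N)) g"
  by (rule integrable_measure_pmf_finite[OF finite_set_resampling])

lemma expectation_resampling_coordinate:
  fixes g :: "nat \<Rightarrow> 'b::{banach, second_countable_topology}"
  assumes "i \<in> {1..N}"
  shows "(\<integral>h. g (h i) \<partial>measure_pmf (resampling N)) = average N g"
proof -
  have "(\<integral>h. g (h i) \<partial>measure_pmf (resampling N)) = (\<integral>j. g j \<partial>measure_pmf (map_pmf (\<lambda>h. h i) (resampling N)))"
    by simp
  also have "map_pmf (\<lambda>h. h i) (resampling N) = pmf_of_set {1..N}"
    using assms by (simp add: resampling_def Pi_pmf_component)
  also have "(\<integral>j. g j \<partial>measure_pmf (pmf_of_set {1..N})) = average N g"
    using assms by (subst integral_measure_pmf[of "{1..N}"])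
      (auto simp: average_def scaleR_sum_right divide_inverse)
  finally show ?thesis .
qed

lemma indep_vars_resampling:
  "prob_space.indep_vars (measure_pmf (resampling N)) (\<lambda>_. borel) (\<lambda>i h. g (h i)) {1..N}"
  unfolding resampling_def
  using prob_space.indep_vars_compose2[OF measure_pmf.prob_space_axioms
      indep_vars_Pi_pmf[of "{1..N}"], of "\<lambda>_. g" "\<lambda>_. borel"]
  by simp

lemma expectation_resampling_prod:
  fixes g :: "nat \<Rightarrow> 'b::{real_normed_field, banach, second_countable_topology}"
  assumes "1 \<le> N"
  shows "(\<integral>h. (\<Prod>i=1..N. g (h i)) \<partial>measure_pmf (resampling N)) = average N g ^ N"
  using assms
  by (subst prob_space.indep_vars_lebesgue_integral[OF measure_pmf.prob_space_axioms])
    (auto intro!: indep_vars_resampling[of N g, simplified] simp: integrable_resampling expectation_resampling_coordinate)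

lemma expectation_resampling_square_sum:
  fixes u :: "nat \<Rightarrow> real"
  assumes "1 \<le> N" "average N u = 0"
  shows "(\<integral>h. (\<Sum>i=1..N. u (h i))\<^sup>2 \<partial>measure_pmf (resampling N)) = real N * average N (\<lambda>j. (u j)\<^sup>2)"
  using assms
  by (subst prob_space.expectation_square_sum_indep(2)[OF measure_pmf.prob_space_axioms])
    (auto intro!: indep_vars_resampling[of N u, simplified] simp: integrable_resampling expectation_resampling_coordinate
      expectation_resampling_coordinate[of _ _ "\<lambda>j. (u j)\<^sup>2"])

text \<open>
  The upper bound compares \<open>exp (- y) = 1 / exp y\<close> with \<open>1 / (1 + y + y\<^sup>2 / 2)\<close>.
\<close>

lemma abs_exp_minus_linear_le:
  fixes y :: real
  assumes "0 \<le> y"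
  shows "\<bar>exp (- y) - (1 - y)\<bar> \<le> y\<^sup>2 / 2"
proof -
  have "1 \<le> (1 + y + y\<^sup>2 / 2) * (1 - y + y\<^sup>2 / 2)"
  proof -
    have "(1 + y + y\<^sup>2 / 2) * (1 - y + y\<^sup>2 / 2) = 1 + y ^ 4 / 4"
      by (simp add: field_simps power2_eq_square power4_eq_xxxx)
    then show ?thesis by simp
  qed
  also have "\<dots> \<le> exp y * (1 - y + y\<^sup>2 / 2)"
  proof (rule mult_right_mono)
    show "1 + y + y\<^sup>2 / 2 \<le> exp y" by (rule exp_lower_Taylor_quadratic[OF assms])
    have "0 \<le> (1 - y)\<^sup>2 + 1" by (rule add_nonneg_nonneg) simp_all
    then show "0 \<le> 1 - y + y\<^sup>2 / 2" by (simp add: power2_eq_square algebra_simps)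
  qed
  finally have "exp (- y) \<le> 1 - y + y\<^sup>2 / 2"
    by (simp add: exp_minus field_simps)
  moreover have "1 - y \<le> exp (- y)" using exp_ge_add_one_self[of "- y"] by simp
  ultimately show ?thesis by simp
qed

text \<open>
  The characteristic function is the \<open>N\<close>-th power of the average of \<open>iexp (u j / sqrt N)\<close>, and the limit
  is the \<open>N\<close>-th power of \<open>exp (- v / (2 * N))\<close>. Both bases agree with \<open>1 - v / (2 * N)\<close> up to terms of order
  three and four in \<open>1 / sqrt N\<close>, and taking \<open>N\<close>-th powers of numbers in the unit disc multiplies
  their distance by at most \<open>N\<close>.
\<close>

lemma resampling_char_approx:
  fixes u :: "nat \<Rightarrow> real"
  assumes N: "1 \<le> N" and centred: "average N u = 0"
  defines "v \<equiv> average N (\<lambda>j. (u j)\<^sup>2)"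
  shows "cmod ((\<integral>h. iexp ((\<Sum>i=1..N. u (h i)) / sqrt (real N)) \<partial>measure_pmf (resampling N)) - exp (- v / 2))
    \<le> average N (\<lambda>j. \<bar>u j\<bar> ^ 3) / (6 * sqrt (real N)) + v\<^sup>2 / (8 * real N)"
proof -
  define s where "s = sqrt (real N)"
  have s: "0 < s" "s\<^sup>2 = N" using N by (auto simp: s_def)
  have v: "0 \<le> v" unfolding v_def average_def by (simp add: sum_nonneg)
  \<comment> \<open>The bases of the two \<open>N\<close>-th powers.\<close>
  define \<phi> where "\<phi> = average N (\<lambda>j. iexp (u j / s))"
  define w where "w = exp (- (v / (2 * real N)))"
  have "iexp ((\<Sum>i=1..N. u (h i)) / s) = (\<Prod>i=1..N. iexp (u (h i) / s))" for h
    by (simp add: sum_divide_distrib sum_distrib_left exp_sum)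
  then have "(\<integral>h. iexp ((\<Sum>i=1..N. u (h i)) / s) \<partial>measure_pmf (resampling N)) = \<phi> ^ N"
    unfolding \<phi>_def using expectation_resampling_prod[OF N, of "\<lambda>j. iexp (u j / s)"] by simp
  moreover have "exp (- v / 2) = w ^ N"
    using N by (simp add: w_def flip: exp_of_nat_mult)
  ultimately have "cmod ((\<integral>h. iexp ((\<Sum>i=1..N. u (h i)) / s) \<partial>measure_pmf (resampling N)) - exp (- v / 2))
      = cmod (\<phi> ^ N - complex_of_real w ^ N)"
    by (simp flip: of_real_power)
  also have "\<dots> \<le> N * cmod (\<phi> - w)"
  proof (rule norm_power_diff)
    have "cmod \<phi> \<le> (\<Sum>j=1..N. cmod (iexp (u j / s))) / N"
      unfolding \<phi>_def average_def
      using norm_sum[of "\<lambda>j. iexp (u j / s)" "{1..N}"] by (simp add: field_simps)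
    then show "cmod \<phi> \<le> 1" using N by simp
    show "cmod (complex_of_real w) \<le> 1" using v by (simp add: w_def)
  qed
  also have "\<dots> \<le> N * (average N (\<lambda>j. \<bar>u j\<bar> ^ 3) / (6 * s ^ 3) + (v / (2 * real N))\<^sup>2 / 2)"
  proof (rule mult_left_mono)
    have "cmod (\<phi> - (1 - v / (2 * real N))) \<le> average N (\<lambda>j. \<bar>u j\<bar> ^ 3) / (6 * s ^ 3)"
    proof -
      define t where "t j = iexp (u j / s) - (1 + \<i> * (u j / s) - ((u j / s)\<^sup>2 / 2 :: real))" for j
      have t: "cmod (t j) \<le> \<bar>u j / s\<bar> ^ 3 / 6" for j
        using iexp_approx1[of "u j / s" 2]
        by (simp add: t_def numeral_eq_Suc power_mult_distrib power_divide algebra_simps fact_numeral)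
      have "(\<Sum>j=1..N. t j) = (\<Sum>j=1..N. iexp (u j / s))
          - (N + \<i> * of_real ((\<Sum>j=1..N. u j) / s) - of_real ((\<Sum>j=1..N. (u j)\<^sup>2) / (2 * real N)))"
        using s by (simp add: t_def sum.distrib sum_subtractf sum_distrib_left sum_divide_distrib
            power_divide mult.commute)
      also have "(\<Sum>j=1..N. u j) = 0" using centred N by (simp add: average_def)
      also have "(\<Sum>j=1..N. (u j)\<^sup>2) / (2 * real N) = v / 2" 
        using N by (simp add: v_def average_def field_simps)
      finally have "(\<Sum>j=1..N. iexp (u j / s)) = (\<Sum>j=1..N. t j) + N - of_real (v / 2)" by simp
      then have "\<phi> - (1 - v / (2 * real N)) = average N t"
        using N by (simp add: average_def \<phi>_def scaleR_conv_of_real divide_simps)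
      also have "cmod (average N t) \<le> (\<Sum>j=1..N. cmod (t j)) / N"
        unfolding average_def using norm_sum[of t "{1..N}"] N by (simp add: field_simps)
      also have "\<dots> \<le> (\<Sum>j=1..N. \<bar>u j / s\<bar> ^ 3 / 6) / N"
        by (intro divide_right_mono sum_mono t) simp
      also have "\<dots> = average N (\<lambda>j. \<bar>u j\<bar> ^ 3) / (6 * s ^ 3)"
        using s by (simp add: average_def power_divide sum_distrib_left sum_divide_distrib field_simps)
      finally show ?thesis .
    qed
    moreover have "cmod (complex_of_real (1 - v / (2 * real N)) - w) \<le> (v / (2 * real N))\<^sup>2 / 2"
      using abs_exp_minus_linear_le[of "v / (2 * real N)"] v
      unfolding w_def of_real_diff[symmetric] norm_of_real by (simp add: abs_minus_commute)
    ultimately show "cmod (\<phi> - w) \<le> average N (\<lambda>j. \<bar>u j\<bar> ^ 3) / (6 * s ^ 3) + (v / (2 * real N))\<^sup>2 / 2"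
      using norm_triangle_ineq[of "\<phi> - (1 - v / (2 * real N))" "(1 - v / (2 * real N)) - w"] by simp
  qed simp
  also have "\<dots> = average N (\<lambda>j. \<bar>u j\<bar> ^ 3) / (6 * s) + v\<^sup>2 / (8 * real N)"
    using s N by (simp add: field_simps power2_eq_square power3_eq_cube)
  finally show ?thesis unfolding s_def .
qed

text \<open>
  A cosine with a phase is the form in which \<open>cramer_wold\<close> consumes the convergence.
\<close>

lemma resampling_clt:
  fixes u :: "nat \<Rightarrow> nat \<Rightarrow> real"
  assumes n: "filterlim n at_top sequentially" "\<And>k. 1 \<le> n k"
    and centred: "\<And>k. average (n k) (u k) = 0"
    and var: "(\<lambda>k. average (n k) (\<lambda>j. (u k j)\<^sup>2)) \<longlonglongrightarrow> v"
    and lyapunov: "(\<lambda>k. average (n k) (\<lambda>j. \<bar>u k j\<bar> ^ 3) / sqrt (real (n k))) \<longlonglongrightarrow> 0"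
  shows "(\<lambda>k. \<integral>h. cos (b + (\<Sum>i=1..n k. u k (h i)) / sqrt (real (n k))) \<partial>measure_pmf (resampling (n k)))
    \<longlonglongrightarrow> cos b * exp (- v / 2)"
proof -
  let ?S = "\<lambda>k h. (\<Sum>i=1..n k. u k (h i)) / sqrt (real (n k))"
  let ?v = "\<lambda>k. average (n k) (\<lambda>j. (u k j)\<^sup>2)"
  have rn: "filterlim (\<lambda>k. real (n k)) at_top sequentially"
    by (rule filterlim_compose[OF filterlim_real_sequentially n(1)])
  have "(\<lambda>k. average (n k) (\<lambda>j. \<bar>u k j\<bar> ^ 3) / sqrt (real (n k)) / 6 + (?v k)\<^sup>2 * (1 / 8) / real (n k)) \<longlonglongrightarrow> 0 / 6 + 0"
  proof (rule tendsto_add)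
    show "(\<lambda>k. average (n k) (\<lambda>j. \<bar>u k j\<bar> ^ 3) / sqrt (real (n k)) / 6) \<longlonglongrightarrow> 0 / 6"
      by (intro tendsto_divide lyapunov tendsto_const) simp
    show "(\<lambda>k. (?v k)\<^sup>2 * (1 / 8) / real (n k)) \<longlonglongrightarrow> 0"
      by (rule tendsto_divide_0[OF tendsto_mult[OF tendsto_power[OF var] tendsto_const]
            filterlim_at_top_imp_at_infinity[OF rn]])
  qed
  then have bound: "(\<lambda>k. average (n k) (\<lambda>j. \<bar>u k j\<bar> ^ 3) / (6 * sqrt (real (n k))) + (?v k)\<^sup>2 / (8 * real (n k))) \<longlonglongrightarrow> 0"
    by (simp add: mult.commute)
  have "(\<lambda>k. (\<integral>h. iexp (?S k h) \<partial>measure_pmf (resampling (n k))) - exp (- ?v k / 2)) \<longlonglongrightarrow> 0"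
    by (rule Lim_null_comparison[OF _ bound])
      (intro always_eventually allI resampling_char_approx n centred)
  moreover have "(\<lambda>k. complex_of_real (exp (- ?v k / 2))) \<longlonglongrightarrow> complex_of_real (exp (- v / 2))"
    by (intro tendsto_intros var) simp
  ultimately have "(\<lambda>k. (\<integral>h. iexp (?S k h) \<partial>measure_pmf (resampling (n k)))) \<longlonglongrightarrow> complex_of_real (exp (- v / 2))"
    by (rule Lim_transform[rotated])
  then have "(\<lambda>k. Re (iexp b * (\<integral>h. iexp (?S k h) \<partial>measure_pmf (resampling (n k))))) \<longlonglongrightarrow> Re (iexp b * complex_of_real (exp (- v / 2)))"
    by (intro tendsto_intros)
  moreover have "Re (iexp b * (\<integral>h. iexp (?S k h) \<partial>measure_pmf (resampling (n k)))) =
      (\<integral>h. cos (b + ?S k h) \<partial>measure_pmf (resampling (n k)))" for k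
  proof -
    have "iexp b * (\<integral>h. iexp (?S k h) \<partial>measure_pmf (resampling (n k))) = (\<integral>h. iexp b * iexp (?S k h) \<partial>measure_pmf (resampling (n k)))"
      by simp
    also have "Re \<dots> = (\<integral>h. Re (iexp b * iexp (?S k h)) \<partial>measure_pmf (resampling (n k)))"
      by (rule integral_Re[symmetric] integrable_resampling n)+
    also have "\<dots> = (\<integral>h. cos (b + ?S k h) \<partial>measure_pmf (resampling (n k)))"
      by (simp add: cos_add Re_exp Im_exp)
    finally show ?thesis .
  qed
  ultimately show ?thesis by (simp add: Re_exp)
qed

section \<open>Centred Gaussian vectors\<close>

definition bilinear_form ::
    "'i set \<Rightarrow> ('i \<Rightarrow> 'i \<Rightarrow> real) \<Rightarrow> ('i \<Rightarrow> real) \<Rightarrow> ('i \<Rightarrow> real) \<Rightarrow> real" where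
  "bilinear_form I G a b = (\<Sum>s\<in>I. \<Sum>t\<in>I. a s * b t * G s t)"

lemma bilinear_form_commute:
  assumes "\<And>s t. G s t = G t s"
  shows "bilinear_form I G a b = bilinear_form I G b a"
  unfolding bilinear_form_def
  by (subst sum.swap) (simp add: assms[of _ _] mult.commute)

text \<open>
  Residual weights are differences of two block indicators, the second one scaled.
\<close>

lemma bilinear_form_expand:
  "bilinear_form I G (\<lambda>i. a i - c * b i) (\<lambda>i. a' i - c' * b' i) =
    bilinear_form I G a a' - c' * bilinear_form I G a b' - c * bilinear_form I G b a'
      + c * c' * bilinear_form I G b b'"
  unfolding bilinear_form_def
  by (simp add: algebra_simps sum.distrib sum_subtractf sum_distrib_left)

text \<open>
  With \<open>G\<close> the covariance matrix of the errors, this computes the covariance of two combinations of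
  weighted error sums from the covariance matrix of these sums.
\<close>

lemma bilinear_form_sum:
  "bilinear_form I G (\<lambda>r. \<Sum>i\<in>J. a i * w i r) (\<lambda>r. \<Sum>i\<in>J. b i * w i r) =
    bilinear_form J (\<lambda>i j. bilinear_form I G (w i) (w j)) a b"
proof -
  have "bilinear_form I G (\<lambda>r. \<Sum>i\<in>J. a i * w i r) (\<lambda>r. \<Sum>i\<in>J. b i * w i r) =
      (\<Sum>s\<in>I. \<Sum>t\<in>I. \<Sum>i\<in>J. \<Sum>j\<in>J. a i * b j * (w i s * w j t * G s t))"
    unfolding bilinear_form_def sum_product sum_distrib_right
    by (intro sum.cong refl) (simp add: sum_distrib_left sum_distrib_right ac_simps)
  also have "\<dots> = (\<Sum>s\<in>I. \<Sum>i\<in>J. \<Sum>t\<in>I. \<Sum>j\<in>J. a i * b j * (w i s * w j t * G s t))"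
    by (intro sum.cong refl sum.swap)
  also have "\<dots> = (\<Sum>i\<in>J. \<Sum>s\<in>I. \<Sum>t\<in>I. \<Sum>j\<in>J. a i * b j * (w i s * w j t * G s t))"
    by (rule sum.swap)
  also have "\<dots> = (\<Sum>i\<in>J. \<Sum>s\<in>I. \<Sum>j\<in>J. \<Sum>t\<in>I. a i * b j * (w i s * w j t * G s t))"
    by (intro sum.cong refl sum.swap)
  also have "\<dots> = (\<Sum>i\<in>J. \<Sum>j\<in>J. \<Sum>s\<in>I. \<Sum>t\<in>I. a i * b j * (w i s * w j t * G s t))"
    by (intro sum.cong refl sum.swap)
  finally show ?thesis by (simp add: bilinear_form_def sum_distrib_left)
qed

text \<open>
  Constants count as normal here, so each claim is checked for the degenerate and for the
  nondegenerate case; the formula for the characteristic function is the same in both.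
\<close>

lemma (in prob_space) centred_univariate_normal:
  assumes Z: "univariate_normal M Z" and mean: "expectation Z = 0"
  shows centred_normal_square_integrable: "integrable M (\<lambda>\<omega>. (Z \<omega>)\<^sup>2)"
    and centred_normal_variance: "covariance M Z Z = expectation (\<lambda>\<omega>. (Z \<omega>)\<^sup>2)"
    and centred_normal_cos: "expectation (\<lambda>\<omega>. cos (b + Z \<omega>)) = cos b * exp (- covariance M Z Z / 2)"
    and centred_normal_zero: "covariance M Z Z = 0 \<Longrightarrow> AE \<omega> in M. Z \<omega> = 0"
    and centred_normal_nonzero: "covariance M Z Z \<noteq> 0 \<Longrightarrow> AE \<omega> in M. Z \<omega> \<noteq> 0"
proof -
  have rv[measurable]: "Z \<in> borel_measurable M" using Z by (simp add: univariate_normal_def)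
  show cov: "covariance M Z Z = expectation (\<lambda>\<omega>. (Z \<omega>)\<^sup>2)"
    by (simp add: covariance_def mean power2_eq_square)
  consider (const) m where "AE \<omega> in M. Z \<omega> = m"
    | (normal) m s where "0 < s" "distributed M lborel Z (normal_density m s)"
    using Z unfolding univariate_normal_def by blast
  then have "integrable M (\<lambda>\<omega>. (Z \<omega>)\<^sup>2) \<and>
    expectation (\<lambda>\<omega>. cos (b + Z \<omega>)) = cos b * exp (- covariance M Z Z / 2) \<and>
    (covariance M Z Z = 0 \<longrightarrow> (AE \<omega> in M. Z \<omega> = 0)) \<and>
    (covariance M Z Z \<noteq> 0 \<longrightarrow> (AE \<omega> in M. Z \<omega> \<noteq> 0))"
  proof cases
    case const
    then have "expectation Z = expectation (\<lambda>_. m)" by (intro integral_cong_AE) auto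
    then have "m = 0" using mean by (simp add: prob_space)
    with const have Z0: "AE \<omega> in M. Z \<omega> = 0" by simp
    have "integrable M (\<lambda>\<omega>. (Z \<omega>)\<^sup>2)"
      by (rule integrable_cong_AE_imp[of _ "\<lambda>_. 0"]) (use Z0 in auto)
    moreover have "expectation (\<lambda>\<omega>. (Z \<omega>)\<^sup>2) = expectation (\<lambda>_. 0)"
      using Z0 by (intro integral_cong_AE) auto
    moreover have "expectation (\<lambda>\<omega>. cos (b + Z \<omega>)) = expectation (\<lambda>_. cos b)"
      using Z0 by (intro integral_cong_AE) auto
    ultimately show ?thesis using Z0 cov by (simp add: prob_space)
  next
    case normal
    have m: "m = 0" using normal_distributed_expectation[OF normal] mean by simp
    have var: "covariance M Z Z = s\<^sup>2"
      using normal_distributed_variance[OF normal] m by (simp add: cov mean)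
    have sq: "integrable M (\<lambda>\<omega>. (Z \<omega>)\<^sup>2)"
      using var normal(1) not_integrable_integral_eq unfolding cov by fastforce
    define W where "W \<omega> = Z \<omega> / s" for \<omega>
    have W: "distributed M lborel W std_normal_density"
      using normal_standard_normal_convert[OF normal(1), of Z m] normal(2) m
      by (simp add: W_def[abs_def])
    have [measurable]: "W \<in> borel_measurable M" unfolding W_def by measurable
    have "distr M borel W = std_normal_distribution"
      using distributed_distr_eq_density[OF W] by (simp add: distr_cong[of M M borel lborel])
    then have "char (distr M borel W) s = exp (- s\<^sup>2 / 2)"
      by (simp add: char_std_normal_distribution)
    moreover have "char (distr M borel W) s = (\<integral>\<omega>. iexp (Z \<omega>) \<partial>M)"
      using normal(1) by (simp add: char_def integral_distr W_def)
    ultimately have char: "(\<integral>\<omega>. iexp (Z \<omega>) \<partial>M) = complex_of_real (exp (- s\<^sup>2 / 2))" by simp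
    have "expectation (\<lambda>\<omega>. cos (b + Z \<omega>)) = expectation (\<lambda>\<omega>. Re (iexp b * iexp (Z \<omega>)))"
      by (simp add: cos_add Re_exp Im_exp)
    also have "\<dots> = Re (\<integral>\<omega>. iexp b * iexp (Z \<omega>) \<partial>M)"
      by (rule integral_Re) (intro integrable_mult_right integrable_iexp, auto)
    also have "\<dots> = cos b * exp (- s\<^sup>2 / 2)"
      using char by (simp add: Re_exp)
    finally have cos: "expectation (\<lambda>\<omega>. cos (b + Z \<omega>)) = cos b * exp (- s\<^sup>2 / 2)" .
    have "AE x in lborel. x \<noteq> (0::real)" by (rule AE_lborel_singleton)
    then have "AE x in density lborel (\<lambda>x. ennreal (normal_density m s x)). x \<noteq> 0"
      by (subst AE_density) auto
    then have "AE x in distr M lborel Z. x \<noteq> 0"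
      unfolding distributed_distr_eq_density[OF normal(2)] .
    then have "AE \<omega> in M. Z \<omega> \<noteq> 0"
      by (subst (asm) AE_distr_iff) auto
    with sq var cos normal(1) show ?thesis by simp
  qed
  then show "integrable M (\<lambda>\<omega>. (Z \<omega>)\<^sup>2)"
    "expectation (\<lambda>\<omega>. cos (b + Z \<omega>)) = cos b * exp (- covariance M Z Z / 2)"
    "covariance M Z Z = 0 \<Longrightarrow> AE \<omega> in M. Z \<omega> = 0"
    "covariance M Z Z \<noteq> 0 \<Longrightarrow> AE \<omega> in M. Z \<omega> \<noteq> 0" by auto
qed

context
  fixes Q :: "'q measure" and I :: "nat set" and X G
  assumes Q: "prob_space Q" and I: "finite I"
    and gaussian: "multivariate_normal Q I X (\<lambda>_. 0) G"
begin

interpretation prob_space Q by (rule Q)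

lemma normal_combinations: "\<forall>a. univariate_normal Q (\<lambda>\<omega>. \<Sum>i\<in>I. a i * X i \<omega>)"
  using gaussian by (simp add: multivariate_normal_def)

lemma gaussian_coordinate:
  assumes "i \<in> I"
  shows "X i \<in> borel_measurable Q" "integrable Q (\<lambda>\<omega>. (X i \<omega>)\<^sup>2)" "expectation (X i) = 0"
    "expectation (\<lambda>\<omega>. (X i \<omega>)\<^sup>2) = G i i"
proof -
  show rv: "X i \<in> borel_measurable Q" and mean: "expectation (X i) = 0"
    using assms gaussian by (auto simp: multivariate_normal_def)
  have "(\<Sum>j\<in>I. (if j = i then 1 else 0) * X j \<omega>) = X i \<omega>" for \<omega>
    using assms I by (simp add: if_distrib[of "\<lambda>y. y * _"] sum.delta cong: if_cong)
  then have un: "univariate_normal Q (X i)"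
    using spec[OF normal_combinations, of "\<lambda>j. if j = i then 1 else 0"] by (simp only:)
  show "integrable Q (\<lambda>\<omega>. (X i \<omega>)\<^sup>2)"
    by (rule centred_normal_square_integrable[OF un mean])
  have "covariance Q (X i) (X i) = G i i" using gaussian assms by (simp add: multivariate_normal_def)
  then show "expectation (\<lambda>\<omega>. (X i \<omega>)\<^sup>2) = G i i"
    using centred_normal_variance[OF un mean] by simp
qed

lemma gaussian_combination:
  shows gaussian_combination_normal: "univariate_normal Q (\<lambda>\<omega>. \<Sum>i\<in>I. a i * X i \<omega>)"
    and gaussian_combination_mean: "expectation (\<lambda>\<omega>. \<Sum>i\<in>I. a i * X i \<omega>) = 0"
    and gaussian_combination_variance:
      "covariance Q (\<lambda>\<omega>. \<Sum>i\<in>I. a i * X i \<omega>) (\<lambda>\<omega>. \<Sum>i\<in>I. a i * X i \<omega>) = bilinear_form I G a a"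
proof -
  show "univariate_normal Q (\<lambda>\<omega>. \<Sum>i\<in>I. a i * X i \<omega>)"
    using normal_combinations by blast
  have int: "integrable Q (X i)" if "i \<in> I" for i
    using square_integrable_imp_integrable gaussian_coordinate[OF that] by blast
  then show "expectation (\<lambda>\<omega>. \<Sum>i\<in>I. a i * X i \<omega>) = 0"
    by (simp add: gaussian_coordinate(3))
  have "covariance Q (\<lambda>\<omega>. \<Sum>i\<in>I. a i * X i \<omega>) (\<lambda>\<omega>. \<Sum>i\<in>I. a i * X i \<omega>)
      = (\<Sum>s\<in>I. \<Sum>t\<in>I. covariance Q (\<lambda>\<omega>. a s * X s \<omega>) (\<lambda>\<omega>. a t * X t \<omega>))"
    using gaussian_coordinate I
    by (intro covariance_sums) (auto simp: power_mult_distrib)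
  also have "\<dots> = (\<Sum>s\<in>I. \<Sum>t\<in>I. a s * a t * covariance Q (X s) (X t))"
  proof (intro sum.cong refl)
    fix s t assume "s \<in> I" "t \<in> I"
    have "(\<lambda>\<omega>. a s * X s \<omega> * (a t * X t \<omega>)) = (\<lambda>\<omega>. a s * a t * (X s \<omega> * X t \<omega>))"
      by (simp add: ac_simps)
    then show "covariance Q (\<lambda>\<omega>. a s * X s \<omega>) (\<lambda>\<omega>. a t * X t \<omega>) = a s * a t * covariance Q (X s) (X t)"
      using \<open>s \<in> I\<close> \<open>t \<in> I\<close> by (simp add: covariance_def gaussian_coordinate(3))
  qed
  also have "\<dots> = bilinear_form I G a a"
    using gaussian by (simp add: multivariate_normal_def bilinear_form_def)
  finally show "covariance Q (\<lambda>\<omega>. \<Sum>i\<in>I. a i * X i \<omega>) (\<lambda>\<omega>. \<Sum>i\<in>I. a i * X i \<omega>) = bilinear_form I G a a" .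
qed

lemmas gaussian_cos =
  centred_normal_cos[OF gaussian_combination_normal gaussian_combination_mean, unfolded gaussian_combination_variance]

lemmas gaussian_degenerate =
  centred_normal_zero[OF gaussian_combination_normal gaussian_combination_mean, unfolded gaussian_combination_variance]

lemmas gaussian_nondegenerate =
  centred_normal_nonzero[OF gaussian_combination_normal gaussian_combination_mean, unfolded gaussian_combination_variance]

end

section \<open>The ratio statistic as a functional of partial sums\<close>

text \<open>
  The linear forms in the numerator and in the denominator of the statistic.
\<close>

definition bridge :: "nat \<Rightarrow> nat \<Rightarrow> (nat \<Rightarrow> real) \<Rightarrow> real" where
  "bridge t s x = x s - real s / real t * x t"

definition reverse_bridge :: "nat \<Rightarrow> nat \<Rightarrow> nat \<Rightarrow> (nat \<Rightarrow> real) \<Rightarrow> real" where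
  "reverse_bridge T t s x = (x T - x s) - real (T - s) / real (T - t) * (x T - x t)"

definition numerator :: "nat \<Rightarrow> (nat \<Rightarrow> real) \<Rightarrow> real" where
  "numerator t x = (MAX s\<in>{1..t}. \<bar>bridge t s x\<bar>)"

definition denominator :: "nat \<Rightarrow> nat \<Rightarrow> (nat \<Rightarrow> real) \<Rightarrow> real" where
  "denominator T t x = (MAX s\<in>{t..T-1}. \<bar>reverse_bridge T t s x\<bar>)"

lemma limit_statistic_eq:
  "limit_statistic T x = (MAX t\<in>{2..T-2}. numerator t x / denominator T t x)"
  by (simp add: limit_statistic_def Let_def numerator_def denominator_def bridge_def reverse_bridge_def)

text \<open>
  As a linear form, a reverse bridge falls under the dichotomy for Gaussian combinations.
\<close>

lemma reverse_bridge_combination: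
  assumes "t \<in> {1..T}" "s \<in> {1..T}"
  shows "\<exists>a. \<forall>x. reverse_bridge T t s x = (\<Sum>i\<in>{1..T}. a i * x i)"
proof -
  define c where "c = real (T - s) / real (T - t)"
  let ?a = "\<lambda>i. (if i = T then 1 - c else 0) - (if i = s then 1 else 0) + (if i = t then c else 0)"
  have "reverse_bridge T t s x = (\<Sum>i\<in>{1..T}. ?a i * x i)" for x
    using assms unfolding reverse_bridge_def c_def[symmetric]
    by (simp add: distrib_right left_diff_distrib sum.distrib sum_subtractf
        if_distrib[of "\<lambda>y. y * _"] sum.delta cong: if_cong)
      (simp add: algebra_simps)
  then show ?thesis by (intro exI[of _ ?a] allI)
qed

lemma denominator_nonneg: "t < T \<Longrightarrow> 0 \<le> denominator T t x"
  unfolding denominator_def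
  by (rule order_trans[OF abs_ge_zero[of "reverse_bridge T t t x"]]) (auto intro!: Max_ge)

lemma denominator_zero_iff:
  assumes "t < T"
  shows "denominator T t x = 0 \<longleftrightarrow> (\<forall>s\<in>{t..T-1}. reverse_bridge T t s x = 0)"
proof
  assume 0: "denominator T t x = 0"
  show "\<forall>s\<in>{t..T-1}. reverse_bridge T t s x = 0"
  proof
    fix s assume s: "s \<in> {t..T-1}"
    have "\<bar>reverse_bridge T t s x\<bar> \<le> denominator T t x"
      unfolding denominator_def using s by (auto intro!: Max_ge)
    then show "reverse_bridge T t s x = 0" using 0 by simp
  qed
next
  assume "\<forall>s\<in>{t..T-1}. reverse_bridge T t s x = 0"
  then have "(\<lambda>s. \<bar>reverse_bridge T t s x\<bar>) ` {t..T-1} = {0}" using assms by force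
  then show "denominator T t x = 0" unfolding denominator_def by simp
qed

lemma continuous_on_Max_finite:
  fixes f :: "'i \<Rightarrow> 'x::topological_space \<Rightarrow> real"
  assumes "finite A" "A \<noteq> {}" "\<And>i. i \<in> A \<Longrightarrow> continuous_on S (f i)"
  shows "continuous_on S (\<lambda>x. MAX i\<in>A. f i x)"
  using assms by (induction rule: finite_ne_induct) (auto intro!: continuous_on_max)

lemma continuous_on_coordinate: "continuous_on UNIV (\<lambda>x :: nat \<Rightarrow> real. x i)"
  by (rule continuous_on_product_coordinates)

lemma continuous_numerator: "1 \<le> t \<Longrightarrow> continuous_on UNIV (numerator t)"
  unfolding numerator_def[abs_def] bridge_def
  by (rule continuous_on_Max_finite)
    (auto intro!: continuous_intros continuous_on_coordinate)

lemma continuous_denominator: "t < T \<Longrightarrow> continuous_on UNIV (denominator T t)"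
  unfolding denominator_def[abs_def] reverse_bridge_def
  by (rule continuous_on_Max_finite)
    (auto intro!: continuous_intros continuous_on_coordinate)

lemma limit_statistic_cong:
  assumes "4 \<le> T" "\<And>t. t \<in> {1..T} \<Longrightarrow> x t = y t"
  shows "limit_statistic T x = limit_statistic T y"
proof -
  have "numerator t x = numerator t y" "denominator T t x = denominator T t y"
    if "t \<in> {2..T-2}" for t
    using assms that unfolding numerator_def denominator_def bridge_def reverse_bridge_def
    by (auto intro!: arg_cong[of _ _ Max] image_cong)
  then show ?thesis
    unfolding limit_statistic_eq by (auto intro!: arg_cong[of _ _ Max] image_cong)
qed

lemma borel_measurable_limit_statistic:
  assumes "4 \<le> T" "\<And>t. t \<in> {1..T} \<Longrightarrow> (\<lambda>\<omega>. x \<omega> t) \<in> borel_measurable M"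
  shows "(\<lambda>\<omega>. limit_statistic T (x \<omega>)) \<in> borel_measurable M"
proof -
  have "(\<lambda>\<omega>. numerator t (x \<omega>)) \<in> borel_measurable M"
    "(\<lambda>\<omega>. denominator T t (x \<omega>)) \<in> borel_measurable M" if "t \<in> {2..T-2}" for t
    using assms that unfolding numerator_def denominator_def bridge_def reverse_bridge_def
    by (auto intro!: borel_measurable_Max borel_measurable_abs borel_measurable_diff borel_measurable_times)
  then show ?thesis
    unfolding limit_statistic_eq
    by (intro borel_measurable_Max borel_measurable_divide) auto
qed

lemma numerator_scale:
  assumes "1 \<le> t" "0 < d" shows "numerator t (\<lambda>i. d * x i) = d * numerator t x"
proof -
  have b: "bridge t s (\<lambda>i. d * x i) = d * bridge t s x" for s
    unfolding bridge_def by (simp add: algebra_simps)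
  have "numerator t (\<lambda>i. d * x i) = (MAX s\<in>{1..t}. d * \<bar>bridge t s x\<bar>)"
    unfolding numerator_def b using assms by (simp add: abs_mult)
  also have "\<dots> = d * numerator t x"
    unfolding numerator_def using assms
    by (subst mono_Max_commute[of "\<lambda>y. d * y"]) (auto simp: mono_def image_image mult_left_mono)
  finally show ?thesis .
qed

lemma denominator_scale:
  assumes "t < T" "0 < d" shows "denominator T t (\<lambda>i. d * x i) = d * denominator T t x"
proof -
  have rb: "reverse_bridge T t s (\<lambda>i. d * x i) = d * reverse_bridge T t s x" for s
    unfolding reverse_bridge_def by (simp add: algebra_simps)
  have "denominator T t (\<lambda>i. d * x i) = (MAX s\<in>{t..T-1}. d * \<bar>reverse_bridge T t s x\<bar>)"
    unfolding denominator_def rb using assms by (simp add: abs_mult)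
  also have "\<dots> = d * denominator T t x"
    unfolding denominator_def using assms
    by (subst mono_Max_commute[of "\<lambda>y. d * y"]) (auto simp: mono_def image_image mult_left_mono)
  finally show ?thesis .
qed

text \<open>
  Numerator and denominator are both homogeneous of degree one, so \<open>\<sigma>\<close> and \<open>sqrt N\<close> drop out.
\<close>

lemma limit_statistic_scale:
  assumes "0 < d" shows "limit_statistic T (\<lambda>i. d * x i) = limit_statistic T x"
  unfolding limit_statistic_eq using assms
proof (intro arg_cong[of _ _ Max] image_cong refl)
  fix t assume "t \<in> {2..T-2}"
  then have "1 \<le> t" "t < T" by auto
  then show "numerator t (\<lambda>i. d * x i) / denominator T t (\<lambda>i. d * x i) = numerator t x / denominator T t x"
    using assms by (simp add: numerator_scale denominator_scale)
qed

lemma ratio_statistic_eq_limit_statistic: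
  "ratio_statistic N T Y = limit_statistic T (\<lambda>t. \<Sum>i=1..N. \<Sum>r=1..t. Y i r)"
proof -
  let ?x = "\<lambda>t. \<Sum>i=1..N. \<Sum>r=1..t. Y i r"
  have num: "(\<Sum>i=1..N. \<Sum>r=1..s. (Y i r - mean_upto (Y i) t)) = bridge t s ?x" for s t
    by (simp add: bridge_def sum_subtractf mean_upto_def sum_distrib_left sum_divide_distrib)
  have den: "(\<Sum>i=1..N. \<Sum>r=s+1..T. (Y i r - mean_after T (Y i) t)) = reverse_bridge T t s ?x"
    if "s \<in> {t..T-1}" "t \<in> {2..T-2}" for s t
  proof -
    have tail: "(\<Sum>i=1..N. \<Sum>r=u+1..T. Y i r) = ?x T - ?x u" if "u \<le> T" for u
    proof -
      have "{1..T} = {1..u} \<union> {u+1..T}" "{1..u} \<inter> {u+1..T} = {}" using that by auto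
      then have "(\<Sum>r=1..T. Y i r) = (\<Sum>r=1..u. Y i r) + (\<Sum>r=u+1..T. Y i r)" for i
        by (simp add: sum.union_disjoint)
      then show ?thesis by (simp add: sum.distrib)
    qed
    have "(\<Sum>i=1..N. \<Sum>r=s+1..T. (Y i r - mean_after T (Y i) t)) =
        (\<Sum>i=1..N. \<Sum>r=s+1..T. Y i r) - real (T - s) / real (T - t) * (\<Sum>i=1..N. \<Sum>r=t+1..T. Y i r)"
      by (simp add: sum_subtractf mean_after_def sum_distrib_left sum_divide_distrib)
    also have "\<dots> = reverse_bridge T t s ?x"
      unfolding reverse_bridge_def using that by (subst (1 2) tail) auto
    finally show ?thesis .
  qed
  show ?thesis
    unfolding ratio_statistic_def limit_statistic_eq numerator_def denominator_def num
    by (intro arg_cong[of _ _ Max] image_cong refl arg_cong2[of _ _ _ _ "(/)"])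
      (simp only: den)
qed

text \<open>
  The indices in \<open>D\<close> are those whose denominator vanishes identically; their quotients are \<open>0\<close>. The
  others are kept away from zero by \<open>\<kappa>\<close>, which makes the functional continuous.
\<close>

definition truncated_statistic :: "nat \<Rightarrow> nat set \<Rightarrow> real \<Rightarrow> (nat \<Rightarrow> real) \<Rightarrow> real" where
  "truncated_statistic T D \<kappa> x =
    (MAX t\<in>{2..T-2}. if t \<in> D then 0 else numerator t x / max (denominator T t x) \<kappa>)"

text \<open>
  A continuous majorant of the indicator that some denominator outside \<open>D\<close> is smaller than \<open>\<kappa>\<close>; it is
  zero when all these denominators are at least \<open>2 * \<kappa>\<close>.
\<close>

definition small_denominators :: "nat \<Rightarrow> nat set \<Rightarrow> real \<Rightarrow> (nat \<Rightarrow> real) \<Rightarrow> real" where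
  "small_denominators T D \<kappa> x =
    (\<Sum>t\<in>{2..T-2} - D. max 0 (min 1 (2 - denominator T t x / \<kappa>)))"

lemma continuous_truncated_statistic:
  assumes "4 \<le> T" "0 < \<kappa>"
  shows "continuous_on UNIV (truncated_statistic T D \<kappa>)"
  unfolding truncated_statistic_def[abs_def]
proof (rule continuous_on_Max_finite)
  fix t assume t: "t \<in> {2..T-2}"
  show "continuous_on UNIV (\<lambda>x. if t \<in> D then 0 else numerator t x / max (denominator T t x) \<kappa>)"
  proof (cases "t \<in> D")
    case False
    have "max (denominator T t x) \<kappa> \<noteq> 0" for x using assms by (simp add: max_def)
    then have "continuous_on UNIV (\<lambda>x. numerator t x / max (denominator T t x) \<kappa>)"
      using t assms
      by (intro continuous_on_divide continuous_on_max continuous_on_const continuous_numerator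
          continuous_denominator) auto
    then show ?thesis using False by simp
  qed simp
qed (use assms in auto)

lemma continuous_small_denominators:
  assumes "4 \<le> T" "0 < \<kappa>"
  shows "continuous_on UNIV (small_denominators T D \<kappa>)"
  unfolding small_denominators_def[abs_def] using assms
  by (intro continuous_on_sum continuous_on_max continuous_on_min continuous_on_const
      continuous_on_diff continuous_on_divide continuous_denominator) auto

lemma small_denominators_bounds:
  "0 \<le> small_denominators T D \<kappa> x" "small_denominators T D \<kappa> x \<le> real T"
proof -
  show "0 \<le> small_denominators T D \<kappa> x"
    unfolding small_denominators_def by (intro sum_nonneg) auto
  have "small_denominators T D \<kappa> x \<le> real (card ({2..T-2} - D)) * 1"
    unfolding small_denominators_def by (rule sum_bounded_above) auto
  also have "card ({2..T-2} - D) \<le> card {2..T-2}" by (intro card_mono) auto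
  then have "real (card ({2..T-2} - D)) * 1 \<le> real T" by simp
  finally show "small_denominators T D \<kappa> x \<le> real T" .
qed

text \<open>
  The two statistics coincide when every denominator outside \<open>D\<close> is at least \<open>\<kappa>\<close>, and otherwise
  \<open>small_denominators\<close> is at least \<open>1\<close>.
\<close>

lemma truncation_error:
  assumes T: "4 \<le> T" and \<kappa>: "0 < \<kappa>" and B: "\<And>x. \<bar>f x\<bar> \<le> (B::real)"
    and zero: "\<And>t. t \<in> {2..T-2} \<inter> D \<Longrightarrow> denominator T t x = 0"
  shows "\<bar>f (limit_statistic T x) - f (truncated_statistic T D \<kappa> x)\<bar>
    \<le> 2 * B * small_denominators T D \<kappa> x"
proof (cases "\<forall>t\<in>{2..T-2} - D. \<kappa> \<le> denominator T t x")
  case True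
  have "numerator t x / denominator T t x =
      (if t \<in> D then 0 else numerator t x / max (denominator T t x) \<kappa>)" if "t \<in> {2..T-2}" for t
    using True zero that by (auto simp: max_absorb1)
  then have "limit_statistic T x = truncated_statistic T D \<kappa> x"
    unfolding limit_statistic_eq truncated_statistic_def
    by (intro arg_cong[of _ _ Max] image_cong refl)
  then show ?thesis
    using small_denominators_bounds[of T D \<kappa> x] B[of undefined] by simp
next
  case False
  then obtain t where t: "t \<in> {2..T-2} - D" "denominator T t x < \<kappa>" by auto
  have "1 = max 0 (min 1 (2 - denominator T t x / \<kappa>))"
    using t(2) \<kappa> by (simp add: max_def min_def field_simps)
  also have "\<dots> \<le> small_denominators T D \<kappa> x"
    unfolding small_denominators_def using t(1) by (intro member_le_sum) auto
  finally have "2 * B * 1 \<le> 2 * B * small_denominators T D \<kappa> x"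
    using B[of undefined] by (intro mult_left_mono) auto
  then show ?thesis
    using B[of "limit_statistic T x"] B[of "truncated_statistic T D \<kappa> x"] by linarith
qed

lemma small_denominators_tendsto_zero:
  assumes "\<And>t. t \<in> {2..T-2} - D \<Longrightarrow> 0 < denominator T t x"
  shows "(\<lambda>m. small_denominators T D (1 / real (Suc m)) x) \<longlonglongrightarrow> 0"
proof -
  have "(\<lambda>m. max 0 (min 1 (2 - denominator T t x / (1 / real (Suc m))))) \<longlonglongrightarrow> 0"
    if "t \<in> {2..T-2} - D" for t
  proof -
    obtain m where m: "2 / denominator T t x \<le> real m" using real_arch_simple by blast
    have "max 0 (min 1 (2 - denominator T t x / (1 / real (Suc k)))) = 0" if "m \<le> k" for k
    proof -
      have "2 / denominator T t x \<le> real (Suc k)" using m that by linarith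
      then have "2 \<le> denominator T t x * real (Suc k)"
        using assms[OF \<open>t \<in> _\<close>] by (simp add: pos_divide_le_eq mult.commute)
      then show ?thesis by (simp add: max_def min_def)
    qed
    then show ?thesis
      by (intro tendsto_eventually) (auto simp: eventually_sequentially)
  qed
  then have "(\<lambda>m. small_denominators T D (1 / real (Suc m)) x) \<longlonglongrightarrow> (\<Sum>t\<in>{2..T-2} - D. 0)"
    unfolding small_denominators_def by (intro tendsto_sum)
  then show ?thesis by simp
qed

section \<open>The resampled statistic of a deterministic array\<close>

definition resampled_sum :: "nat \<Rightarrow> (nat \<Rightarrow> nat \<Rightarrow> real) \<Rightarrow> (nat \<Rightarrow> nat) \<Rightarrow> nat \<Rightarrow> real" where
  "resampled_sum N q h t = (\<Sum>i=1..N. q (h i) t - average N (\<lambda>j. q j t)) / sqrt (real N)"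

definition centred_combination ::
    "'t set \<Rightarrow> ('t \<Rightarrow> real) \<Rightarrow> nat \<Rightarrow> (nat \<Rightarrow> 't \<Rightarrow> real) \<Rightarrow> nat \<Rightarrow> real" where
  "centred_combination I a N q j = (\<Sum>t\<in>I. a t * (q j t - average N (\<lambda>j. q j t)))"

text \<open>
  A linear combination of the resampled partial sums is itself a resampled sum, of one real number
  per row; this reduces the multivariate limit to \<open>resampling_clt\<close>.
\<close>

lemma combination_resampled_sum:
  "(\<Sum>t\<in>I. a t * resampled_sum N q h t) =
    (\<Sum>i=1..N. centred_combination I a N q (h i)) / sqrt (real N)"
  by (simp add: resampled_sum_def centred_combination_def sum.swap[of _ I] sum_distrib_left
      sum_divide_distrib)

lemma average_centred_combination:
  assumes "1 \<le> N"
  shows "average N (centred_combination I a N q) = 0"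
  using assms
  by (simp add: centred_combination_def[abs_def] average_sum average_cmult average_diff average_const)

lemma average_centred_combination_square:
  assumes "1 \<le> N"
  shows "average N (\<lambda>j. (centred_combination I a N q j)\<^sup>2) = bilinear_form I (\<lambda>s t.
    average N (\<lambda>j. q j s * q j t) - average N (\<lambda>j. q j s) * average N (\<lambda>j. q j t)) a a"
proof -
  let ?m = "\<lambda>t. average N (\<lambda>j. q j t)"
  have "average N (\<lambda>j. (q j s - ?m s) * (q j t - ?m t)) = average N (\<lambda>j. q j s * q j t) - ?m s * ?m t"
    for s t
  proof -
    have "(\<lambda>j. (q j s - ?m s) * (q j t - ?m t)) =
        (\<lambda>j. q j s * q j t - ?m t * q j s - (?m s * q j t - ?m s * ?m t))"
      by (simp add: algebra_simps)
    then show ?thesis using assms by (simp add: average_diff average_cmult average_const)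
  qed
  moreover have "(centred_combination I a N q j)\<^sup>2 =
      (\<Sum>s\<in>I. \<Sum>t\<in>I. a s * a t * ((q j s - ?m s) * (q j t - ?m t)))" for j
    by (simp add: centred_combination_def power2_eq_square sum_product ac_simps)
  ultimately show ?thesis
    by (simp add: average_sum average_cmult bilinear_form_def)
qed

lemma average_centred_combination_power4:
  assumes "1 \<le> N"
  shows "average N (\<lambda>j. centred_combination I a N q j ^ 4) \<le> real (card I) ^ 3 *
    (\<Sum>t\<in>I. a t ^ 4 * (8 * (average N (\<lambda>j. q j t ^ 4) + average N (\<lambda>j. q j t) ^ 4)))"
proof -
  let ?m = "\<lambda>t. average N (\<lambda>j. q j t)"
  have "centred_combination I a N q j ^ 4 \<le>
      real (card I) ^ 3 * (\<Sum>t\<in>I. a t ^ 4 * (8 * (q j t ^ 4 + ?m t ^ 4)))" for j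
  proof -
    have "centred_combination I a N q j ^ 4 \<le> real (card I) ^ 3 * (\<Sum>t\<in>I. (a t * (q j t - ?m t)) ^ 4)"
      unfolding centred_combination_def by (rule power4_sum_le)
    also have "\<dots> \<le> real (card I) ^ 3 * (\<Sum>t\<in>I. a t ^ 4 * (8 * (q j t ^ 4 + ?m t ^ 4)))"
      unfolding power_mult_distrib by (intro mult_left_mono sum_mono power4_diff_le) auto
    finally show ?thesis .
  qed
  then have "average N (\<lambda>j. centred_combination I a N q j ^ 4) \<le>
      average N (\<lambda>j. real (card I) ^ 3 * (\<Sum>t\<in>I. a t ^ 4 * (8 * (q j t ^ 4 + ?m t ^ 4))))"
    by (intro average_mono)
  also have "\<dots> = real (card I) ^ 3 *
      (\<Sum>t\<in>I. a t ^ 4 * (8 * (average N (\<lambda>j. q j t ^ 4) + ?m t ^ 4)))"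
    using assms by (simp add: average_sum average_cmult average_add average_const)
  finally show ?thesis .
qed

lemma expectation_resampled_sum_square:
  assumes "1 \<le> N"
  shows "(\<integral>h. (resampled_sum N q h t)\<^sup>2 \<partial>measure_pmf (resampling N)) =
    average N (\<lambda>j. q j t * q j t) - (average N (\<lambda>j. q j t))\<^sup>2"
proof -
  let ?u = "centred_combination {t} (\<lambda>_. 1) N q"
  have "resampled_sum N q h t = (\<Sum>i=1..N. ?u (h i)) / sqrt (real N)" for h
    using combination_resampled_sum[of "\<lambda>_. 1" N q h "{t}"] by simp
  then have "(\<integral>h. (resampled_sum N q h t)\<^sup>2 \<partial>measure_pmf (resampling N)) =
      (\<integral>h. (\<Sum>i=1..N. ?u (h i))\<^sup>2 \<partial>measure_pmf (resampling N)) / real N"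
    by (simp add: power_divide)
  also have "\<dots> = average N (\<lambda>j. (?u j)\<^sup>2)"
    using assms by (subst expectation_resampling_square_sum) (auto simp: average_centred_combination)
  also have "\<dots> = average N (\<lambda>j. q j t * q j t) - (average N (\<lambda>j. q j t))\<^sup>2"
    using assms by (subst average_centred_combination_square) (auto simp: bilinear_form_def power2_eq_square)
  finally show ?thesis .
qed

lemma AE_resampling_in_range: "1 \<le> N \<Longrightarrow> AE h in measure_pmf (resampling N). \<forall>i\<in>{1..N}. h i \<in> {1..N}"
  unfolding resampling_def
  by (subst AE_measure_pmf_iff) (auto simp: set_Pi_pmf PiE_dflt_def set_pmf_of_set)

text \<open>
  Resampled sums lie in the span of the rows, so linear forms that kill all rows kill them too.
\<close>

lemma denominator_resampled_sum_zero:
  assumes t: "1 \<le> t" "t < T" and N: "1 \<le> N" and h: "\<And>i. i \<in> {1..N} \<Longrightarrow> h i \<in> {1..N}"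
    and zero: "\<And>j. j \<in> {1..N} \<Longrightarrow> denominator T t (q j) = 0"
  shows "denominator T t (resampled_sum N q h) = 0"
  unfolding denominator_zero_iff[OF t(2)]
proof
  fix s assume s: "s \<in> {t..T-1}"
  have ts: "t \<in> {1..T}" "s \<in> {1..T}" using t s by auto
  obtain a where a: "\<And>x. reverse_bridge T t s x = (\<Sum>i\<in>{1..T}. a i * x i)"
    using reverse_bridge_combination[of t T s, OF ts] by blast
  have 0: "(\<Sum>i\<in>{1..T}. a i * q j i) = 0" if "j \<in> {1..N}" for j
    using zero[OF that] s a t(2) denominator_zero_iff by metis
  have "centred_combination {1..T} a N q j = 0" if "j \<in> {1..N}" for j
  proof -
    have "centred_combination {1..T} a N q j =
        (\<Sum>i\<in>{1..T}. a i * q j i) - average N (\<lambda>j. \<Sum>i\<in>{1..T}. a i * q j i)"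
      unfolding average_sum average_cmult
      by (simp add: centred_combination_def right_diff_distrib sum_subtractf)
    moreover have "average N (\<lambda>j. \<Sum>i\<in>{1..T}. a i * q j i) = 0"
      unfolding average_real using 0 by simp
    ultimately show ?thesis using 0[OF that] by simp
  qed
  then have "(\<Sum>i=1..N. centred_combination {1..T} a N q (h i)) = 0"
    using h by (intro sum.neutral) blast
  then show "reverse_bridge T t s (resampled_sum N q h) = 0"
    unfolding a combination_resampled_sum by simp
qed

text \<open>
  The Lyapunov condition follows from the fourth moments through \<open>\<bar>u\<bar> ^ 3 \<le> u\<^sup>2 + u ^ 4\<close>: the second
  moments converge and are divided by \<open>sqrt N\<close>, and the fourth moments are of smaller order than
  \<open>sqrt N\<close>.
\<close>

lemma resampled_sum_cos_limit:
  fixes q :: "nat \<Rightarrow> nat \<Rightarrow> nat \<Rightarrow> real"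
  assumes n: "filterlim n at_top sequentially" "\<And>k. 1 \<le> n k" and I: "finite I"
    and mean: "\<And>t. t \<in> I \<Longrightarrow> (\<lambda>k. average (n k) (\<lambda>j. q k j t)) \<longlonglongrightarrow> 0"
    and second: "\<And>s t. s \<in> I \<Longrightarrow> t \<in> I \<Longrightarrow> (\<lambda>k. average (n k) (\<lambda>j. q k j s * q k j t)) \<longlonglongrightarrow> G s t"
    and fourth: "\<And>t. t \<in> I \<Longrightarrow> (\<lambda>k. average (n k) (\<lambda>j. q k j t ^ 4) / sqrt (real (n k))) \<longlonglongrightarrow> 0"
  shows "(\<lambda>k. \<integral>h. cos (b + (\<Sum>t\<in>I. a t * resampled_sum (n k) (q k) h t)) \<partial>measure_pmf (resampling (n k)))
    \<longlonglongrightarrow> cos b * exp (- bilinear_form I G a a / 2)"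
  unfolding combination_resampled_sum
proof (rule resampling_clt[OF n])
  let ?u = "\<lambda>k. centred_combination I a (n k) (q k)"
  let ?m = "\<lambda>k t. average (n k) (\<lambda>j. q k j t)"
  show "average (n k) (?u k) = 0" for k by (rule average_centred_combination[OF n(2)])
  have "(\<lambda>k. bilinear_form I (\<lambda>s t. average (n k) (\<lambda>j. q k j s * q k j t) - ?m k s * ?m k t) a a)
      \<longlonglongrightarrow> bilinear_form I (\<lambda>s t. G s t - 0 * 0) a a"
    unfolding bilinear_form_def by (intro tendsto_intros mean second)
  then show var: "(\<lambda>k. average (n k) (\<lambda>j. (?u k j)\<^sup>2)) \<longlonglongrightarrow> bilinear_form I G a a"
    by (simp add: average_centred_combination_square[OF n(2)])
  have inv: "(\<lambda>k. 1 / sqrt (real (n k))) \<longlonglongrightarrow> 0"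
    by (intro tendsto_divide_0[OF tendsto_const] filterlim_at_top_imp_at_infinity
        filterlim_compose[OF sqrt_at_top] filterlim_compose[OF filterlim_real_sequentially] n(1))
  have bound: "average (n k) (\<lambda>j. \<bar>?u k j\<bar> ^ 3) / sqrt (real (n k)) \<le>
      average (n k) (\<lambda>j. (?u k j)\<^sup>2) * (1 / sqrt (real (n k))) + real (card I) ^ 3 * (\<Sum>t\<in>I. a t ^ 4 *
        (8 * (average (n k) (\<lambda>j. q k j t ^ 4) / sqrt (real (n k)) + ?m k t ^ 4 * (1 / sqrt (real (n k))))))" for k
  proof -
    have "average (n k) (\<lambda>j. \<bar>?u k j\<bar> ^ 3) \<le> average (n k) (\<lambda>j. (?u k j)\<^sup>2 + ?u k j ^ 4)"
      by (rule average_mono[OF abs_power3_le])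
    also have "\<dots> \<le> average (n k) (\<lambda>j. (?u k j)\<^sup>2) + real (card I) ^ 3 *
        (\<Sum>t\<in>I. a t ^ 4 * (8 * (average (n k) (\<lambda>j. q k j t ^ 4) + ?m k t ^ 4)))"
      unfolding average_add by (rule add_left_mono[OF average_centred_combination_power4[OF n(2)]])
    finally have "average (n k) (\<lambda>j. \<bar>?u k j\<bar> ^ 3) / sqrt (real (n k)) \<le> \<dots> / sqrt (real (n k))"
      by (rule divide_right_mono) simp
    then show ?thesis
      by (simp add: add_divide_distrib sum_distrib_left sum_divide_distrib distrib_left)
  qed
  have lim: "(\<lambda>k. average (n k) (\<lambda>j. (?u k j)\<^sup>2) * (1 / sqrt (real (n k))) + real (card I) ^ 3 * (\<Sum>t\<in>I. a t ^ 4 *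
        (8 * (average (n k) (\<lambda>j. q k j t ^ 4) / sqrt (real (n k)) + ?m k t ^ 4 * (1 / sqrt (real (n k)))))))
      \<longlonglongrightarrow> bilinear_form I G a a * 0 + real (card I) ^ 3 * (\<Sum>t\<in>I. a t ^ 4 * (8 * (0 + 0 ^ 4 * 0)))"
    by (intro tendsto_intros var inv fourth mean)
  show "(\<lambda>k. average (n k) (\<lambda>j. \<bar>?u k j\<bar> ^ 3) / sqrt (real (n k))) \<longlonglongrightarrow> 0"
  proof (rule tendsto_sandwich[OF _ _ tendsto_const lim[simplified]])
    show "\<forall>\<^sub>F k in sequentially. 0 \<le> average (n k) (\<lambda>j. \<bar>?u k j\<bar> ^ 3) / sqrt (real (n k))"
      by (intro always_eventually allI divide_nonneg_nonneg average_nonneg) auto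
  qed (use bound in \<open>auto intro!: always_eventually\<close>)
qed

text \<open>
  The convergence of \<open>x\<close> is inherited from approximants \<open>y m\<close> whose error bounds \<open>w m k\<close> also converge
  in \<open>k\<close>, to limits that become small with \<open>m\<close>.
\<close>

lemma LIMSEQ_by_approximation:
  fixes x :: "nat \<Rightarrow> real"
  assumes "\<And>m k. \<bar>x k - y m k\<bar> \<le> w m k" "\<And>m. \<bar>l - y' m\<bar> \<le> w' m"
    and "\<And>m. y m \<longlonglongrightarrow> y' m" "\<And>m. w m \<longlonglongrightarrow> w' m" "w' \<longlonglongrightarrow> 0"
  shows "x \<longlonglongrightarrow> l"
proof (rule LIMSEQ_I)
  fix r :: real assume r: "0 < r"
  obtain m where m: "w' m < r / 4"
    using order_tendstoD(2)[OF assms(5), of "r / 4"] r by (auto simp: eventually_sequentially)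
  have "eventually (\<lambda>k. w m k < r / 4) sequentially"
    by (rule order_tendstoD(2)[OF assms(4) m])
  moreover have "eventually (\<lambda>k. dist (y m k) (y' m) < r / 4) sequentially"
    using r by (intro tendstoD[OF assms(3)]) simp
  ultimately have "eventually (\<lambda>k. norm (x k - l) < r) sequentially"
  proof eventually_elim
    case (elim k)
    then show ?case
      using assms(1)[of k m] assms(2)[of m] m unfolding dist_real_def real_norm_def by linarith
  qed
  then show "\<exists>K. \<forall>k\<ge>K. norm (x k - l) < r" by (simp add: eventually_sequentially)
qed

text \<open>
  A Gaussian linear form that is not almost surely zero is almost surely nonzero, and one nonzero
  form suffices for a positive maximum.
\<close>

lemma denominator_gaussian_dichotomy:
  assumes Q: "prob_space Q" and gaussian: "multivariate_normal Q {1..T} X (\<lambda>_. 0) G"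
    and t: "1 \<le> t" "t < T"
    and not_zero: "\<not> (AE \<omega> in Q. denominator T t (\<lambda>i. X i \<omega>) = 0)"
  shows "AE \<omega> in Q. 0 < denominator T t (\<lambda>i. X i \<omega>)"
proof -
  obtain s where s: "s \<in> {t..T-1}" "\<not> (AE \<omega> in Q. reverse_bridge T t s (\<lambda>i. X i \<omega>) = 0)"
  proof (rule ccontr)
    assume "\<not> thesis"
    then have "\<forall>s\<in>{t..T-1}. AE \<omega> in Q. reverse_bridge T t s (\<lambda>i. X i \<omega>) = 0" using that by blast
    then have "AE \<omega> in Q. \<forall>s\<in>{t..T-1}. reverse_bridge T t s (\<lambda>i. X i \<omega>) = 0"
      by (subst AE_finite_all) auto
    then show False using not_zero denominator_zero_iff[OF t(2)] by simp
  qed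
  have "t \<in> {1..T}" "s \<in> {1..T}" using t s by auto
  then obtain a where a: "\<And>x. reverse_bridge T t s x = (\<Sum>i\<in>{1..T}. a i * x i)"
    using reverse_bridge_combination[of t T s] by blast
  have "AE \<omega> in Q. reverse_bridge T t s (\<lambda>i. X i \<omega>) \<noteq> 0"
    unfolding a
    using s(2) gaussian_degenerate[OF Q _ gaussian, of a] gaussian_nondegenerate[OF Q _ gaussian, of a]
    unfolding a by auto
  then show ?thesis
  proof eventually_elim
    case (elim \<omega>)
    then have "denominator T t (\<lambda>i. X i \<omega>) \<noteq> 0" using denominator_zero_iff[OF t(2)] s(1) by blast
    then show ?case using denominator_nonneg[OF t(2)] by (simp add: order_less_le)
  qed
qed

text \<open>
  Convergence of the truncated statistic is \<open>cramer_wold\<close>. The truncation errors of the resampled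
  statistic and of the limit are bounded by \<open>2 * B\<close> times the expectation of \<open>small_denominators\<close>, to which
  \<open>cramer_wold\<close> applies as well; in the limit it vanishes with \<open>\<kappa>\<close> by dominated convergence.
\<close>

lemma resampled_statistic_limit:
  fixes q :: "nat \<Rightarrow> nat \<Rightarrow> nat \<Rightarrow> real" and f :: "real \<Rightarrow> real"
  assumes T: "4 \<le> T"
    and n: "filterlim n at_top sequentially" "\<And>k. 1 \<le> n k"
    and mean: "\<And>t. t \<in> {1..T} \<Longrightarrow> (\<lambda>k. average (n k) (\<lambda>j. q k j t)) \<longlonglongrightarrow> 0"
    and second: "\<And>s t. s \<in> {1..T} \<Longrightarrow> t \<in> {1..T} \<Longrightarrow>
      (\<lambda>k. average (n k) (\<lambda>j. q k j s * q k j t)) \<longlonglongrightarrow> G s t"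
    and fourth: "\<And>t. t \<in> {1..T} \<Longrightarrow>
      (\<lambda>k. average (n k) (\<lambda>j. q k j t ^ 4) / sqrt (real (n k))) \<longlonglongrightarrow> 0"
    and degenerate: "\<And>t k j. t \<in> {2..T-2} \<Longrightarrow> (AE \<omega> in Q. denominator T t (\<lambda>i. X i \<omega>) = 0) \<Longrightarrow>
      j \<in> {1..n k} \<Longrightarrow> denominator T t (q k j) = 0"
    and Q: "prob_space Q" and gaussian: "multivariate_normal Q {1..T} X (\<lambda>_. 0) G"
    and f: "continuous_on UNIV f" "\<And>x. \<bar>f x\<bar> \<le> B"
  shows "(\<lambda>k. \<integral>h. f (limit_statistic T (resampled_sum (n k) (q k) h)) \<partial>measure_pmf (resampling (n k)))
    \<longlonglongrightarrow> (\<integral>\<omega>. f (limit_statistic T (\<lambda>t. X t \<omega>)) \<partial>Q)"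
proof -
  interpret Q: prob_space Q by (rule Q)
  let ?I = "{1..T}"
  let ?P = "\<lambda>k. measure_pmf (resampling (n k))"
  \<comment> \<open>Only the coordinates \<open>1, \<dots>, T\<close> matter; setting the others to \<open>0\<close> gives vectors supported on \<open>?I\<close>.\<close>
  define V where "V k h t = (if t \<in> ?I then resampled_sum (n k) (q k) h t else 0)" for k h t
  define Z where "Z \<omega> t = (if t \<in> ?I then X t \<omega> else 0)" for \<omega> t
  define D where "D = {t. AE \<omega> in Q. denominator T t (\<lambda>i. X i \<omega>) = 0}"
  let ?g = "\<lambda>m x. f (truncated_statistic T D (1 / real (Suc m)) x)"
  let ?w = "\<lambda>m x. small_denominators T D (1 / real (Suc m)) x"

  have X: "X i \<in> borel_measurable Q" "integrable Q (\<lambda>\<omega>. (X i \<omega>)\<^sup>2)" "(\<integral>\<omega>. (X i \<omega>)\<^sup>2 \<partial>Q) = G i i"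
    if "i \<in> ?I" for i
    using gaussian_coordinate[OF Q _ gaussian that] by auto
  have Z: "Z \<in> borel_measurable Q"
  proof (rule measurable_coordinatewise_then_product)
    fix i show "(\<lambda>\<omega>. Z \<omega> i) \<in> borel_measurable Q"
      using X(1)[of i] by (cases "i \<in> ?I") (auto simp: Z_def)
  qed
  have den_cong: "denominator T t x = denominator T t y" if "\<And>i. i \<in> ?I \<Longrightarrow> x i = y i" "t \<in> {2..T-2}" for t x y
    using that unfolding denominator_def reverse_bridge_def
    by (auto intro!: arg_cong[of _ _ Max] image_cong)

  have "\<exists>C. \<forall>k. \<forall>t\<in>?I. (\<integral>h. (V k h t)\<^sup>2 \<partial>?P k) \<le> C \<and> (\<integral>\<omega>. (Z \<omega> t)\<^sup>2 \<partial>Q) \<le> C"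
  proof -
    have "\<exists>c. (\<forall>k. (\<integral>h. (V k h t)\<^sup>2 \<partial>?P k) \<le> c) \<and> (\<integral>\<omega>. (Z \<omega> t)\<^sup>2 \<partial>Q) \<le> c" if t: "t \<in> ?I" for t
    proof -
      have "(\<lambda>k. average (n k) (\<lambda>j. q k j t * q k j t) - (average (n k) (\<lambda>j. q k j t))\<^sup>2) \<longlonglongrightarrow> G t t - 0\<^sup>2"
        by (intro tendsto_intros second mean t)
      then have "Bseq (\<lambda>k. average (n k) (\<lambda>j. q k j t * q k j t) - (average (n k) (\<lambda>j. q k j t))\<^sup>2)"
        by (rule convergent_imp_Bseq[OF convergentI])
      then obtain c where c: "\<And>k. \<bar>average (n k) (\<lambda>j. q k j t * q k j t) - (average (n k) (\<lambda>j. q k j t))\<^sup>2\<bar> \<le> c"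
        by (auto simp: Bseq_def)
      have "(\<integral>h. (V k h t)\<^sup>2 \<partial>?P k) \<le> c" for k
        using t c[of k] by (simp add: V_def expectation_resampled_sum_square[OF n(2)])
      then show ?thesis
        by (intro exI[of _ "max c (\<integral>\<omega>. (Z \<omega> t)\<^sup>2 \<partial>Q)"]) (auto intro: max.coboundedI1)
    qed
    then obtain c where c: "\<And>t. t \<in> ?I \<Longrightarrow> (\<forall>k. (\<integral>h. (V k h t)\<^sup>2 \<partial>?P k) \<le> c t) \<and> (\<integral>\<omega>. (Z \<omega> t)\<^sup>2 \<partial>Q) \<le> c t"
      by metis
    have "c t \<le> (MAX t\<in>?I. c t)" if "t \<in> ?I" for t using that by (intro Max_ge) auto
    then show ?thesis using c by (meson order_trans)
  qed
  then obtain C where C: "\<And>k t. t \<in> ?I \<Longrightarrow> (\<integral>h. (V k h t)\<^sup>2 \<partial>?P k) \<le> C"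
    "\<And>t. t \<in> ?I \<Longrightarrow> (\<integral>\<omega>. (Z \<omega> t)\<^sup>2 \<partial>Q) \<le> C" by metis

  have conv: "(\<lambda>k. \<integral>h. g (V k h) \<partial>?P k) \<longlonglongrightarrow> (\<integral>\<omega>. g (Z \<omega>) \<partial>Q)"
    if g: "continuous_on UNIV g" "\<And>x. \<bar>g x\<bar> \<le> b" for g :: "(nat \<Rightarrow> real) \<Rightarrow> real" and b
  proof (rule cramer_wold[where P = ?P and V = V and I = ?I and C = C and B = b])
    show "prob_space Q" "Z \<in> borel_measurable Q" "continuous_on UNIV g" "\<And>x. \<bar>g x\<bar> \<le> b"
      "\<And>k t. t \<in> ?I \<Longrightarrow> (\<integral>h. (V k h t)\<^sup>2 \<partial>?P k) \<le> C" "\<And>t. t \<in> ?I \<Longrightarrow> (\<integral>\<omega>. (Z \<omega> t)\<^sup>2 \<partial>Q) \<le> C"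
      by (fact Q Z g C)+
    show "integrable (?P k) (\<lambda>h. (V k h t)\<^sup>2)" for k t by (rule integrable_resampling[OF n(2)])
    show "prob_space (?P k)" for k by (rule measure_pmf.prob_space_axioms)
    show "(\<lambda>k. \<integral>h. cos (b + (\<Sum>i\<in>?I. a i * V k h i)) \<partial>?P k)
        \<longlonglongrightarrow> (\<integral>\<omega>. cos (b + (\<Sum>i\<in>?I. a i * Z \<omega> i)) \<partial>Q)" for a b
      using resampled_sum_cos_limit[of n ?I q G b a, OF n _ mean second fourth] gaussian_cos[OF Q _ gaussian, of b a]
      by (simp add: V_def Z_def)
  qed (use X in \<open>auto simp: V_def Z_def\<close>)

  have bound_V: "\<bar>(\<integral>h. f (limit_statistic T (resampled_sum (n k) (q k) h)) \<partial>?P k) - (\<integral>h. ?g m (V k h) \<partial>?P k)\<bar>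
      \<le> (\<integral>h. 2 * B * ?w m (V k h) \<partial>?P k)" for m k
  proof -
    have "\<bar>(\<integral>h. f (limit_statistic T (resampled_sum (n k) (q k) h)) \<partial>?P k) - (\<integral>h. ?g m (V k h) \<partial>?P k)\<bar>
        = \<bar>\<integral>h. f (limit_statistic T (resampled_sum (n k) (q k) h)) - ?g m (V k h) \<partial>?P k\<bar>"
      by (subst Bochner_Integration.integral_diff) (auto intro!: integrable_resampling n)
    also have "\<dots> \<le> (\<integral>h. \<bar>f (limit_statistic T (resampled_sum (n k) (q k) h)) - ?g m (V k h)\<bar> \<partial>?P k)"
      by (rule integral_abs_bound)
    also have "\<dots> \<le> (\<integral>h. 2 * B * ?w m (V k h) \<partial>?P k)"
    proof (rule integral_mono_AE)
      show "AE h in ?P k. \<bar>f (limit_statistic T (resampled_sum (n k) (q k) h)) - ?g m (V k h)\<bar>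
          \<le> 2 * B * ?w m (V k h)"
        using AE_resampling_in_range[OF n(2)[of k]]
      proof eventually_elim
        case (elim h)
        have "denominator T t (V k h) = 0" if t: "t \<in> {2..T-2} \<inter> D" for t
        proof -
          have "denominator T t (resampled_sum (n k) (q k) h) = 0"
            using elim t n(2)[of k] degenerate[of t]
            by (intro denominator_resampled_sum_zero) (auto simp: D_def)
          then show ?thesis using den_cong[of "V k h" "resampled_sum (n k) (q k) h" t] t
            by (simp add: V_def)
        qed
        moreover have "limit_statistic T (resampled_sum (n k) (q k) h) = limit_statistic T (V k h)"
          by (rule limit_statistic_cong[OF T]) (simp add: V_def)
        ultimately show ?case using truncation_error[OF T _ f(2), of "1 / real (Suc m)" D "V k h"] by simp
      qed
    qed (auto intro!: integrable_resampling n)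
    finally show ?thesis .
  qed

  have int_w: "integrable Q (\<lambda>\<omega>. ?w m (Z \<omega>))" for m
    by (rule Q.integrable_bounded_continuous[OF Z continuous_small_denominators[OF T], where B = "real T"])
      (use small_denominators_bounds in \<open>auto simp: abs_le_iff intro: order_trans[of _ 0]\<close>)
  have cont_g: "continuous_on UNIV (?g m)" for m
    by (rule continuous_on_compose2[OF f(1) continuous_truncated_statistic[OF T]]) auto
  have int_g: "integrable Q (\<lambda>\<omega>. ?g m (Z \<omega>))" for m
    by (rule Q.integrable_bounded_continuous[OF Z cont_g f(2)])
  have [measurable]: "f \<in> borel_measurable borel" by (rule borel_measurable_continuous_onI[OF f(1)])
  have meas: "(\<lambda>\<omega>. limit_statistic T (\<lambda>t. X t \<omega>)) \<in> borel_measurable Q"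
    by (rule borel_measurable_limit_statistic[OF T X(1)])
  have int_f: "integrable Q (\<lambda>\<omega>. f (limit_statistic T (\<lambda>t. X t \<omega>)))"
    by (rule Q.integrable_const_bound[of _ B]) (use f meas in auto)

  have bound_Z: "\<bar>(\<integral>\<omega>. f (limit_statistic T (\<lambda>t. X t \<omega>)) \<partial>Q) - (\<integral>\<omega>. ?g m (Z \<omega>) \<partial>Q)\<bar>
      \<le> (\<integral>\<omega>. 2 * B * ?w m (Z \<omega>) \<partial>Q)" for m
  proof -
    have "\<bar>(\<integral>\<omega>. f (limit_statistic T (\<lambda>t. X t \<omega>)) \<partial>Q) - (\<integral>\<omega>. ?g m (Z \<omega>) \<partial>Q)\<bar>
        \<le> (\<integral>\<omega>. \<bar>f (limit_statistic T (\<lambda>t. X t \<omega>)) - ?g m (Z \<omega>)\<bar> \<partial>Q)"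
      by (subst Bochner_Integration.integral_diff[OF int_f int_g, symmetric]) (rule integral_abs_bound)
    also have "\<dots> \<le> (\<integral>\<omega>. 2 * B * ?w m (Z \<omega>) \<partial>Q)"
    proof (rule integral_mono_AE)
      have "AE \<omega> in Q. \<forall>t\<in>{2..T-2} \<inter> D. denominator T t (\<lambda>i. X i \<omega>) = 0"
        by (subst AE_finite_all) (auto simp: D_def)
      then show "AE \<omega> in Q. \<bar>f (limit_statistic T (\<lambda>t. X t \<omega>)) - ?g m (Z \<omega>)\<bar> \<le> 2 * B * ?w m (Z \<omega>)"
      proof eventually_elim
        case (elim \<omega>)
        have "denominator T t (Z \<omega>) = 0" if "t \<in> {2..T-2} \<inter> D" for t
          using elim that den_cong[of "Z \<omega>" "\<lambda>i. X i \<omega>" t] by (simp add: Z_def)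
        moreover have "limit_statistic T (\<lambda>t. X t \<omega>) = limit_statistic T (Z \<omega>)"
          by (rule limit_statistic_cong[OF T]) (simp add: Z_def)
        ultimately show ?case using truncation_error[OF T _ f(2), of "1 / real (Suc m)" D "Z \<omega>"] by simp
      qed
    qed (use int_f int_g int_w in auto)
    finally show ?thesis .
  qed

  have "(\<lambda>m. \<integral>\<omega>. ?w m (Z \<omega>) \<partial>Q) \<longlonglongrightarrow> (\<integral>\<omega>. 0 \<partial>Q)"
  proof (rule integral_dominated_convergence[where w = "\<lambda>_. real T"])
    have "AE \<omega> in Q. \<forall>t\<in>{2..T-2} - D. 0 < denominator T t (\<lambda>i. X i \<omega>)"
      by (subst AE_finite_all)
        (auto simp: D_def intro!: denominator_gaussian_dichotomy[OF Q gaussian])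
    then show "AE \<omega> in Q. (\<lambda>m. ?w m (Z \<omega>)) \<longlonglongrightarrow> 0"
    proof eventually_elim
      case (elim \<omega>)
      have "denominator T t (Z \<omega>) = denominator T t (\<lambda>i. X i \<omega>)" if "t \<in> {2..T-2} - D" for t
        using that by (intro den_cong) (auto simp: Z_def)
      then show ?case using elim by (intro small_denominators_tendsto_zero) auto
    qed
  qed (use int_w small_denominators_bounds in \<open>auto simp: abs_le_iff intro: order_trans[of _ 0]\<close>)
  then have w0: "(\<lambda>m. \<integral>\<omega>. 2 * B * ?w m (Z \<omega>) \<partial>Q) \<longlonglongrightarrow> 0"
    by (simp add: tendsto_mult_right_zero)

  show ?thesis
  proof (rule LIMSEQ_by_approximation[OF bound_V bound_Z _ _ w0])
    show "(\<lambda>k. \<integral>h. ?g m (V k h) \<partial>?P k) \<longlonglongrightarrow> (\<integral>\<omega>. ?g m (Z \<omega>) \<partial>Q)" for m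
      by (rule conv[OF cont_g f(2)])
    have B: "0 \<le> B" using f(2)[of undefined] by linarith
    show "(\<lambda>k. \<integral>h. 2 * B * ?w m (V k h) \<partial>?P k) \<longlonglongrightarrow> (\<integral>\<omega>. 2 * B * ?w m (Z \<omega>) \<partial>Q)" for m
    proof (rule conv[of _ "2 * B * real T"])
      show "continuous_on UNIV (\<lambda>x. 2 * B * ?w m x)"
        by (intro continuous_on_mult continuous_on_const continuous_small_denominators T) simp
      show "\<bar>2 * B * ?w m x\<bar> \<le> 2 * B * real T" for x
        using B small_denominators_bounds by (simp add: abs_mult abs_of_nonneg mult_left_mono)
    qed
  qed
qed

text \<open>
  The event of the data, shown to be likely for every \<open>d > 0\<close>, on which the resampled statistic is
  compared with its limit.
\<close>

definition moments_close ::
    "nat \<Rightarrow> (nat \<Rightarrow> nat \<Rightarrow> real) \<Rightarrow> real \<Rightarrow> nat \<Rightarrow> (nat \<Rightarrow> nat \<Rightarrow> real) \<Rightarrow> bool" where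
  "moments_close T G d N q \<longleftrightarrow> (\<forall>s\<in>{1..T}.
     \<bar>average N (\<lambda>j. q j s)\<bar> \<le> d \<and>
     average N (\<lambda>j. q j s ^ 4) / sqrt (real N) \<le> d \<and>
     (\<forall>t\<in>{1..T}. \<bar>average N (\<lambda>j. q j s * q j t) - G s t\<bar> \<le> d))"

text \<open>
  Otherwise there would be arrays with \<open>N \<ge> Suc k\<close> rows and moments within \<open>1 / Suc k\<close> of their limits
  whose statistics stay away from the limit, against \<open>resampled_statistic_limit\<close>. In this form the
  randomness of the data enters only through the event that the moments are close.
\<close>

lemma resampled_statistic_uniform:
  fixes f :: "real \<Rightarrow> real"
  assumes T: "4 \<le> T" and Q: "prob_space Q" and gaussian: "multivariate_normal Q {1..T} X (\<lambda>_. 0) G"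
    and f: "continuous_on UNIV f" "\<And>x. \<bar>f x\<bar> \<le> B" and e: "0 < e"
  shows "\<exists>d>0. \<exists>N0. \<forall>N\<ge>N0. \<forall>q. moments_close T G d N q \<longrightarrow>
    (\<forall>t\<in>{2..T-2}. (AE \<omega> in Q. denominator T t (\<lambda>i. X i \<omega>) = 0) \<longrightarrow>
      (\<forall>j\<in>{1..N}. denominator T t (q j) = 0)) \<longrightarrow>
    \<bar>(\<integral>h. f (limit_statistic T (resampled_sum N q h)) \<partial>measure_pmf (resampling N)) -
      (\<integral>\<omega>. f (limit_statistic T (\<lambda>t. X t \<omega>)) \<partial>Q)\<bar> \<le> e"
proof (rule ccontr)
  assume contr: "\<not> ?thesis"
  let ?d = "\<lambda>k. 1 / real (Suc k)"
  let ?F = "\<lambda>N q. (\<integral>h. f (limit_statistic T (resampled_sum N q h)) \<partial>measure_pmf (resampling N))"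
  let ?L = "\<integral>\<omega>. f (limit_statistic T (\<lambda>t. X t \<omega>)) \<partial>Q"
  have "\<exists>N\<ge>Suc k. \<exists>q. moments_close T G (?d k) N q \<and>
      (\<forall>t\<in>{2..T-2}. (AE \<omega> in Q. denominator T t (\<lambda>i. X i \<omega>) = 0) \<longrightarrow>
        (\<forall>j\<in>{1..N}. denominator T t (q j) = 0)) \<and> e < \<bar>?F N q - ?L\<bar>" for k
  proof (rule ccontr)
    assume "\<not> ?thesis"
    then have "0 < ?d k \<and> (\<exists>N0. \<forall>N\<ge>N0. \<forall>q. moments_close T G (?d k) N q \<longrightarrow>
      (\<forall>t\<in>{2..T-2}. (AE \<omega> in Q. denominator T t (\<lambda>i. X i \<omega>) = 0) \<longrightarrow>
        (\<forall>j\<in>{1..N}. denominator T t (q j) = 0)) \<longrightarrow> \<bar>?F N q - ?L\<bar> \<le> e)"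
      by (intro conjI exI[of _ "Suc k"]) (simp, meson not_less)
    then show False using contr by blast
  qed
  then obtain n q where nq: "\<And>k. Suc k \<le> n k" "\<And>k. moments_close T G (?d k) (n k) (q k)"
    "\<And>k. \<forall>t\<in>{2..T-2}. (AE \<omega> in Q. denominator T t (\<lambda>i. X i \<omega>) = 0) \<longrightarrow>
        (\<forall>j\<in>{1..n k}. denominator T t (q k j) = 0)"
    "\<And>k. e < \<bar>?F (n k) (q k) - ?L\<bar>"
    by metis
  have d0: "?d \<longlonglongrightarrow> 0" using LIMSEQ_inverse_real_of_nat by (simp add: inverse_eq_divide)
  have to_zero: "x \<longlonglongrightarrow> 0" if "\<And>k. \<bar>x k\<bar> \<le> ?d k" for x :: "nat \<Rightarrow> real"
    by (rule Lim_null_comparison[OF _ d0]) (use that in auto)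
  have "(\<lambda>k. ?F (n k) (q k)) \<longlonglongrightarrow> ?L"
  proof (rule resampled_statistic_limit[OF T _ _ _ _ _ _ Q gaussian f])
    show "filterlim n at_top sequentially"
      by (rule filterlim_at_top_mono[OF filterlim_Suc]) (use nq(1) in auto)
    show "1 \<le> n k" for k using nq(1)[of k] by simp
    fix t assume t: "t \<in> {1..T}"
    show "(\<lambda>k. average (n k) (\<lambda>j. q k j t)) \<longlonglongrightarrow> 0"
      using nq(2) t by (intro to_zero) (auto simp: moments_close_def)
    show "(\<lambda>k. average (n k) (\<lambda>j. q k j t ^ 4) / sqrt (real (n k))) \<longlonglongrightarrow> 0"
    proof (rule to_zero)
      fix k
      have "0 \<le> average (n k) (\<lambda>j. q k j t ^ 4) / sqrt (real (n k))"
        by (intro divide_nonneg_nonneg average_nonneg) auto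
      moreover have "average (n k) (\<lambda>j. q k j t ^ 4) / sqrt (real (n k)) \<le> ?d k"
        using nq(2)[of k] t by (auto simp: moments_close_def)
      ultimately show "\<bar>average (n k) (\<lambda>j. q k j t ^ 4) / sqrt (real (n k))\<bar> \<le> ?d k"
        by (simp only: abs_of_nonneg)
    qed
    fix s assume s: "s \<in> {1..T}"
    have "(\<lambda>k. average (n k) (\<lambda>j. q k j s * q k j t) - G s t) \<longlonglongrightarrow> 0"
      using nq(2) s t by (intro to_zero) (auto simp: moments_close_def)
    then show "(\<lambda>k. average (n k) (\<lambda>j. q k j s * q k j t)) \<longlonglongrightarrow> G s t"
      by (simp add: LIM_zero_iff)
  qed (use nq(3) in blast)
  then have "eventually (\<lambda>k. dist (?F (n k) (q k)) ?L < e) sequentially"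
    by (rule tendstoD[OF _ e])
  then obtain k where "dist (?F (n k) (q k)) ?L < e" by (auto simp: eventually_sequentially)
  then show False using nq(4)[of k] by (simp add: dist_real_def)
qed

section \<open>Residual partial sums and their covariance\<close>

text \<open>
  The covariance of two sums of errors over index sets of one row. The functions \<open>r_fun\<close>, \<open>R_fun\<close> and
  \<open>S_fun\<close> are its values on equal, adjacent and separated blocks.
\<close>

definition block_covariance :: "(int \<Rightarrow> real) \<Rightarrow> nat set \<Rightarrow> nat set \<Rightarrow> real" where
  "block_covariance \<rho> A B = (\<Sum>s\<in>A. \<Sum>u\<in>B. \<rho> (int u - int s))"

lemma bilinear_form_blocks:
  assumes "finite I" "A \<subseteq> I" "B \<subseteq> I"
  shows "bilinear_form I (\<lambda>s u. \<rho> (int u - int s)) (\<lambda>r. of_bool (r \<in> A)) (\<lambda>r. of_bool (r \<in> B)) =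
    block_covariance \<rho> A B"
proof -
  have "bilinear_form I (\<lambda>s u. \<rho> (int u - int s)) (\<lambda>r. of_bool (r \<in> A)) (\<lambda>r. of_bool (r \<in> B)) =
      (\<Sum>s\<in>I. of_bool (s \<in> A) * (\<Sum>u\<in>I. of_bool (u \<in> B) * \<rho> (int u - int s)))"
    by (simp add: bilinear_form_def sum_distrib_left mult.assoc)
  also have "\<dots> = (\<Sum>s\<in>I \<inter> A. \<Sum>u\<in>I \<inter> B. \<rho> (int u - int s))"
    using assms(1) by (simp add: of_bool_def if_distrib[of "\<lambda>y. y * _"] sum.inter_restrict cong: if_cong)
  finally show ?thesis using assms(2,3) by (simp add: block_covariance_def Int_absorb1)
qed

lemma block_covariance_commute:
  assumes "\<And>t. \<rho> (- t) = \<rho> t"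
  shows "block_covariance \<rho> A B = block_covariance \<rho> B A"
proof -
  have "\<rho> (int u - int s) = \<rho> (int s - int u)" for s u
    using assms[of "int u - int s"] by simp
  then show ?thesis unfolding block_covariance_def by (subst sum.swap) simp
qed

lemma r_fun_add_R_fun:
  assumes "t \<le> v"
  shows "r_fun \<rho> t + R_fun \<rho> t v = block_covariance \<rho> {1..t} {1..v}"
proof -
  have "{1..v} = {1..t} \<union> {t+1..v}" "{1..t} \<inter> {t+1..v} = {}" using assms by auto
  then have "(\<Sum>u=1..v. \<rho> (int u - int s)) =
      (\<Sum>u=1..t. \<rho> (int u - int s)) + (\<Sum>u=t+1..v. \<rho> (int u - int s))" for s
    by (simp add: sum.union_disjoint)
  then show ?thesis
    unfolding r_fun_eq_double_sum R_fun_def block_covariance_def sum.distrib[symmetric]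
    by (intro sum.cong refl) simp
qed

lemma r_fun_block: "r_fun \<rho> t = block_covariance \<rho> {1..t} {1..t}"
  by (simp add: r_fun_eq_double_sum block_covariance_def)

lemma R_fun_block:
  "t \<le> v \<Longrightarrow> R_fun \<rho> t v = block_covariance \<rho> {1..t} {1..v} - block_covariance \<rho> {1..t} {1..t}"
  using r_fun_add_R_fun[of t v \<rho>] by (simp add: r_fun_block)

text \<open>
  Stationarity: after the change point, \<open>r_fun\<close> and \<open>R_fun\<close> are evaluated at times counted from it.
\<close>

lemma block_covariance_shift:
  assumes "k \<le> t" "k \<le> v"
  shows "block_covariance \<rho> {k+1..t} {k+1..v} = block_covariance \<rho> {1..t-k} {1..v-k}"
proof -
  have shift: "(\<Sum>s=k+1..t. g s) = (\<Sum>s=1..t-k. g (s + k))" if "k \<le> t" for g :: "nat \<Rightarrow> real" and t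
    using sum.shift_bounds_cl_nat_ivl[of g 1 k "t - k"] that by (simp add: add.commute)
  show ?thesis unfolding block_covariance_def using assms by (simp add: shift del: One_nat_def)
qed

definition residual_sum :: "nat \<Rightarrow> nat \<Rightarrow> (nat \<Rightarrow> real) \<Rightarrow> nat \<Rightarrow> real" where
  "residual_sum T k y t = (\<Sum>r=1..t. if r \<le> k then y r - mean_upto y k else y r - mean_after T y k)"

text \<open>
  The coefficient of entry \<open>r\<close> of a row in the partial sum up to \<open>t\<close> of its residuals. For \<open>t > k\<close> the
  residuals up to \<open>k\<close> add up to zero, so that only the block after \<open>k\<close> contributes.
\<close>

definition residual_weight :: "nat \<Rightarrow> nat \<Rightarrow> nat \<Rightarrow> nat \<Rightarrow> real" where
  "residual_weight T k t r =
    (if t \<le> k then of_bool (r \<in> {1..t}) - real t / real k * of_bool (r \<in> {1..k})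
     else of_bool (r \<in> {k+1..t}) - real (t - k) / real (T - k) * of_bool (r \<in> {k+1..T}))"

lemma sum_of_bool_block:
  assumes "finite I" "A \<subseteq> I"
  shows "(\<Sum>r\<in>I. of_bool (r \<in> A) * (y r :: real)) = (\<Sum>r\<in>A. y r)"
proof -
  have "(\<Sum>r\<in>I. of_bool (r \<in> A) * y r) = (\<Sum>r\<in>I \<inter> A. y r)"
    using assms(1) by (simp add: of_bool_def if_distrib[of "\<lambda>y. y * _"] sum.inter_restrict cong: if_cong)
  then show ?thesis using assms(2) by (simp add: Int_absorb1)
qed

lemma residual_sum_weights:
  assumes k: "1 \<le> k" "k \<le> T" and t: "t \<le> T"
  shows "residual_sum T k y t = (\<Sum>r\<in>{1..T}. residual_weight T k t r * y r)"
proof (cases "t \<le> k")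
  case True
  have "residual_sum T k y t = (\<Sum>r=1..t. y r - mean_upto y k)"
    unfolding residual_sum_def using True by (intro sum.cong) auto
  also have "\<dots> = (\<Sum>r=1..t. y r) - real t / real k * (\<Sum>r=1..k. y r)"
    by (simp add: sum_subtractf mean_upto_def)
  also have "\<dots> = (\<Sum>r\<in>{1..T}. residual_weight T k t r * y r)"
    using True k t sum_of_bool_block[of "{1..T}" "{1..t}" y] sum_of_bool_block[of "{1..T}" "{1..k}" y]
    unfolding residual_weight_def
    by (simp add: left_diff_distrib sum_subtractf mult.assoc flip: sum_distrib_left sum_divide_distrib)
  finally show ?thesis .
next
  case False
  then have split: "{1..t} = {1..k} \<union> {k+1..t}" "{1..k} \<inter> {k+1..t} = {}" by auto
  have "residual_sum T k y t = (\<Sum>r=1..k. y r - mean_upto y k) + (\<Sum>r=k+1..t. y r - mean_after T y k)"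
    unfolding residual_sum_def split(1) sum.union_disjoint[OF finite_atLeastAtMost finite_atLeastAtMost split(2)]
    by (intro arg_cong2[of _ _ _ _ "(+)"] sum.cong) auto
  also have "(\<Sum>r=1..k. y r - mean_upto y k) = 0"
    using k by (simp add: sum_subtractf mean_upto_def)
  also have "(\<Sum>r=k+1..t. y r - mean_after T y k) =
      (\<Sum>r=k+1..t. y r) - real (t - k) / real (T - k) * (\<Sum>r=k+1..T. y r)"
    by (simp add: sum_subtractf mean_after_def)
  also have "0 + \<dots> = (\<Sum>r\<in>{1..T}. residual_weight T k t r * y r)"
    using False k t sum_of_bool_block[of "{1..T}" "{k+1..t}" y] sum_of_bool_block[of "{1..T}" "{k+1..T}" y]
    unfolding residual_weight_def
    by (simp add: left_diff_distrib sum_subtractf mult.assoc flip: sum_distrib_left sum_divide_distrib)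
  finally show ?thesis .
qed

text \<open>
  For \<open>s \<le> t\<close> each case of the definition of \<open>gamma_matrix\<close> is the expansion of the covariance of two
  differences of block sums into four block covariances.
\<close>

lemma gamma_matrix_eq_bilinear_form:
  assumes k: "1 \<le> k" "k \<le> T" and st: "s \<in> {1..T}" "t \<in> {1..T}"
    and even: "\<And>t. \<rho> (- t) = \<rho> t"
  shows "gamma_matrix \<rho> T k s t =
    bilinear_form {1..T} (\<lambda>r u. \<rho> (int u - int r)) (residual_weight T k s) (residual_weight T k t)"
proof -
  let ?b = "bilinear_form {1..T} (\<lambda>r u. \<rho> (int u - int r))"
  let ?G = "\<lambda>s t. if s = t then gamma_diag \<rho> T k s else gamma_upper \<rho> T k s t"
  let ?K = "block_covariance \<rho>"
  have ordered: "?G s t = ?b (residual_weight T k s) (residual_weight T k t)"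
    if le: "s \<le> t" and st: "s \<in> {1..T}" "t \<in> {1..T}" for s t
  proof -
    have expand: "?b (\<lambda>r. of_bool (r \<in> A) - c * of_bool (r \<in> E)) (\<lambda>r. of_bool (r \<in> A') - c' * of_bool (r \<in> E')) =
        ?K A A' - c' * ?K A E' - c * ?K E A' + c * c' * ?K E E'"
      if "A \<subseteq> {1..T}" "E \<subseteq> {1..T}" "A' \<subseteq> {1..T}" "E' \<subseteq> {1..T}" for A E A' E' c c'
      unfolding bilinear_form_expand using that by (simp add: bilinear_form_blocks del: One_nat_def)
    have low: "residual_weight T k t =
        (\<lambda>r. of_bool (r \<in> {1..t}) - real t / real k * of_bool (r \<in> {1..k}))" if "t \<le> k" for t
      using that by (simp add: residual_weight_def fun_eq_iff)
    have high: "residual_weight T k t =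
        (\<lambda>r. of_bool (r \<in> {k+1..t}) - real (t - k) / real (T - k) * of_bool (r \<in> {k+1..T}))" if "k < t" for t
      using that by (simp add: residual_weight_def fun_eq_iff)
    have zero_left: "residual_weight T k k = (\<lambda>_. 0)"
      using k by (auto simp: residual_weight_def)
    have zero: "?b (\<lambda>_. 0) w = 0" "?b w (\<lambda>_. 0) = 0" for w by (simp_all add: bilinear_form_def)
    consider "s = k \<or> t = k" | "t < k" | "s < k" "k < t" | "k < s" using le by linarith
    then show ?thesis
    proof cases
      case 1
      then show ?thesis using zero zero_left
        by (auto simp: gamma_diag_def gamma_upper_def)
    next
      case 2
      have "?b (residual_weight T k s) (residual_weight T k t) =
          ?K {1..s} {1..t} - real t / real k * ?K {1..s} {1..k} - real s / real k * ?K {1..k} {1..t}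
          + real s / real k * (real t / real k) * ?K {1..k} {1..k}"
        unfolding low[OF less_imp_le[OF 2]] low[OF order_trans[OF le less_imp_le[OF 2]]]
        using k st 2 le by (intro expand) auto
      also have "?K {1..k} {1..t} = ?K {1..t} {1..k}" by (rule block_covariance_commute[where \<rho> = \<rho>, OF even])
      finally show ?thesis
        using 2 le by (auto simp: gamma_diag_def gamma_upper_def R_fun_block r_fun_block
            power2_eq_square algebra_simps)
    next
      case 3
      have "?b (residual_weight T k s) (residual_weight T k t) =
          ?K {1..s} {k+1..t} - real (t - k) / real (T - k) * ?K {1..s} {k+1..T}
          - real s / real k * ?K {1..k} {k+1..t}
          + real s / real k * (real (t - k) / real (T - k)) * ?K {1..k} {k+1..T}"
        unfolding low[OF less_imp_le[OF 3(1)]] high[OF 3(2)] using k st 3 by (intro expand) auto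
      then show ?thesis
        using 3 by (auto simp: gamma_upper_def S_fun_def R_fun_def block_covariance_def)
    next
      case 4
      have "?b (residual_weight T k s) (residual_weight T k t) =
          ?K {k+1..s} {k+1..t} - real (t - k) / real (T - k) * ?K {k+1..s} {k+1..T}
          - real (s - k) / real (T - k) * ?K {k+1..T} {k+1..t}
          + real (s - k) / real (T - k) * (real (t - k) / real (T - k)) * ?K {k+1..T} {k+1..T}"
        unfolding high[OF 4] high[OF less_le_trans[OF 4 le]] using k st 4 le by (intro expand) auto
      also have "?K {k+1..T} {k+1..t} = ?K {k+1..t} {k+1..T}" by (rule block_covariance_commute[where \<rho> = \<rho>, OF even])
      also have "?K {k+1..s} {k+1..t} = r_fun \<rho> (s - k) + R_fun \<rho> (s - k) (t - k)"
        using 4 le by (simp add: block_covariance_shift[where k = k, simplified] r_fun_add_R_fun)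
      also have "?K {k+1..s} {k+1..T} = r_fun \<rho> (s - k) + R_fun \<rho> (s - k) (T - k)"
        using 4 st by (simp add: block_covariance_shift[where k = k, simplified] r_fun_add_R_fun)
      also have "?K {k+1..t} {k+1..T} = r_fun \<rho> (t - k) + R_fun \<rho> (t - k) (T - k)"
        using 4 le st by (simp add: block_covariance_shift[where k = k, simplified] r_fun_add_R_fun)
      also have "?K {k+1..T} {k+1..T} = r_fun \<rho> (T - k)"
        using k by (simp add: block_covariance_shift[where k = k, simplified] r_fun_block)
      finally show ?thesis
        using 4 le by (auto simp: gamma_diag_def gamma_upper_def R_fun_def power2_eq_square algebra_simps)
    qed
  qed
  have sym: "?b a b = ?b b a" for a b
  proof (rule bilinear_form_commute)
    show "\<rho> (int t - int s) = \<rho> (int s - int t)" for s t using even[of "int t - int s"] by simp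
  qed
  show ?thesis
    using ordered[of s t] ordered[of t s] st sym by (cases "s \<le> t") (auto simp: gamma_matrix_def)
qed

text \<open>
  Centring each segment at its own mean removes the level and, when the split is at the true change
  point, the jump.
\<close>

lemma residual_sum_panel:
  assumes "1 \<le> k" "k \<le> T" "t \<le> T"
  shows "residual_sum T k (panel \<mu> \<delta> \<sigma> k e i) t = \<sigma> * residual_sum T k (e i) t"
proof -
  let ?Y = "panel \<mu> \<delta> \<sigma> k e i"
  have "(\<Sum>s=1..k. ?Y s) = (\<Sum>s=1..k. \<mu> i + \<sigma> * e i s)"
    by (intro sum.cong) (auto simp: panel_def)
  then have upto: "mean_upto ?Y k = \<mu> i + \<sigma> * mean_upto (e i) k"
    using assms by (simp add: mean_upto_def sum.distrib add_divide_distrib flip: sum_distrib_left)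
  have after: "mean_after T ?Y k = \<mu> i + \<delta> i + \<sigma> * mean_after T (e i) k" if "k < T"
  proof -
    have "(\<Sum>s=k+1..T. ?Y s) = (\<Sum>s=k+1..T. \<mu> i + \<delta> i + \<sigma> * e i s)"
      by (intro sum.cong) (auto simp: panel_def)
    also have "\<dots> = real (T - k) * (\<mu> i + \<delta> i) + \<sigma> * (\<Sum>s=k+1..T. e i s)"
      by (simp add: sum.distrib flip: sum_distrib_left)
    finally show ?thesis using that by (simp add: mean_after_def add_divide_distrib)
  qed
  show ?thesis
    unfolding residual_sum_def sum_distrib_left
  proof (intro sum.cong refl)
    fix r assume r: "r \<in> {1..t}"
    show "(if r \<le> k then ?Y r - mean_upto ?Y k else ?Y r - mean_after T ?Y k) =
        \<sigma> * (if r \<le> k then e i r - mean_upto (e i) k else e i r - mean_after T (e i) k)"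
    proof (cases "r \<le> k")
      case True
      then show ?thesis by (simp add: upto) (simp add: panel_def algebra_simps)
    next
      case False
      then have "k < T" using r assms by auto
      with False show ?thesis by (simp add: after) (simp add: panel_def algebra_simps)
    qed
  qed
qed

text \<open>
  Drawing residual rows amounts to drawing row indices, and by scale invariance the partial sums may
  be divided by any \<open>c > 0\<close>.
\<close>

lemma integral_bootstrap_law:
  fixes f :: "real \<Rightarrow> real"
  assumes N: "1 \<le> N" and c: "0 < c" and f: "f \<in> borel_measurable borel"
  shows "(\<integral>x. f x \<partial>bootstrap_law N T k Y) =
    (\<integral>h. f (limit_statistic T (resampled_sum N (\<lambda>j t. residual_sum T k (Y j) t / c) h))
      \<partial>measure_pmf (resampling N))"
proof -
  let ?e = "residual T k Y"
  \<comment> \<open>The index \<open>0\<close> is the default value of \<open>resampling\<close> and must be sent to the default row of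
    \<open>resampled_rows\<close>; it is never drawn.\<close>
  define e where "e = ?e(0 := \<lambda>_. 0)"
  have "resampled_rows N ?e = Pi_pmf {1..N} (\<lambda>_. 0) (\<lambda>_. map_pmf e (pmf_of_set {1..N}))"
    unfolding resampled_rows_def using N
    by (intro Pi_pmf_cong map_pmf_cong refl) (auto simp: e_def set_pmf_of_set)
  also have "\<dots> = map_pmf (\<lambda>h. e \<circ> h) (resampling N)"
    unfolding resampling_def by (rule Pi_pmf_map) (auto simp: e_def)
  finally have rows: "resampled_rows N ?e = map_pmf (\<lambda>h. e \<circ> h) (resampling N)" .
  have "(\<integral>x. f x \<partial>bootstrap_law N T k Y) =
      (\<integral>h. f (ratio_statistic N T (centred_rows N ?e (e \<circ> h))) \<partial>measure_pmf (resampling N))"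
    unfolding bootstrap_law_def rows using f by (simp add: integral_distr)
  also have "\<dots> = (\<integral>h. f (limit_statistic T (resampled_sum N (\<lambda>j t. residual_sum T k (Y j) t / c) h))
      \<partial>measure_pmf (resampling N))"
  proof (rule integral_cong_AE)
    show "AE h in measure_pmf (resampling N). f (ratio_statistic N T (centred_rows N ?e (e \<circ> h))) =
        f (limit_statistic T (resampled_sum N (\<lambda>j t. residual_sum T k (Y j) t / c) h))"
      using AE_resampling_in_range[OF N]
    proof eventually_elim
      case (elim h)
      have rs: "(\<Sum>r=1..t. ?e j r) = residual_sum T k (Y j) t" for j t
        by (simp add: residual_def residual_sum_def)
      have "c * sqrt (real N) * resampled_sum N (\<lambda>j t. residual_sum T k (Y j) t / c) h t =
          (\<Sum>i=1..N. \<Sum>r=1..t. centred_rows N ?e (e \<circ> h) i r)" for t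
      proof -
        have "(\<Sum>r=1..t. centred_rows N ?e (e \<circ> h) i r) =
            residual_sum T k (Y (h i)) t - average N (\<lambda>j. residual_sum T k (Y j) t)"
          if i: "i \<in> {1..N}" for i
        proof -
          have "e (h i) = ?e (h i)" using bspec[OF elim i] by (auto simp: e_def)
          then have "(\<Sum>r=1..t. centred_rows N ?e (e \<circ> h) i r) =
              (\<Sum>r=1..t. ?e (h i) r) - (\<Sum>j=1..N. \<Sum>r=1..t. ?e j r) / real N"
            by (simp add: centred_rows_def sum_subtractf flip: sum_divide_distrib)
              (subst sum.swap, simp)
          then show ?thesis by (simp only: rs average_real)
        qed
        then have "(\<Sum>i=1..N. \<Sum>r=1..t. centred_rows N ?e (e \<circ> h) i r) =
            (\<Sum>i=1..N. residual_sum T k (Y (h i)) t - average N (\<lambda>j. residual_sum T k (Y j) t))"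
          by (intro sum.cong) auto
        also have "\<dots> = c * sqrt (real N) * resampled_sum N (\<lambda>j t. residual_sum T k (Y j) t / c) h t"
        proof -
          have "average N (\<lambda>j. residual_sum T k (Y j) t / c) = average N (\<lambda>j. residual_sum T k (Y j) t) / c"
            using average_cmult[of N "1 / c" "\<lambda>j. residual_sum T k (Y j) t"] by simp
          then have "resampled_sum N (\<lambda>j t. residual_sum T k (Y j) t / c) h t =
              (\<Sum>i=1..N. residual_sum T k (Y (h i)) t - average N (\<lambda>j. residual_sum T k (Y j) t))
                / c / sqrt (real N)"
            unfolding resampled_sum_def by (simp only: diff_divide_distrib[symmetric] sum_divide_distrib[symmetric])
          then show ?thesis using N c by simp
        qed
        finally show ?thesis by simp
      qed
      then have "ratio_statistic N T (centred_rows N ?e (e \<circ> h)) =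
          limit_statistic T (\<lambda>t. c * sqrt (real N) * resampled_sum N (\<lambda>j t. residual_sum T k (Y j) t / c) h t)"
        by (simp add: ratio_statistic_eq_limit_statistic)
      also have "\<dots> = limit_statistic T (resampled_sum N (\<lambda>j t. residual_sum T k (Y j) t / c) h)"
        using N c by (intro limit_statistic_scale) simp
      finally show ?case by simp
    qed
  qed auto
  finally show ?thesis .
qed

section \<open>Events of vanishing probability\<close>

definition (in prob_space) vanishing :: "(nat \<Rightarrow> 'a set) \<Rightarrow> bool" where
  "vanishing A \<longleftrightarrow> (\<forall>N. A N \<in> events) \<and> (\<lambda>N. prob (A N)) \<longlonglongrightarrow> 0"

lemma (in prob_space) vanishing_UN:
  assumes "finite I" "\<And>i. i \<in> I \<Longrightarrow> vanishing (A i)"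
  shows "vanishing (\<lambda>N. \<Union>i\<in>I. A i N)"
  unfolding vanishing_def
proof (intro conjI allI)
  show "(\<Union>i\<in>I. A i N) \<in> events" for N
    using assms by (intro sets.finite_UN) (auto simp: vanishing_def)
  have "(\<lambda>N. \<Sum>i\<in>I. prob (A i N)) \<longlonglongrightarrow> (\<Sum>i\<in>I. 0)"
    using assms by (intro tendsto_sum) (auto simp: vanishing_def)
  then have sum: "(\<lambda>N. \<Sum>i\<in>I. prob (A i N)) \<longlonglongrightarrow> 0" by simp
  show "(\<lambda>N. prob (\<Union>i\<in>I. A i N)) \<longlonglongrightarrow> 0"
    by (rule Lim_null_comparison[OF _ sum])
      (use assms in \<open>auto intro!: always_eventually finite_measure_subadditive_finite simp: vanishing_def\<close>)
qed

lemma (in prob_space) vanishing_Un: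
  assumes "vanishing A" "vanishing B"
  shows "vanishing (\<lambda>N. A N \<union> B N)"
  using vanishing_UN[of UNIV "\<lambda>b. if b then A else B"] assms by (simp add: UNIV_bool Un_commute)

lemma (in prob_space) vanishing_Markov:
  fixes Z :: "nat \<Rightarrow> 'a \<Rightarrow> real"
  assumes int: "\<And>N. integrable M (Z N)" and nonneg: "\<And>N \<omega>. 0 \<le> Z N \<omega>"
    and lim: "(\<lambda>N. expectation (Z N)) \<longlonglongrightarrow> 0" and d: "0 < d"
  shows "vanishing (\<lambda>N. {\<omega>\<in>space M. d < Z N \<omega>})"
  unfolding vanishing_def
proof (intro conjI allI)
  have [measurable]: "Z N \<in> borel_measurable M" for N using int by auto
  show ev: "{\<omega>\<in>space M. d < Z N \<omega>} \<in> events" for N by measurable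
  have "prob {\<omega>\<in>space M. d < Z N \<omega>} \<le> expectation (Z N) / d" for N
  proof -
    have "prob {\<omega>\<in>space M. d < Z N \<omega>} \<le> prob {\<omega>\<in>space M. d \<le> Z N \<omega>}"
      by (rule finite_measure_mono) auto
    also have "\<dots> \<le> expectation (Z N) / d"
      by (rule integral_Markov_inequality_measure[OF int sets.empty_sets]) (use nonneg d in auto)
    finally show ?thesis .
  qed
  note bound = this
  have "(\<lambda>N. expectation (Z N) / d) \<longlonglongrightarrow> 0 / d"
    by (intro tendsto_divide lim tendsto_const) (use d in simp)
  then have lim': "(\<lambda>N. expectation (Z N) / d) \<longlonglongrightarrow> 0" by simp
  show "(\<lambda>N. prob {\<omega>\<in>space M. d < Z N \<omega>}) \<longlonglongrightarrow> 0"
    by (rule Lim_null_comparison[OF _ lim']) (use bound in auto)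
qed

text \<open>
  Markov's inequality for the square of the centred average, whose expectation is \<open>(c - m\<^sup>2) / N\<close>.
\<close>

lemma (in prob_space) weak_law_of_large_numbers:
  fixes W :: "nat \<Rightarrow> 'a \<Rightarrow> real"
  assumes indep: "indep_vars (\<lambda>_. borel) W {1::nat..}"
    and sq: "\<And>j. 1 \<le> j \<Longrightarrow> integrable M (\<lambda>\<omega>. (W j \<omega>)\<^sup>2)"
    and mean: "\<And>j. 1 \<le> j \<Longrightarrow> expectation (W j) = m"
    and second: "\<And>j. 1 \<le> j \<Longrightarrow> expectation (\<lambda>\<omega>. (W j \<omega>)\<^sup>2) = c"
    and d: "0 < d"
  shows "vanishing (\<lambda>N. {\<omega>\<in>space M. d < \<bar>average N (\<lambda>j. W j \<omega>) - m\<bar>})"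
proof -
  define V where "V j \<omega> = W j \<omega> - m" for j \<omega>
  have rv: "W j \<in> borel_measurable M" if "1 \<le> j" for j
    using indep that by (auto simp: indep_vars_def)
  have int: "integrable M (W j)" if "1 \<le> j" for j
    by (rule square_integrable_imp_integrable[OF rv[OF that] sq[OF that]])
  have V_indep: "indep_vars (\<lambda>_. borel) V {1..N}" for N
    unfolding V_def[abs_def] by (rule indep_vars_compose2[OF indep_vars_subset[OF indep]]) auto
  have V_eq: "(\<lambda>\<omega>. (V j \<omega>)\<^sup>2) = (\<lambda>\<omega>. (W j \<omega>)\<^sup>2 - 2 * m * W j \<omega> + m\<^sup>2)" for j
    by (simp add: V_def power2_diff algebra_simps)
  have V_sq: "integrable M (\<lambda>\<omega>. (V j \<omega>)\<^sup>2)" and V_second: "expectation (\<lambda>\<omega>. (V j \<omega>)\<^sup>2) = c - m\<^sup>2"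
    and V_mean: "expectation (V j) = 0" if "1 \<le> j" for j
  proof -
    show "integrable M (\<lambda>\<omega>. (V j \<omega>)\<^sup>2)" unfolding V_eq using sq[OF that] int[OF that] by simp
    show "expectation (\<lambda>\<omega>. (V j \<omega>)\<^sup>2) = c - m\<^sup>2"
      unfolding V_eq using sq[OF that] int[OF that] mean[OF that] second[OF that]
      by (simp add: prob_space power2_eq_square)
    show "expectation (V j) = 0" unfolding V_def[abs_def] using int[OF that] mean[OF that] by (simp add: prob_space)
  qed
  let ?Z = "\<lambda>N \<omega>. ((\<Sum>j=1..N. V j \<omega>) / real N)\<^sup>2"
  have Z_int: "integrable M (?Z N)" for N
    unfolding power_divide
    by (intro integrable_divide expectation_square_sum_indep(1) V_indep V_sq V_mean) auto
  have Z_exp: "expectation (?Z N) = (c - m\<^sup>2) / real N" for N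
  proof -
    have "expectation (\<lambda>\<omega>. (\<Sum>j=1..N. V j \<omega>)\<^sup>2) = (\<Sum>j=1..N. expectation (\<lambda>\<omega>. (V j \<omega>)\<^sup>2))"
      by (intro expectation_square_sum_indep(2) V_indep V_sq V_mean) auto
    also have "\<dots> = (\<Sum>j=1..N. c - m\<^sup>2)" by (intro sum.cong refl V_second) simp
    finally show ?thesis by (simp add: power_divide) (simp add: power2_eq_square)
  qed
  have van: "vanishing (\<lambda>N. {\<omega>\<in>space M. d\<^sup>2 < ?Z N \<omega>})"
  proof (rule vanishing_Markov[OF Z_int])
    show "(\<lambda>N. expectation (?Z N)) \<longlonglongrightarrow> 0"
      unfolding Z_exp by (rule lim_const_over_n)
    show "0 < d\<^sup>2" using d by simp
  qed simp
  have eq: "{\<omega>\<in>space M. d\<^sup>2 < ?Z N \<omega>} = {\<omega>\<in>space M. d < \<bar>average N (\<lambda>j. W j \<omega>) - m\<bar>}" if "1 \<le> N" for N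
  proof -
    have "(\<Sum>j=1..N. V j \<omega>) / real N = average N (\<lambda>j. W j \<omega>) - m" for \<omega>
      using that by (simp add: V_def average_real sum_subtractf diff_divide_distrib)
    moreover have "d\<^sup>2 < x\<^sup>2 \<longleftrightarrow> d < \<bar>x\<bar>" for x
      using d abs_le_square_iff[of x d] by (simp add: not_le[symmetric])
    ultimately show ?thesis by simp
  qed
  show ?thesis unfolding vanishing_def
  proof (intro conjI allI)
    show "{\<omega>\<in>space M. d < \<bar>average N (\<lambda>j. W j \<omega>) - m\<bar>} \<in> events" for N
    proof -
      have [measurable]: "(\<lambda>\<omega>. average N (\<lambda>j. W j \<omega>)) \<in> borel_measurable M"
        unfolding average_real
        by (intro borel_measurable_divide borel_measurable_sum borel_measurable_const rv) auto
      show ?thesis by measurable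
    qed
    have ev: "eventually (\<lambda>N. prob {\<omega>\<in>space M. d\<^sup>2 < ?Z N \<omega>} =
        prob {\<omega>\<in>space M. d < \<bar>average N (\<lambda>j. W j \<omega>) - m\<bar>}) sequentially"
      using eventually_ge_at_top[of 1] by eventually_elim (simp only: eq)
    show "(\<lambda>N. prob {\<omega>\<in>space M. d < \<bar>average N (\<lambda>j. W j \<omega>) - m\<bar>}) \<longlonglongrightarrow> 0"
      using conjunct2[OF van[unfolded vanishing_def]] ev by (rule Lim_transform_eventually)
  qed
qed

section \<open>Empirical moments of the error rows\<close>

locale panel_errors = prob_space M for M :: "'w measure" +
  fixes T :: nat and \<epsilon> :: "nat \<Rightarrow> nat \<Rightarrow> 'w \<Rightarrow> real" and \<rho> :: "int \<Rightarrow> real"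
  assumes indep_rows: "indep_vars (\<lambda>_. Pi\<^sub>M {1..T} (\<lambda>_. borel)) (\<lambda>i \<omega>. \<lambda>t\<in>{1..T}. \<epsilon> i t \<omega>) {1..}"
    and same_law: "\<And>i. 1 \<le> i \<Longrightarrow>
         distr M (Pi\<^sub>M {1..T} (\<lambda>_. borel)) (\<lambda>\<omega>. \<lambda>t\<in>{1..T}. \<epsilon> i t \<omega>) =
         distr M (Pi\<^sub>M {1..T} (\<lambda>_. borel)) (\<lambda>\<omega>. \<lambda>t\<in>{1..T}. \<epsilon> 1 t \<omega>)"
    and mean_zero: "\<And>i t. \<lbrakk>1 \<le> i; t \<in> {1..T}\<rbrakk> \<Longrightarrow> integrable M (\<epsilon> i t) \<and> expectation (\<epsilon> i t) = 0"
    and unit_variance: "\<And>i t. \<lbrakk>1 \<le> i; t \<in> {1..T}\<rbrakk> \<Longrightarrow> variance (\<epsilon> i t) = 1"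
    and autocorrelation: "\<And>i t s. \<lbrakk>1 \<le> i; t < T; s \<in> {1..T - t}\<rbrakk> \<Longrightarrow>
      correlation M (\<epsilon> i s) (\<epsilon> i (s + t)) = \<rho> (int t)"
    and even: "\<And>t. \<rho> (- t) = \<rho> t"
    and fourth_moment: "\<And>t. t \<in> {1..T} \<Longrightarrow> integrable M (\<lambda>\<omega>. \<epsilon> 1 t \<omega> ^ 4)"
begin

abbreviation row :: "'w \<Rightarrow> nat \<Rightarrow> nat \<Rightarrow> real" where
  "row \<omega> i \<equiv> \<lambda>t\<in>{1..T}. \<epsilon> i t \<omega>"

abbreviation row_space :: "(nat \<Rightarrow> real) measure" where
  "row_space \<equiv> Pi\<^sub>M {1..T} (\<lambda>_. borel)"

text \<open>
  By \<open>residual_sum_weights\<close>, the partial sums of residuals are of this form.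
\<close>

definition weighted_error :: "(nat \<Rightarrow> real) \<Rightarrow> nat \<Rightarrow> 'w \<Rightarrow> real" where
  "weighted_error w j \<omega> = (\<Sum>r\<in>{1..T}. w r * \<epsilon> j r \<omega>)"

lemma row_measurable: "1 \<le> i \<Longrightarrow> (\<lambda>\<omega>. row \<omega> i) \<in> M \<rightarrow>\<^sub>M row_space"
  using indep_rows by (auto simp: indep_vars_def)

lemma error_measurable:
  assumes "1 \<le> i" "t \<in> {1..T}"
  shows "\<epsilon> i t \<in> borel_measurable M"
  using measurable_compose[OF row_measurable[OF assms(1)] measurable_component_singleton[OF assms(2)]] assms
  by simp

lemma row_function_law:
  fixes \<phi> :: "(nat \<Rightarrow> real) \<Rightarrow> real"
  assumes \<phi>: "\<phi> \<in> borel_measurable row_space" and i: "1 \<le> i"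
  shows "expectation (\<lambda>\<omega>. \<phi> (row \<omega> i)) = expectation (\<lambda>\<omega>. \<phi> (row \<omega> 1))"
    and "integrable M (\<lambda>\<omega>. \<phi> (row \<omega> i)) \<longleftrightarrow> integrable M (\<lambda>\<omega>. \<phi> (row \<omega> 1))"
proof -
  show "expectation (\<lambda>\<omega>. \<phi> (row \<omega> i)) = expectation (\<lambda>\<omega>. \<phi> (row \<omega> 1))"
    using integral_distr[OF row_measurable[OF i] \<phi>] integral_distr[OF row_measurable[of 1] \<phi>] same_law[OF i]
    by simp
  show "integrable M (\<lambda>\<omega>. \<phi> (row \<omega> i)) \<longleftrightarrow> integrable M (\<lambda>\<omega>. \<phi> (row \<omega> 1))"
    using integrable_distr_eq[OF row_measurable[OF i] \<phi>] integrable_distr_eq[OF row_measurable[of 1] \<phi>] same_law[OF i]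
    by simp
qed

lemma average_row_function:
  fixes \<phi> :: "(nat \<Rightarrow> real) \<Rightarrow> real"
  assumes \<phi>: "\<phi> \<in> borel_measurable row_space" and sq: "integrable M (\<lambda>\<omega>. (\<phi> (row \<omega> 1))\<^sup>2)" and d: "0 < d"
  shows "vanishing (\<lambda>N. {\<omega>\<in>space M.
    d < \<bar>average N (\<lambda>j. \<phi> (row \<omega> j)) - expectation (\<lambda>\<omega>. \<phi> (row \<omega> 1))\<bar>})"
proof (rule weak_law_of_large_numbers[OF _ _ _ _ d])
  have \<phi>2: "(\<lambda>y. (\<phi> y)\<^sup>2) \<in> borel_measurable row_space" by (rule borel_measurable_power[OF \<phi>])
  show "indep_vars (\<lambda>_. borel) (\<lambda>j \<omega>. \<phi> (row \<omega> j)) {1..}"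
    by (rule indep_vars_compose2[OF indep_rows \<phi>])
  fix j :: nat assume j: "1 \<le> j"
  show "integrable M (\<lambda>\<omega>. (\<phi> (row \<omega> j))\<^sup>2)"
    using row_function_law(2)[OF \<phi>2 j] sq by (simp only:)
  show "expectation (\<lambda>\<omega>. \<phi> (row \<omega> j)) = expectation (\<lambda>\<omega>. \<phi> (row \<omega> 1))"
    by (rule row_function_law(1)[OF \<phi> j])
  show "expectation (\<lambda>\<omega>. (\<phi> (row \<omega> j))\<^sup>2) = expectation (\<lambda>\<omega>. (\<phi> (row \<omega> 1))\<^sup>2)"
    by (rule row_function_law(1)[OF \<phi>2 j])
qed

text \<open>
  Only a first moment of \<open>\<phi>\<close> is available when \<open>\<phi>\<close> is a fourth power, but the expectation of its average
  is constant and the division by \<open>sqrt N\<close> makes it small.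
\<close>

lemma average_row_function_over_sqrt:
  fixes \<phi> :: "(nat \<Rightarrow> real) \<Rightarrow> real"
  assumes \<phi>: "\<phi> \<in> borel_measurable row_space" and nonneg: "\<And>y. 0 \<le> \<phi> y"
    and int: "integrable M (\<lambda>\<omega>. \<phi> (row \<omega> 1))" and d: "0 < d"
  shows "vanishing (\<lambda>N. {\<omega>\<in>space M. d < average N (\<lambda>j. \<phi> (row \<omega> j)) / sqrt (real N)})"
proof (rule vanishing_Markov[OF _ _ _ d])
  have intj: "integrable M (\<lambda>\<omega>. \<phi> (row \<omega> j))" if "1 \<le> j" for j
    using row_function_law(2)[OF \<phi> that] int by simp
  then show "integrable M (\<lambda>\<omega>. average N (\<lambda>j. \<phi> (row \<omega> j)) / sqrt (real N))" for N
    unfolding average_real by (intro integrable_divide Bochner_Integration.integrable_sum) auto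
  show "0 \<le> average N (\<lambda>j. \<phi> (row \<omega> j)) / sqrt (real N)" for N \<omega>
    by (intro divide_nonneg_nonneg average_nonneg nonneg) auto
  define c where "c = expectation (\<lambda>\<omega>. \<phi> (row \<omega> 1))"
  have "expectation (\<lambda>\<omega>. average N (\<lambda>j. \<phi> (row \<omega> j)) / sqrt (real N)) = c / sqrt (real N)" for N
  proof -
    have "expectation (\<lambda>\<omega>. \<Sum>j=1..N. \<phi> (row \<omega> j)) = (\<Sum>j=1..N. expectation (\<lambda>\<omega>. \<phi> (row \<omega> j)))"
      using intj by (intro Bochner_Integration.integral_sum) auto
    also have "\<dots> = (\<Sum>j=1..N. c)"
      unfolding c_def by (intro sum.cong refl row_function_law(1)[OF \<phi>]) auto
    finally show ?thesis unfolding average_real by (simp add: integral_divide_zero)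
  qed
  moreover have "(\<lambda>N. c / sqrt (real N)) \<longlonglongrightarrow> 0" by real_asymp
  ultimately show "(\<lambda>N. expectation (\<lambda>\<omega>. average N (\<lambda>j. \<phi> (row \<omega> j)) / sqrt (real N))) \<longlonglongrightarrow> 0"
    by (simp only:)
qed

lemma weighted_error_row: "weighted_error w j \<omega> = (\<Sum>r\<in>{1..T}. w r * row \<omega> j r)"
  unfolding weighted_error_def by (intro sum.cong) auto

lemma weighted_sum_measurable: "(\<lambda>y. \<Sum>r\<in>{1..T}. w r * y r) \<in> borel_measurable row_space" for w :: "nat \<Rightarrow> real"
  by (intro borel_measurable_sum borel_measurable_times borel_measurable_const measurable_component_singleton)

lemma weighted_error_measurable: "1 \<le> j \<Longrightarrow> weighted_error w j \<in> borel_measurable M"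
  unfolding weighted_error_def[abs_def]
  by (intro borel_measurable_sum borel_measurable_times borel_measurable_const error_measurable) auto

lemma error_square_integrable:
  assumes "1 \<le> i" "t \<in> {1..T}"
  shows "integrable M (\<lambda>\<omega>. (\<epsilon> i t \<omega>)\<^sup>2)"
  using unit_variance[OF assms] mean_zero[OF assms] not_integrable_integral_eq by fastforce

lemma error_product_integrable:
  assumes "1 \<le> i" "s \<in> {1..T}" "t \<in> {1..T}"
  shows "integrable M (\<lambda>\<omega>. \<epsilon> i s \<omega> * \<epsilon> i t \<omega>)"
proof (rule Bochner_Integration.integrable_bound)
  show "integrable M (\<lambda>\<omega>. (\<epsilon> i s \<omega>)\<^sup>2 + (\<epsilon> i t \<omega>)\<^sup>2)"
    using assms by (intro Bochner_Integration.integrable_add error_square_integrable)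
  show "(\<lambda>\<omega>. \<epsilon> i s \<omega> * \<epsilon> i t \<omega>) \<in> borel_measurable M"
    by (rule borel_measurable_times[OF error_measurable error_measurable]) (fact assms)+
  have "\<bar>a * b\<bar> \<le> a\<^sup>2 + b\<^sup>2" for a b :: real
  proof -
    have "2 * (\<bar>a\<bar> * \<bar>b\<bar>) \<le> a\<^sup>2 + b\<^sup>2" using sum_squares_bound[of "\<bar>a\<bar>" "\<bar>b\<bar>"] by (simp add: mult.assoc)
    moreover have "0 \<le> \<bar>a\<bar> * \<bar>b\<bar>" by simp
    ultimately show ?thesis unfolding abs_mult by linarith
  qed
  then show "AE \<omega> in M. norm (\<epsilon> i s \<omega> * \<epsilon> i t \<omega>) \<le> norm ((\<epsilon> i s \<omega>)\<^sup>2 + (\<epsilon> i t \<omega>)\<^sup>2)" by simp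
qed

lemma expectation_error_product:
  assumes i: "1 \<le> i" and st: "s \<in> {1..T}" "t \<in> {1..T}"
  shows "expectation (\<lambda>\<omega>. \<epsilon> i s \<omega> * \<epsilon> i t \<omega>) = \<rho> (int t - int s)"
proof -
  have self: "covariance M (\<epsilon> i s) (\<epsilon> i s) = 1" if "s \<in> {1..T}" for s
    using unit_variance[OF i that] by (simp add: covariance_def power2_eq_square)
  have ordered: "expectation (\<lambda>\<omega>. \<epsilon> i s \<omega> * \<epsilon> i t \<omega>) = \<rho> (int t - int s)"
    if st: "s \<in> {1..T}" "t \<in> {1..T}" and le: "s \<le> t" for s t
  proof -
    have "correlation M (\<epsilon> i s) (\<epsilon> i (s + (t - s))) = \<rho> (int (t - s))"
      using st le by (intro autocorrelation i) auto
    then have "covariance M (\<epsilon> i s) (\<epsilon> i t) = \<rho> (int t - int s)"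
      using self[OF st(1)] self[OF st(2)] le by (simp add: correlation_def of_nat_diff)
    then show ?thesis using mean_zero[OF i st(1)] mean_zero[OF i st(2)] by (simp add: covariance_def)
  qed
  show ?thesis
    using ordered[OF st] ordered[OF st(2,1)] even[of "int t - int s"]
    by (cases "s \<le> t") (auto simp: mult.commute)
qed

lemma expectation_weighted_error:
  assumes "1 \<le> i"
  shows "expectation (weighted_error w i) = 0"
proof -
  have "expectation (weighted_error w i) = (\<Sum>r\<in>{1..T}. w r * expectation (\<epsilon> i r))"
    unfolding weighted_error_def[abs_def] using mean_zero[OF assms]
    by (subst Bochner_Integration.integral_sum) auto
  then show ?thesis using mean_zero[OF assms] by simp
qed

lemma weighted_error_product:
  assumes "1 \<le> i"
  shows "integrable M (\<lambda>\<omega>. weighted_error v i \<omega> * weighted_error w i \<omega>)"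
    and "expectation (\<lambda>\<omega>. weighted_error v i \<omega> * weighted_error w i \<omega>) =
      bilinear_form {1..T} (\<lambda>s t. \<rho> (int t - int s)) v w"
proof -
  have eq: "(\<lambda>\<omega>. weighted_error v i \<omega> * weighted_error w i \<omega>) =
      (\<lambda>\<omega>. \<Sum>s\<in>{1..T}. \<Sum>t\<in>{1..T}. v s * w t * (\<epsilon> i s \<omega> * \<epsilon> i t \<omega>))"
    by (simp add: weighted_error_def sum_product ac_simps)
  have int: "integrable M (\<lambda>\<omega>. v s * w t * (\<epsilon> i s \<omega> * \<epsilon> i t \<omega>))" if "s \<in> {1..T}" "t \<in> {1..T}" for s t
    using error_product_integrable[OF assms that] by (rule integrable_mult_right)
  show "integrable M (\<lambda>\<omega>. weighted_error v i \<omega> * weighted_error w i \<omega>)"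
    unfolding eq by (intro Bochner_Integration.integrable_sum int)
  have "expectation (\<lambda>\<omega>. \<Sum>s\<in>{1..T}. \<Sum>t\<in>{1..T}. v s * w t * (\<epsilon> i s \<omega> * \<epsilon> i t \<omega>)) =
      (\<Sum>s\<in>{1..T}. expectation (\<lambda>\<omega>. \<Sum>t\<in>{1..T}. v s * w t * (\<epsilon> i s \<omega> * \<epsilon> i t \<omega>)))"
    by (intro Bochner_Integration.integral_sum Bochner_Integration.integrable_sum int)
  also have "\<dots> = (\<Sum>s\<in>{1..T}. \<Sum>t\<in>{1..T}. expectation (\<lambda>\<omega>. v s * w t * (\<epsilon> i s \<omega> * \<epsilon> i t \<omega>)))"
    by (intro sum.cong refl Bochner_Integration.integral_sum int)
  also have "\<dots> = (\<Sum>s\<in>{1..T}. \<Sum>t\<in>{1..T}. v s * w t * \<rho> (int t - int s))"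
    by (intro sum.cong refl) (simp only: integral_mult_right_zero expectation_error_product[OF assms])
  finally show "expectation (\<lambda>\<omega>. weighted_error v i \<omega> * weighted_error w i \<omega>) =
      bilinear_form {1..T} (\<lambda>s t. \<rho> (int t - int s)) v w"
    unfolding eq bilinear_form_def .
qed

lemma weighted_error_power4_integrable: "integrable M (\<lambda>\<omega>. weighted_error w 1 \<omega> ^ 4)"
proof (rule Bochner_Integration.integrable_bound)
  show "integrable M (\<lambda>\<omega>. real (card {1..T}) ^ 3 * (\<Sum>r\<in>{1..T}. w r ^ 4 * \<epsilon> 1 r \<omega> ^ 4))"
    by (intro integrable_mult_right Bochner_Integration.integrable_sum fourth_moment)
  show "(\<lambda>\<omega>. weighted_error w 1 \<omega> ^ 4) \<in> borel_measurable M"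
    by (intro borel_measurable_power weighted_error_measurable) simp
  have "weighted_error w 1 \<omega> ^ 4 \<le> real (card {1..T}) ^ 3 * (\<Sum>r\<in>{1..T}. w r ^ 4 * \<epsilon> 1 r \<omega> ^ 4)" for \<omega>
    using power4_sum_le[of "\<lambda>r. w r * \<epsilon> 1 r \<omega>" "{1..T}"]
    unfolding weighted_error_def power_mult_distrib .
  then show "AE \<omega> in M. norm (weighted_error w 1 \<omega> ^ 4) \<le>
      norm (real (card {1..T}) ^ 3 * (\<Sum>r\<in>{1..T}. w r ^ 4 * \<epsilon> 1 r \<omega> ^ 4))"
    by (auto intro!: always_eventually order_trans[OF _ abs_ge_self])
qed

lemma weighted_error_product_square_integrable:
  "integrable M (\<lambda>\<omega>. (weighted_error v 1 \<omega> * weighted_error w 1 \<omega>)\<^sup>2)"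
proof (rule Bochner_Integration.integrable_bound)
  show "integrable M (\<lambda>\<omega>. weighted_error v 1 \<omega> ^ 4 + weighted_error w 1 \<omega> ^ 4)"
    by (intro Bochner_Integration.integrable_add weighted_error_power4_integrable)
  show "(\<lambda>\<omega>. (weighted_error v 1 \<omega> * weighted_error w 1 \<omega>)\<^sup>2) \<in> borel_measurable M"
    by (intro borel_measurable_power borel_measurable_times weighted_error_measurable) simp_all
  have "(a * b)\<^sup>2 \<le> a ^ 4 + b ^ 4" for a b :: real
  proof -
    have "2 * a\<^sup>2 * b\<^sup>2 \<le> (a\<^sup>2)\<^sup>2 + (b\<^sup>2)\<^sup>2" by (rule sum_squares_bound)
    moreover have "0 \<le> a\<^sup>2 * b\<^sup>2" by simp
    ultimately have "a\<^sup>2 * b\<^sup>2 \<le> (a\<^sup>2)\<^sup>2 + (b\<^sup>2)\<^sup>2" by linarith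
    then show ?thesis by (simp add: power_mult_distrib flip: power_mult)
  qed
  then show "AE \<omega> in M. norm ((weighted_error v 1 \<omega> * weighted_error w 1 \<omega>)\<^sup>2) \<le>
      norm (weighted_error v 1 \<omega> ^ 4 + weighted_error w 1 \<omega> ^ 4)"
    by (auto intro!: always_eventually order_trans[OF _ abs_ge_self])
qed

text \<open>
  Means and second moments obey the weak law because the products of two weighted errors are square
  integrable by the fourth moment assumption; the fourth moments are compared with \<open>sqrt N\<close> by Markov's
  inequality.
\<close>

lemma moments_close_with_high_probability:
  assumes d: "0 < d"
  shows "vanishing (\<lambda>N. {\<omega>\<in>space M. \<not> moments_close T
    (\<lambda>s t. bilinear_form {1..T} (\<lambda>r u. \<rho> (int u - int r)) (w s) (w t)) d N (\<lambda>j t. weighted_error (w t) j \<omega>)})"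
proof -
  let ?G = "\<lambda>s t. bilinear_form {1..T} (\<lambda>r u. \<rho> (int u - int r)) (w s) (w t)"
  let ?c = "\<lambda>w y. \<Sum>r\<in>{1..T}. w r * (y r :: real)"
  let ?A = "\<lambda>s N. {\<omega>\<in>space M. d < \<bar>average N (\<lambda>j. weighted_error (w s) j \<omega>)\<bar>}"
  let ?B = "\<lambda>s N. {\<omega>\<in>space M. d < average N (\<lambda>j. weighted_error (w s) j \<omega> ^ 4) / sqrt (real N)}"
  let ?C = "\<lambda>s t N. {\<omega>\<in>space M.
    d < \<bar>average N (\<lambda>j. weighted_error (w s) j \<omega> * weighted_error (w t) j \<omega>) - ?G s t\<bar>}"
  have m1: "?c v \<in> borel_measurable row_space" for v by (rule weighted_sum_measurable)
  have m2: "(\<lambda>y. ?c v y * ?c v' y) \<in> borel_measurable row_space" for v v'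
    by (intro borel_measurable_times m1)
  have m4: "(\<lambda>y. ?c v y ^ 4) \<in> borel_measurable row_space" for v
    by (intro borel_measurable_power m1)
  have A: "vanishing (?A s)" for s
    using average_row_function[OF m1, of "w s" d] d weighted_error_product(1)[of 1 "w s" "w s"]
      expectation_weighted_error[of 1 "w s"]
    unfolding weighted_error_row[symmetric] by (simp add: power2_eq_square)
  have B: "vanishing (?B s)" for s
    using average_row_function_over_sqrt[OF m4, of "w s" d] d weighted_error_power4_integrable[of "w s"]
    unfolding weighted_error_row[symmetric] by simp
  have C: "vanishing (?C s t)" for s t
    using average_row_function[OF m2, of "w s" "w t" d] d weighted_error_product_square_integrable[of "w s" "w t"]
      weighted_error_product(2)[of 1 "w s" "w t"]
    unfolding weighted_error_row[symmetric] by simp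
  have "vanishing (\<lambda>N. \<Union>s\<in>{1..T}. ?A s N \<union> (?B s N \<union> (\<Union>t\<in>{1..T}. ?C s t N)))"
    by (intro vanishing_UN vanishing_Un A B C) simp_all
  moreover have "(\<Union>s\<in>{1..T}. ?A s N \<union> (?B s N \<union> (\<Union>t\<in>{1..T}. ?C s t N))) =
      {\<omega>\<in>space M. \<not> moments_close T ?G d N (\<lambda>j t. weighted_error (w t) j \<omega>)}" for N
    unfolding moments_close_def by (auto simp: not_le)
  ultimately show ?thesis by (simp only:)
qed

lemma degenerate_weighted_error:
  assumes "bilinear_form {1..T} (\<lambda>r u. \<rho> (int u - int r)) w w = 0"
  shows "AE \<omega> in M. \<forall>j\<in>{1..}. weighted_error w j \<omega> = 0"
proof -
  have "AE \<omega> in M. weighted_error w j \<omega> = 0" if "1 \<le> j" for j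
  proof -
    have "AE \<omega> in M. weighted_error w j \<omega> * weighted_error w j \<omega> = 0"
      using weighted_error_product[OF that, of w w] assms
      by (subst integral_nonneg_eq_0_iff_AE[symmetric]) auto
    then show ?thesis by simp
  qed
  then show ?thesis by (subst AE_ball_countable) auto
qed

end

section \<open>The bootstrap law along the panel\<close>

lemma (in panel_errors) estimated_change_point_measurable:
  assumes est: "est \<in> Pi\<^sub>M ({1..N} \<times> {1..T}) (\<lambda>_. borel) \<rightarrow>\<^sub>M count_space {1..T}"
  shows "(\<lambda>\<omega>. est (\<lambda>(i, t)\<in>{1..N} \<times> {1..T}. panel \<mu> \<delta> \<sigma> k (\<lambda>i t. \<epsilon> i t \<omega>) i t))
    \<in> M \<rightarrow>\<^sub>M count_space {1..T}"
proof (rule measurable_compose[OF _ est])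
  show "(\<lambda>\<omega>. \<lambda>(i, t)\<in>{1..N} \<times> {1..T}. panel \<mu> \<delta> \<sigma> k (\<lambda>i t. \<epsilon> i t \<omega>) i t)
      \<in> M \<rightarrow>\<^sub>M Pi\<^sub>M ({1..N} \<times> {1..T}) (\<lambda>_. borel)"
  proof (rule measurable_restrict)
    fix p assume "p \<in> {1..N} \<times> {1..T}"
    then obtain i t where p: "p = (i, t)" "1 \<le> i" "t \<in> {1..T}" by auto
    show "(\<lambda>\<omega>. case p of (i, t) \<Rightarrow> panel \<mu> \<delta> \<sigma> k (\<lambda>i t. \<epsilon> i t \<omega>) i t) \<in> borel_measurable M"
      unfolding p(1) panel_def using error_measurable[OF p(2,3)] by simp
  qed
qed

text \<open>
  For a fixed split \<open>k\<close> the integral is a finite sum over all resampling index vectors; the estimated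
  split takes finitely many values.
\<close>

lemma (in panel_errors) bootstrap_integral_measurable:
  fixes f :: "real \<Rightarrow> real"
  assumes T: "4 \<le> T" and N: "1 \<le> N" and f: "f \<in> borel_measurable borel"
    and \<kappa>: "\<kappa> \<in> M \<rightarrow>\<^sub>M count_space {1..T}"
  shows "(\<lambda>\<omega>. \<integral>x. f x \<partial>bootstrap_law N T (\<kappa> \<omega>) (panel \<mu> \<delta> \<sigma> \<tau> (\<lambda>i t. \<epsilon> i t \<omega>))) \<in> borel_measurable M"
proof (rule measurable_compose_countable'[OF _ \<kappa>])
  let ?Y = "\<lambda>\<omega>. panel \<mu> \<delta> \<sigma> \<tau> (\<lambda>i t. \<epsilon> i t \<omega>)"
  fix k assume k: "k \<in> {1..T}"
  define q where "q \<omega> j t = residual_sum T k (?Y \<omega> j) t / 1" for \<omega> j t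
  have res: "(\<lambda>\<omega>. q \<omega> j t) \<in> borel_measurable M" if j: "1 \<le> j" and t: "t \<in> {1..T}" for j t
  proof -
    have eq: "q \<omega> j t = (\<Sum>r\<in>{1..T}. residual_weight T k t r * ?Y \<omega> j r)" for \<omega>
      unfolding q_def using k t by (subst residual_sum_weights) auto
    have Y: "(\<lambda>\<omega>. ?Y \<omega> j r) \<in> borel_measurable M" if "r \<in> {1..T}" for r
      unfolding panel_def using error_measurable[OF j that] by simp
    show ?thesis
      unfolding eq by (rule borel_measurable_sum, rule borel_measurable_times[OF borel_measurable_const Y])
  qed
  have eq: "(\<integral>x. f x \<partial>bootstrap_law N T k (?Y \<omega>)) =
      (\<Sum>h\<in>set_pmf (resampling N). pmf (resampling N) h *
        f (limit_statistic T (resampled_sum N (q \<omega>) h)))" for \<omega>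
    unfolding integral_bootstrap_law[OF N zero_less_one f] q_def real_scaleR_def[symmetric]
    by (rule integral_measure_pmf[OF finite_set_resampling[OF N]])
  have "(\<lambda>\<omega>. f (limit_statistic T (resampled_sum N (q \<omega>) h))) \<in> borel_measurable M"
    if h: "h \<in> set_pmf (resampling N)" for h
  proof (rule measurable_compose[OF borel_measurable_limit_statistic[OF T] f])
    fix t assume t: "t \<in> {1..T}"
    have "h i \<in> {1..N}" if "i \<in> {1..N}" for i
      using AE_resampling_in_range[OF N] h that by (simp add: AE_measure_pmf_iff)
    then have row: "(\<lambda>\<omega>. q \<omega> (h i) t) \<in> borel_measurable M" if "i \<in> {1..N}" for i
      using res[OF _ t] that by force
    have mean: "(\<lambda>\<omega>. average N (\<lambda>j. q \<omega> j t)) \<in> borel_measurable M"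
      unfolding average_real
      by (rule borel_measurable_divide[OF borel_measurable_sum borel_measurable_const]) (rule res[OF _ t], simp)
    show "(\<lambda>\<omega>. resampled_sum N (q \<omega>) h t) \<in> borel_measurable M"
      unfolding resampled_sum_def
      by (rule borel_measurable_divide[OF borel_measurable_sum borel_measurable_const])
        (rule borel_measurable_diff[OF row mean])
  qed
  then show "(\<lambda>\<omega>. \<integral>x. f x \<partial>bootstrap_law N T k (?Y \<omega>)) \<in> borel_measurable M"
    unfolding eq by (intro borel_measurable_sum borel_measurable_times[OF borel_measurable_const])
qed simp

text \<open>
  The Gaussian vector and the weighted errors have the same covariance matrix, so a linear form of
  variance zero vanishes almost surely on both sides. This makes the quotients with zero denominator
  agree exactly, not only in the limit.
\<close>

lemma (in panel_errors) degenerate_denominators_vanish: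
  assumes T: "4 \<le> T" and k: "k \<in> {1..T}" and Q: "prob_space Q"
    and gaussian: "multivariate_normal Q {1..T} X (\<lambda>_. 0) (gamma_matrix \<rho> T k)"
  shows "AE \<omega> in M. \<forall>t\<in>{2..T-2}. (AE \<xi> in Q. denominator T t (\<lambda>i. X i \<xi>) = 0) \<longrightarrow>
    (\<forall>j\<in>{1..}. denominator T t (\<lambda>i. weighted_error (residual_weight T k i) j \<omega>) = 0)"
proof -
  interpret Q: prob_space Q by (rule Q)
  let ?b = "bilinear_form {1..T} (\<lambda>r u. \<rho> (int u - int r))"
  let ?w = "residual_weight T k"
  have bridge: "AE \<omega> in M. \<forall>j\<in>{1..}. reverse_bridge T t s (\<lambda>i. weighted_error (?w i) j \<omega>) = 0"
    if t: "t \<in> {2..T-2}" and s: "s \<in> {t..T-1}"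
      and zero: "AE \<xi> in Q. denominator T t (\<lambda>i. X i \<xi>) = 0" for s t
  proof -
    have tT: "t < T" using t by auto
    have "t \<in> {1..T}" "s \<in> {1..T}" using t s by auto
    then obtain a where a: "\<And>x. reverse_bridge T t s x = (\<Sum>i\<in>{1..T}. a i * x i)"
      using reverse_bridge_combination[of t T s] by blast
    have "AE \<xi> in Q. (\<Sum>i\<in>{1..T}. a i * X i \<xi>) = 0"
      using zero
    proof eventually_elim
      case (elim \<xi>)
      then have "reverse_bridge T t s (\<lambda>i. X i \<xi>) = 0" using s denominator_zero_iff[OF tT] by blast
      then show ?case by (simp add: a)
    qed
    then have "\<not> (AE \<xi> in Q. (\<Sum>i\<in>{1..T}. a i * X i \<xi>) \<noteq> 0)"
      using Q.AE_contr by blast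
    then have "bilinear_form {1..T} (gamma_matrix \<rho> T k) a a = 0"
      using gaussian_nondegenerate[OF Q _ gaussian, of a] by auto
    also have "bilinear_form {1..T} (gamma_matrix \<rho> T k) a a = bilinear_form {1..T} (\<lambda>i j. ?b (?w i) (?w j)) a a"
      unfolding bilinear_form_def[of "{1..T}" "gamma_matrix \<rho> T k"]
        bilinear_form_def[of "{1..T}" "\<lambda>i j. ?b (?w i) (?w j)"]
      using k even by (intro sum.cong refl) (simp add: gamma_matrix_eq_bilinear_form)
    also have "\<dots> = ?b (\<lambda>r. \<Sum>i\<in>{1..T}. a i * ?w i r) (\<lambda>r. \<Sum>i\<in>{1..T}. a i * ?w i r)"
      by (rule bilinear_form_sum[symmetric])
    finally have "AE \<omega> in M. \<forall>j\<in>{1..}. weighted_error (\<lambda>r. \<Sum>i\<in>{1..T}. a i * ?w i r) j \<omega> = 0"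
      by (rule degenerate_weighted_error)
    moreover have "weighted_error (\<lambda>r. \<Sum>i\<in>{1..T}. a i * ?w i r) j \<omega> =
        (\<Sum>i\<in>{1..T}. a i * weighted_error (?w i) j \<omega>)" for j \<omega>
      unfolding weighted_error_def sum_distrib_left sum_distrib_right
      by (subst sum.swap) (simp add: mult.assoc)
    ultimately show ?thesis by (simp only: a)
  qed
  have bridges: "AE \<omega> in M. \<forall>s\<in>{t..T-1}. \<forall>j\<in>{1..}. reverse_bridge T t s (\<lambda>i. weighted_error (?w i) j \<omega>) = 0"
    if "t \<in> {2..T-2}" "AE \<xi> in Q. denominator T t (\<lambda>i. X i \<xi>) = 0" for t
    using bridge[OF that(1) _ that(2)] by (subst AE_finite_all) auto
  have "AE \<omega> in M. (AE \<xi> in Q. denominator T t (\<lambda>i. X i \<xi>) = 0) \<longrightarrow>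
      (\<forall>j\<in>{1..}. denominator T t (\<lambda>i. weighted_error (?w i) j \<omega>) = 0)" if "t \<in> {2..T-2}" for t
  proof (cases "AE \<xi> in Q. denominator T t (\<lambda>i. X i \<xi>) = 0")
    case True
    have tT: "t < T" using that by auto
    show ?thesis using bridges[OF that True] by eventually_elim (auto simp: denominator_zero_iff[OF tT])
  qed simp
  then show ?thesis by (subst AE_finite_all) auto
qed

theorem theorem4:
  fixes M :: "'w measure"
    and Q :: "'q measure"
    and T \<tau> :: nat
    and \<mu> :: "nat \<Rightarrow> real"
    and \<delta> :: "nat \<Rightarrow> nat \<Rightarrow> real"
    and \<sigma> :: real
    and \<epsilon> :: "nat \<Rightarrow> nat \<Rightarrow> 'w \<Rightarrow> real"
    and \<rho> :: "int \<Rightarrow> real"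
    and Y :: "nat \<Rightarrow> 'w \<Rightarrow> nat \<Rightarrow> nat \<Rightarrow> real"
    and est :: "nat \<Rightarrow> (nat \<times> nat \<Rightarrow> real) \<Rightarrow> nat"
    and \<tau>hat :: "nat \<Rightarrow> 'w \<Rightarrow> nat"
    and X :: "nat \<Rightarrow> 'q \<Rightarrow> real"
  assumes "prob_space M"
    and "4 \<le> T" and "\<tau> \<in> {1..T}" and "0 < \<sigma>"
    and iid: "prob_space.indep_vars M (\<lambda>_. Pi\<^sub>M {1..T} (\<lambda>_. borel))
               (\<lambda>i \<omega>. \<lambda>t\<in>{1..T}. \<epsilon> i t \<omega>) {1..}"
      "\<And>i. 1 \<le> i \<Longrightarrow>
         distr M (Pi\<^sub>M {1..T} (\<lambda>_. borel)) (\<lambda>\<omega>. \<lambda>t\<in>{1..T}. \<epsilon> i t \<omega>) =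
         distr M (Pi\<^sub>M {1..T} (\<lambda>_. borel)) (\<lambda>\<omega>. \<lambda>t\<in>{1..T}. \<epsilon> 1 t \<omega>)"
    and mean_zero: "\<And>i t. \<lbrakk>1 \<le> i; t \<in> {1..T}\<rbrakk> \<Longrightarrow>
      integrable M (\<epsilon> i t) \<and> prob_space.expectation M (\<epsilon> i t) = 0"
    and unit_variance: "\<And>i t. \<lbrakk>1 \<le> i; t \<in> {1..T}\<rbrakk> \<Longrightarrow>
      prob_space.variance M (\<epsilon> i t) = 1"
    and autocorrelation: "\<And>i t s. \<lbrakk>1 \<le> i; t < T; s \<in> {1..T - t}\<rbrakk> \<Longrightarrow>
      correlation M (\<epsilon> i s) (\<epsilon> i (s + t)) = \<rho> (int t)"
      "\<And>t. \<rho> (- t) = \<rho> t"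
    and fourth_moment: "\<And>t. t \<in> {1..T} \<Longrightarrow> integrable M (\<lambda>\<omega>. \<epsilon> 1 t \<omega> ^ 4)"
    and model: "\<And>N \<omega>. Y N \<omega> = panel \<mu> (\<delta> N) \<sigma> \<tau> (\<lambda>i t. \<epsilon> i t \<omega>)"
    and estimator: "\<And>N. 1 \<le> N \<Longrightarrow>
      est N \<in> Pi\<^sub>M ({1..N} \<times> {1..T}) (\<lambda>_. borel) \<rightarrow>\<^sub>M count_space {1..T}"
      "\<And>N \<omega>. \<tau>hat N \<omega> = est N (\<lambda>(i, t)\<in>{1..N} \<times> {1..T}. Y N \<omega> i t)"
    and consistent: "(\<lambda>N. measure M {\<omega> \<in> space M. \<tau>hat N \<omega> = \<tau>}) \<longlonglongrightarrow> 1"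
    and "prob_space Q"
    and gaussian: "multivariate_normal Q {1..T} X (\<lambda>_. 0) (gamma_matrix \<rho> T \<tau>)"
  shows "weak_conv_in_probability M
           (\<lambda>N \<omega>. bootstrap_law N T (\<tau>hat N \<omega>) (Y N \<omega>))
           (distr Q borel (\<lambda>\<omega>. limit_statistic T (\<lambda>t. X t \<omega>)))"
proof -
  interpret errors: panel_errors M T \<epsilon> \<rho>
    unfolding panel_errors_def panel_errors_axioms_def
    using assms by blast
  interpret Q: prob_space Q by fact
  note T = \<open>4 \<le> T\<close>
  have \<tau>: "1 \<le> \<tau>" "\<tau> \<le> T" using \<open>\<tau> \<in> {1..T}\<close> by auto
  let ?K = "\<lambda>N \<omega>. bootstrap_law N T (\<tau>hat N \<omega>) (Y N \<omega>)"
  let ?L = "distr Q borel (\<lambda>\<omega>. limit_statistic T (\<lambda>t. X t \<omega>))"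
  let ?q = "\<lambda>\<omega> j t. errors.weighted_error (residual_weight T \<tau> t) j \<omega>"
  let ?G = "gamma_matrix \<rho> T \<tau>"
  have X: "X t \<in> borel_measurable Q" if "t \<in> {1..T}" for t
    using gaussian that by (simp add: multivariate_normal_def)
  have \<tau>hat: "\<tau>hat N \<in> M \<rightarrow>\<^sub>M count_space {1..T}" if "1 \<le> N" for N
    using errors.estimated_change_point_measurable[OF estimator(1)[OF that]]
    by (simp add: estimator(2)[abs_def] model)
  show ?thesis
    unfolding weak_conv_in_probability_def
  proof (intro allI impI)
    fix f :: "real \<Rightarrow> real" assume "continuous_on UNIV f \<and> bounded (range f)"
    then have cont: "continuous_on UNIV f" and "bounded (range f)" by auto
    then obtain B where B: "\<And>x. \<bar>f x\<bar> \<le> B" by (auto simp: bounded_iff)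
    have f: "f \<in> borel_measurable borel" by (rule borel_measurable_continuous_onI[OF cont])
    have L: "(\<integral>x. f x \<partial>?L) = (\<integral>\<omega>. f (limit_statistic T (\<lambda>t. X t \<omega>)) \<partial>Q)"
      by (rule integral_distr[OF borel_measurable_limit_statistic[OF T X] f])
    have meas: "(\<lambda>\<omega>. \<integral>x. f x \<partial>?K N \<omega>) \<in> borel_measurable M" for N
    proof (cases "N = 0")
      case True
      \<comment> \<open>Without rows every sum is empty, and the law does not depend on the data.\<close>
      have "?K 0 \<omega> = bootstrap_law 0 T 0 (\<lambda>_ _. 0)" for \<omega>
        by (simp add: bootstrap_law_def resampled_rows_def ratio_statistic_def)
      then show ?thesis using True by simp
    next
      case False
      then show ?thesis
        unfolding model
        by (intro errors.bootstrap_integral_measurable[OF T _ f] \<tau>hat) auto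
    qed
    show "tendsto_in_probability M (\<lambda>N \<omega>. \<integral>x. f x \<partial>?K N \<omega>) (\<integral>x. f x \<partial>?L)"
      unfolding tendsto_in_probability_def
    proof (intro conjI allI impI meas)
      fix \<eta> :: real assume "0 < \<eta>"
      obtain d N0 where d: "0 < d" and close: "\<forall>N\<ge>N0. \<forall>q. moments_close T ?G d N q \<longrightarrow>
          (\<forall>t\<in>{2..T-2}. (AE \<omega> in Q. denominator T t (\<lambda>i. X i \<omega>) = 0) \<longrightarrow>
            (\<forall>j\<in>{1..N}. denominator T t (q j) = 0)) \<longrightarrow>
          \<bar>(\<integral>h. f (limit_statistic T (resampled_sum N q h)) \<partial>measure_pmf (resampling N)) -
            (\<integral>\<omega>. f (limit_statistic T (\<lambda>t. X t \<omega>)) \<partial>Q)\<bar> \<le> \<eta>"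
        using resampled_statistic_uniform[OF T \<open>prob_space Q\<close> gaussian cont B \<open>0 < \<eta>\<close>]
        by (elim exE conjE) (rule that)
      \<comment> \<open>Off \<open>bad N\<close>, \<open>miss N\<close> and a null set, the conditional expectation is within \<open>\<eta>\<close> of its limit.\<close>
      define bad where "bad N = {\<omega>\<in>space M. \<not> moments_close T ?G d N (?q \<omega>)}" for N
      define miss where "miss N = {\<omega>\<in>space M. \<tau>hat N \<omega> \<noteq> \<tau>}" for N
      have moments_cong: "moments_close T ?G d N q \<longleftrightarrow>
          moments_close T (\<lambda>s t. bilinear_form {1..T} (\<lambda>r u. \<rho> (int u - int r))
            (residual_weight T \<tau> s) (residual_weight T \<tau> t)) d N q" for N q
        unfolding moments_close_def
        using gamma_matrix_eq_bilinear_form[where \<rho> = \<rho>, OF \<tau> _ _ autocorrelation(2)]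
        by (intro ball_cong conj_cong refl) (simp only:)
      have bad: "errors.vanishing bad"
        using errors.moments_close_with_high_probability[OF d, of "residual_weight T \<tau>"]
        unfolding bad_def[abs_def] moments_cong .
      have miss_events: "miss N \<in> sets M" if "1 \<le> N" for N
      proof -
        have "miss N = \<tau>hat N -` ({1..T} - {\<tau>}) \<inter> space M"
          using measurable_space[OF \<tau>hat[OF that]] by (auto simp: miss_def)
        then show ?thesis using measurable_sets[OF \<tau>hat[OF that], of "{1..T} - {\<tau>}"] by simp
      qed
      have miss_prob: "errors.prob (miss N) = 1 - errors.prob {\<omega>\<in>space M. \<tau>hat N \<omega> = \<tau>}" if "1 \<le> N" for N
      proof -
        have eq: "{\<omega>\<in>space M. \<tau>hat N \<omega> = \<tau>} = space M - miss N" by (auto simp: miss_def)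
        show ?thesis unfolding eq using errors.prob_compl[OF miss_events[OF that]] by simp
      qed
      have null: "AE \<omega> in M. \<forall>t\<in>{2..T-2}. (AE \<xi> in Q. denominator T t (\<lambda>i. X i \<xi>) = 0) \<longrightarrow>
          (\<forall>j\<in>{1..}. denominator T t (?q \<omega> j) = 0)"
        by (rule errors.degenerate_denominators_vanish[OF T \<open>\<tau> \<in> {1..T}\<close> \<open>prob_space Q\<close> gaussian])
      have good: "\<bar>(\<integral>x. f x \<partial>?K N \<omega>) - (\<integral>x. f x \<partial>?L)\<bar> \<le> \<eta>"
        if N: "N0 \<le> N" "1 \<le> N" and hat: "\<tau>hat N \<omega> = \<tau>" and moments: "moments_close T ?G d N (?q \<omega>)"
          and den: "\<forall>t\<in>{2..T-2}. (AE \<xi> in Q. denominator T t (\<lambda>i. X i \<xi>) = 0) \<longrightarrow>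
            (\<forall>j\<in>{1..}. denominator T t (?q \<omega> j) = 0)" for N \<omega>
      proof -
        have res: "residual_sum T \<tau> (Y N \<omega> j) t / \<sigma> = ?q \<omega> j t" if "t \<in> {1..T}" for j t
          using residual_sum_panel[of \<tau> T t \<mu> "\<delta> N" \<sigma> "\<lambda>i t. \<epsilon> i t \<omega>" j]
            residual_sum_weights[of \<tau> T t "\<lambda>t. \<epsilon> j t \<omega>"] \<tau> that \<open>0 < \<sigma>\<close>
          by (simp add: model errors.weighted_error_def)
        have "(\<integral>x. f x \<partial>?K N \<omega>) =
            (\<integral>h. f (limit_statistic T (resampled_sum N (?q \<omega>) h)) \<partial>measure_pmf (resampling N))"
          unfolding hat integral_bootstrap_law[OF N(2) \<open>0 < \<sigma>\<close> f]
          by (intro Bochner_Integration.integral_cong refl arg_cong[of _ _ f] limit_statistic_cong[OF T])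
            (simp add: resampled_sum_def res)
        moreover have "\<bar>(\<integral>h. f (limit_statistic T (resampled_sum N (?q \<omega>) h)) \<partial>measure_pmf (resampling N)) -
            (\<integral>\<omega>. f (limit_statistic T (\<lambda>t. X t \<omega>)) \<partial>Q)\<bar> \<le> \<eta>"
          using den by (intro close[rule_format] N moments) auto
        ultimately show ?thesis by (simp only: L)
      qed
      have bound: "errors.prob {\<omega>\<in>space M. \<eta> < \<bar>(\<integral>x. f x \<partial>?K N \<omega>) - (\<integral>x. f x \<partial>?L)\<bar>}
          \<le> errors.prob (bad N) + (1 - errors.prob {\<omega>\<in>space M. \<tau>hat N \<omega> = \<tau>})" if N: "N0 \<le> N" "1 \<le> N" for N
      proof -
        have badN: "bad N \<in> sets M" using bad by (simp add: errors.vanishing_def)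
        have "errors.prob {\<omega>\<in>space M. \<eta> < \<bar>(\<integral>x. f x \<partial>?K N \<omega>) - (\<integral>x. f x \<partial>?L)\<bar>}
            \<le> errors.prob (bad N \<union> miss N)"
        proof (rule errors.finite_measure_mono_AE)
          show "AE \<omega> in M. \<omega> \<in> {\<omega>\<in>space M. \<eta> < \<bar>(\<integral>x. f x \<partial>?K N \<omega>) - (\<integral>x. f x \<partial>?L)\<bar>} \<longrightarrow>
              \<omega> \<in> bad N \<union> miss N"
            using null
          proof eventually_elim
            case (elim \<omega>)
            then show ?case using good[OF N, of \<omega>] by (auto simp: bad_def miss_def not_less[symmetric])
          qed
          show "bad N \<union> miss N \<in> sets M" using badN miss_events[OF N(2)] by auto
        qed
        also have "\<dots> \<le> errors.prob (bad N) + errors.prob (miss N)"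
          by (rule measure_Un_le[OF badN miss_events[OF N(2)]])
        finally show ?thesis by (simp only: miss_prob[OF N(2)])
      qed
      have "(\<lambda>N. errors.prob (bad N) + (1 - errors.prob {\<omega>\<in>space M. \<tau>hat N \<omega> = \<tau>})) \<longlonglongrightarrow> 0 + (1 - 1)"
        using bad by (intro tendsto_add tendsto_diff tendsto_const consistent) (simp add: errors.vanishing_def)
      then have lim: "(\<lambda>N. errors.prob (bad N) + (1 - errors.prob {\<omega>\<in>space M. \<tau>hat N \<omega> = \<tau>})) \<longlonglongrightarrow> 0"
        by simp
      show "(\<lambda>N. errors.prob {\<omega>\<in>space M. \<eta> < \<bar>(\<integral>x. f x \<partial>?K N \<omega>) - (\<integral>x. f x \<partial>?L)\<bar>}) \<longlonglongrightarrow> 0"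
      proof (rule Lim_null_comparison[OF _ lim])
        show "\<forall>\<^sub>F N in sequentially. norm (errors.prob {\<omega>\<in>space M. \<eta> < \<bar>(\<integral>x. f x \<partial>?K N \<omega>) - (\<integral>x. f x \<partial>?L)\<bar>})
            \<le> errors.prob (bad N) + (1 - errors.prob {\<omega>\<in>space M. \<tau>hat N \<omega> = \<tau>})"
          using eventually_ge_at_top[of "max 1 N0"]
          by eventually_elim (use bound in auto)
      qed
    qed
  qed
qed

end
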